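(* Let $P$ be a very homogeneous polynomial of degree $(m^+,0)$, $g\in G$, $z=g^{-1}z_0$, and $\mu=-u'+\frac{u_{z^\perp}}{2u_{z^\perp}^2}+\frac{u_z}{2u_z^2}$, with $\mu_M$ its orthogonal projection to $M\otimes\mathbb R$. Then, identifying $\mathbb C[D_L^2]\cong\mathbb C[D_M^2]$, $$\Theta_{L,2}(\tau,g,P)=\frac1{2u_{z^\perp}^2}\sum_{c,d\in\mathbb Z^{1\times2}}\sum_{h_1,h_2}\exp\Big(-\frac{\pi}{2u_{z^\perp}^2}\mathrm{tr}\big((c\tau+d)^t(c\bar\tau+d)y^{-1}\big)\Big)\frac{[(c\bar\tau+d)y^{-1}]_1^{h_1}[(c\bar\tau+d)y^{-1}]_2^{h_2}}{(-2i)^{h_1+h_2}}\,\Theta_{M,2}(\tau,\mu_Md,-\mu_Mc,g_w,P_{g_w,h_1,h_2}),$$ where $[\,\cdot\,]_j$ is the $j$-th entry of a $1\times2$ row and $\mu_Mc=(c_1\mu_M,c_2\mu_M)$.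
   Context: Setup: $L$ even lattice of signature $(b,2)$, $L=M\oplus U$ orthogonally, $U$ spanned by $u,u'$ with $q(u)=q(u')=0$, $(u,u')=1$, so $M$ has signature $(b-1,1)$; orthogonal projection $L'\to M'$ induces an isomorphism $D_L\cong D_M$ ($D_L=L'/L$). $V=L\otimes\mathbb R$ with orthogonal basis $e_1,\dots,e_{b+2}$ ($(e_i,e_i)=1$ for $i\le b$, $-1$ otherwise), $G=\mathrm{SO}(V)$, $z_0=\mathrm{span}(e_{b+1},e_{b+2})$; pairs $\mathbf v\in V^2$, coordinates $x_{i,j}$ identify $V^2\cong\mathbb R^{(b+2)\times2}$; $q(\mathbf v)=((v_i,v_j)/2)$; $\mathrm{tr}(\mathbf v,\mathbf w)=(v_1,w_1)+(v_2,w_2)$; $e(t)=e^{2\pi it}$; $\tau=x+iy\in\mathbb H_2$; $\mathrm{tr}(\Delta y^{-1})=\sum_{i}\sum_{j,l}(y^{-1})_{jl}\partial^2/\partial x_{i,j}\partial x_{i,l}$ with $\exp(-\mathrm{tr}(\Delta y^{-1})/8\pi)$ the power series. Very homogeneous of degree $(m^+,0)$: $P$ depends only on the first $b$ rows and $P(\mathbf xN)=\det N^{m^+}P(\mathbf x)$ for $N\in\mathbb C^{2\times2}$. $\Theta_{L,2}(\tau,g,P)=\sum_{\sigma\in D_L^2}\det y\sum_{\boldsymbol\lambda\in\sigma+L^2}\exp(-\frac{1}{8\pi}\mathrm{tr}(\Delta y^{-1}))(P)(g\boldsymbol\lambda)e(\mathrm{tr}(q(\boldsymbol\lambda_{z^\perp})\tau)+\mathrm{tr}(q(\boldsymbol\lambda_z)\bar\tau))\mathfrak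 e_\sigma$. Let $w$ be the orthogonal complement of $u_z$ in $z$, $w^\perp$ that of $u_{z^\perp}$ in $z^\perp$, $g_w(v)=g(v_{w^\perp}+v_w)$. The split polynomials $P_{g_w,h_1,h_2}$ (on $g(w^\perp)^2$, extended to $V^2$ by precomposing with orthogonal projection) are uniquely determined by $P(g(\mathbf v))=\sum_{h_1,h_2}(v_1,u_{z^\perp})^{h_1}(v_2,u_{z^\perp})^{h_2}P_{g_w,h_1,h_2}(g_w(\mathbf v))$. For a polynomial $R$ on $\mathbb R^{(b+2)\times2}$ and $\boldsymbol\alpha,\boldsymbol\beta\in(M\otimes\mathbb R)^2$: $\Theta_{M,2}(\tau,\boldsymbol\alpha,\boldsymbol\beta,g_w,R)=\sum_{\sigma\in D_M^2}\det y^{1/2}\sum_{\boldsymbol\lambda\in\sigma+M^2}\exp(-\frac{1}{8\pi}\mathrm{tr}(\Delta y^{-1}))(R)(g_w(\boldsymbol\lambda+\boldsymbol\beta))\,e\big(\mathrm{tr}(q((\boldsymbol\lambda+\boldsymbol\beta)_{w^\perp})\tau)+\mathrm{tr}(q((\boldsymbol\lambda+\boldsymbol\beta)_w)\bar\tau)-\mathrm{tr}(\boldsymbol\lambda+\boldsymbol\beta/2,\boldsymbol\alpha)\big)\mathfrak e_\sigma$. *)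

theory Defs
  imports "HOL-Analysis.Analysis"
begin

text \<open>The real quadratic space V = R^(b+2): coordinates indexed by 'p + bool,
  where the b indices Inl p carry (e_i,e_i)=1 and the two indices Inr False, Inr True
  (i.e. e_(b+1), e_(b+2)) carry (e_i,e_i) = -1.\<close>

definition sgnc :: "('p::finite + bool) \<Rightarrow> real" where
  "sgnc i = (case i of Inl _ \<Rightarrow> 1 | Inr _ \<Rightarrow> -1)"

definition bf :: "real^('p::finite + bool) \<Rightarrow> real^('p + bool) \<Rightarrow> real" where
  "bf x y = (\<Sum>i\<in>UNIV. sgnc i * x$i * y$i)"

definition qf :: "real^('p::finite + bool) \<Rightarrow> real" where
  "qf x = bf x x / 2"

text \<open>z_0 = span(e_(b+1), e_(b+2)).\<close>
definition z0 :: "(real^('p::finite + bool)) set" where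
  "z0 = {x. \<forall>p. x $ Inl p = 0}"

text \<open>G = SO(V).\<close>
definition SO_V :: "real^('p::finite + bool)^('p + bool) \<Rightarrow> bool" where
  "SO_V g \<longleftrightarrow> (\<forall>x y. bf (g *v x) (g *v y) = bf x y) \<and> det g = 1"

definition perpV :: "(real^('p::finite + bool)) set \<Rightarrow> (real^('p + bool)) set" where
  "perpV S = {x. \<forall>s\<in>S. bf x s = 0}"

text \<open>Orthogonal projection (w.r.t. the form) onto a (nondegenerate) subspace.\<close>
definition projV :: "(real^('p::finite + bool)) set \<Rightarrow> real^('p + bool) \<Rightarrow> real^('p + bool)" where
  "projV S v = (THE s. s \<in> S \<and> (\<forall>t\<in>S. bf (v - s) t = 0))"

text \<open>Lattices: full-rank discrete subgroups (Z-span of a basis of V).\<close>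
definition is_lattice :: "(real^('p::finite + bool)) set \<Rightarrow> bool" where
  "is_lattice L \<longleftrightarrow> (\<exists>B::real^('p + bool)^('p + bool). invertible B \<and>
      L = range (\<lambda>k::int^('p + bool). B *v (\<chi> i. of_int (k$i))))"

definition even_lattice :: "(real^('p::finite + bool)) set \<Rightarrow> bool" where
  "even_lattice L \<longleftrightarrow> is_lattice L \<and> (\<forall>x\<in>L. qf x \<in> \<int>)"

text \<open>Dual lattice L' inside V, and dual M' of a sublattice M inside M \<otimes> R = span M.\<close>
definition dualV :: "(real^('p::finite + bool)) set \<Rightarrow> (real^('p + bool)) set" where
  "dualV L = {x \<in> span L. \<forall>l\<in>L. bf x l \<in> \<int>}"

text \<open>Pairs of vectors v = (v_1, v_2) in V^2 are elements of (real^'i)^2; v$1, v$2.\<close>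
definition mapv :: "('a \<Rightarrow> 'b) \<Rightarrow> 'a^2 \<Rightarrow> 'b^2" where
  "mapv f v = (\<chi> j. f (v$j))"

text \<open>The matrix (x_(i,j)) in R^((b+2) x 2) of a pair, complexified.\<close>
definition cmat :: "(real^('p::finite + bool))^2 \<Rightarrow> complex^2^('p + bool)" where
  "cmat v = (\<chi> i j. complex_of_real (v$j$i))"

text \<open>Polynomial functions in finitely many complex variables.\<close>
inductive mpoly_fun :: "(('k \<Rightarrow> complex) \<Rightarrow> complex) \<Rightarrow> bool" where
  const: "mpoly_fun (\<lambda>f. c)"
| var: "mpoly_fun (\<lambda>f. f k)"
| add: "mpoly_fun p \<Longrightarrow> mpoly_fun q \<Longrightarrow> mpoly_fun (\<lambda>f. p f + q f)"
| mult: "mpoly_fun p \<Longrightarrow> mpoly_fun q \<Longrightarrow> mpoly_fun (\<lambda>f. p f * q f)"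

text \<open>Polynomials on C^((b+2) x 2) (hence on R^((b+2) x 2) by restriction).\<close>
definition poly_mat :: "(complex^2^('i::finite) \<Rightarrow> complex) \<Rightarrow> bool" where
  "poly_mat P \<longleftrightarrow> mpoly_fun (\<lambda>f::'i \<times> 2 \<Rightarrow> complex. P (\<chi> i j. f (i, j)))"

text \<open>Very homogeneous of degree (m^+, 0).\<close>
definition very_homog :: "nat \<Rightarrow> (complex^2^('p::finite + bool) \<Rightarrow> complex) \<Rightarrow> bool" where
  "very_homog m P \<longleftrightarrow> poly_mat P
     \<and> (\<forall>x x'. (\<forall>p. x $ Inl p = x' $ Inl p) \<longrightarrow> P x = P x')
     \<and> (\<forall>x (N::complex^2^2). P (x ** N) = det N ^ m * P x)"

text \<open>Partial derivative with respect to x_(i,j).\<close>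
definition pd :: "'i::finite \<Rightarrow> 2 \<Rightarrow> (complex^2^'i \<Rightarrow> complex) \<Rightarrow> complex^2^'i \<Rightarrow> complex" where
  "pd i j R x = deriv (\<lambda>t. R (x + (\<chi> a b. if a = i \<and> b = j then t else 0))) 0"

text \<open>tr(Delta y^(-1)) = sum_i sum_(j,l) (y^(-1))_(jl) d^2/dx_(i,j) dx_(i,l).\<close>
definition lapY :: "real^2^2 \<Rightarrow> (complex^2^('i::finite) \<Rightarrow> complex) \<Rightarrow> complex^2^'i \<Rightarrow> complex" where
  "lapY Yi R x = (\<Sum>i\<in>UNIV. \<Sum>j\<in>UNIV. \<Sum>l\<in>UNIV. complex_of_real (Yi$j$l) * pd i j (pd i l R) x)"

text \<open>exp(-tr(Delta y^(-1))/(8 pi)) as a power series of operators.\<close>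
definition heatop :: "real^2^2 \<Rightarrow> (complex^2^('i::finite) \<Rightarrow> complex) \<Rightarrow> complex^2^'i \<Rightarrow> complex" where
  "heatop Yi R x = (\<Sum>k. complex_of_real ((- 1 / (8 * pi)) ^ k / fact k) * ((lapY Yi ^^ k) R) x)"

definition ee :: "complex \<Rightarrow> complex" where
  "ee t = exp (2 * pi * \<i> * t)"

text \<open>tr(q(v) tau) with q(v) = ((v_i,v_j)/2).\<close>
definition trq :: "(real^('p::finite + bool))^2 \<Rightarrow> complex^2^2 \<Rightarrow> complex" where
  "trq v \<tau> = (\<Sum>j\<in>UNIV. \<Sum>k\<in>UNIV. complex_of_real (bf (v$j) (v$k) / 2) * \<tau>$k$j)"

text \<open>tr(v, w) = (v_1,w_1) + (v_2,w_2).\<close>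
definition trv :: "(real^('p::finite + bool))^2 \<Rightarrow> (real^('p + bool))^2 \<Rightarrow> real" where
  "trv v w = (\<Sum>j\<in>UNIV. bf (v$j) (w$j))"

definition Imat :: "complex^2^2 \<Rightarrow> real^2^2" where
  "Imat \<tau> = (\<chi> a b. Im (\<tau>$a$b))"

definition cnjmat :: "complex^2^2 \<Rightarrow> complex^2^2" where
  "cnjmat \<tau> = (\<chi> a b. cnj (\<tau>$a$b))"

text \<open>Siegel upper half space H_2.\<close>
definition siegelH2 :: "complex^2^2 \<Rightarrow> bool" where
  "siegelH2 \<tau> \<longleftrightarrow> transpose \<tau> = \<tau> \<and> (\<forall>x::real^2. x \<noteq> 0 \<longrightarrow> x \<bullet> (Imat \<tau> *v x) > 0)"

text \<open>Coset sigma + L^2 (sigma a pair of representatives).\<close>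
definition coset2 :: "(real^('p::finite + bool))^2 \<Rightarrow> (real^('p + bool)) set \<Rightarrow> ((real^('p + bool))^2) set" where
  "coset2 \<sigma> L = {v. \<forall>j. v$j - \<sigma>$j \<in> L}"

text \<open>Component sigma (sigma in (L')^2) of Theta_(L,2)(tau, g, P).\<close>
definition ThetaL :: "(real^('p::finite + bool)) set \<Rightarrow> complex^2^2 \<Rightarrow> real^('p + bool)^('p + bool)
    \<Rightarrow> (complex^2^('p + bool) \<Rightarrow> complex) \<Rightarrow> (real^('p + bool))^2 \<Rightarrow> complex" where
  "ThetaL L \<tau> g P \<sigma> =
     (let y = Imat \<tau>; z = {x. g *v x \<in> z0} in
      complex_of_real (det y) *
      infsum (\<lambda>lam. heatop (matrix_inv y) P (cmat (mapv ((*v) g) lam))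
                    * ee (trq (mapv (projV (perpV z)) lam) \<tau> + trq (mapv (projV z) lam) (cnjmat \<tau>)))
             (coset2 \<sigma> L))"

text \<open>Component sigma (sigma in (M')^2) of Theta_(M,2)(tau, alpha, beta, g_w, R);
  here w, wp are the subspaces w and w^perp, and g_w(v) = g(v_(w^perp) + v_w).\<close>
definition ThetaM :: "(real^('p::finite + bool)) set \<Rightarrow> complex^2^2 \<Rightarrow> (real^('p + bool))^2 \<Rightarrow> (real^('p + bool))^2
    \<Rightarrow> real^('p + bool)^('p + bool) \<Rightarrow> (real^('p + bool)) set \<Rightarrow> (real^('p + bool)) set
    \<Rightarrow> (complex^2^('p + bool) \<Rightarrow> complex) \<Rightarrow> (real^('p + bool))^2 \<Rightarrow> complex" where
  "ThetaM M \<tau> \<alpha> \<beta> g w wp R \<sigma> =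
     (let y = Imat \<tau>; gw = (\<lambda>v. g *v (projV wp v + projV w v)) in
      complex_of_real (sqrt (det y)) *
      infsum (\<lambda>lam. heatop (matrix_inv y) R (cmat (mapv gw (lam + \<beta>)))
                    * ee (trq (mapv (projV wp) (lam + \<beta>)) \<tau> + trq (mapv (projV w) (lam + \<beta>)) (cnjmat \<tau>)
                          - complex_of_real (trv (lam + (1/2) *\<^sub>R \<beta>) \<alpha>)))
             (coset2 \<sigma> M))"

text \<open>Complexified action of a real (b+2)x(b+2) matrix on the columns of x.\<close>
definition capply :: "real^('i::finite)^'i \<Rightarrow> complex^2^'i \<Rightarrow> complex^2^'i" where
  "capply A x = (\<chi> i j. \<Sum>k\<in>UNIV. complex_of_real (A$i$k) * x$k$j)"

end

theory Submission
  imports Defs "HOL-Probability.Probability" "HOL-Analysis.FPS_Convergence"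
begin

text \<open>
  Writing \<open>\<lambda>\<^sub>j = k\<^sub>j + a\<^sub>j u + c\<^sub>j u'\<close> with \<open>k \<in> \<sigma>\<^sub>M + M\<^sup>2\<close> and \<open>a, c \<in> \<int>\<^sup>2\<close>, the theorem is Poisson summation in \<open>a\<close>, with
  dual variable \<open>d\<close>. Since \<open>u\<close> is isotropic, the exponent is quadratic in \<open>a\<close> with the real positive
  definite form \<open>2 N y\<close>, where \<open>N = (u\<^sub>z\<^sub>\<bottom>, u\<^sub>z\<^sub>\<bottom>) = - (u\<^sub>z, u\<^sub>z)\<close>, and it depends on \<open>a\<close> only through
  \<open>X\<^sub>j = (\<lambda>\<^sub>j, u\<^sub>z\<^sub>\<bottom>)\<close>. The operator \<open>exp(- tr(\<Delta> y\<inverse>) / 8\<pi>)\<close> is multiplicative on the split pieces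
  \<open>X\<^sub>1\<^sup>h X\<^sub>2\<^sup>l P\<^sub>h\<^sub>l\<close>, because \<open>P\<^sub>h\<^sub>l\<close> is constant in the direction \<open>u\<^sub>z\<^sub>\<bottom>\<close>; on the monomials in \<open>X\<close> it produces exactly
  the polynomials whose products with the Gaussian have monomials times Gaussians as Fourier
  transforms. All of these are handled at once by the generating function
  \<open>exp(t X - N t y\<inverse> t / 8\<pi>)\<close>, which turns the polynomial Poisson formula into the inversion
  formula of a two-variable theta function with complex characteristic.
\<close>

section \<open>Inversion of Gaussian theta series\<close>

text \<open>The vector \<open>\<mu>\<close> is forced by the geometry: the projections
  \<open>Wp\<close> and \<open>Wn\<close> to \<open>wp\<close> and \<open>w\<close> kill
  \<open>u\<close>, and \<open>\<mu>M\<close> is the element of \<open>span M\<close> with the same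
  projections as \<open>- u'\<close>. A multiple c of \<open>u'\<close> can thus only enter the
  remaining sum as a shift by \<open>- c \<mu>M\<close>, and the whole \<open>w\<close>-part of a
  summand, its polynomial included, is constant in the variable of the Poisson step.

  The characteristic in the inversion formula must be complex for two reasons: it contains c times
  the conjugate of \<tau>, because (\<lambda>, \<open>uz\<close>) = c - X, and it absorbs the formal
  variable t. Completing the square on the dual side produces a term quadratic in t, exactly
  opposite to the one that the heat operator contributes; this cancellation is why plain monomials
  come out.

  Convergence is a separate obstacle: \<open>gw\<close> forgets the directions of \<open>uz\<close>
  and \<open>uzp\<close>, yet the terms must form one absolutely convergent family over the coset of
  \<open>M\<close> and all c, d. A point of \<open>span M\<close> is still determined by its image
  under \<open>gw\<close>: only a multiple of \<open>u\<close> is lost, and orthogonality to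
  \<open>u'\<close> fixes it.\<close>

text \<open>Test against powers of a trigonometric polynomial \<open>p\<close> that exceeds 1 only
  near \<open>x0\<close>: all these integrals vanish, yet the part near \<open>x0\<close> would grow
  geometrically if \<open>f x0\<close> were nonzero. No periodicity of \<open>f\<close> is assumed,
  hence the restriction to interior points.\<close>

lemma vanishing_fourier_coefficients:
  fixes f :: "real \<Rightarrow> complex"
  assumes cont: "continuous_on {0..1} f"
    and coef: "\<And>n::int. integral {0..1} (\<lambda>x. f x * cis (2 * pi * of_int n * x)) = 0"
    and x0: "0 < x0" "x0 < 1"
  shows "f x0 = 0"
proof (rule ccontr)
  assume nz: "f x0 \<noteq> 0"
  define h where "h = (\<lambda>x. Re (f x / f x0))"
  have conth: "continuous_on {0..1} h"
    unfolding h_def using nz by (intro continuous_intros cont) auto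
  have h0: "h x0 = 1" using nz by (simp add: h_def)
  obtain C where C: "\<And>x. x \<in> {0..1} \<Longrightarrow> \<bar>h x\<bar> \<le> C"
  proof -
    have "bounded (h ` {0..1})"
      using compact_imp_bounded compact_continuous_image conth by blast
    then show ?thesis using that unfolding bounded_iff by (metis imageI real_norm_def)
  qed
  obtain d1 where d1: "d1 > 0" "\<And>x. x \<in> {0..1} \<Longrightarrow> \<bar>x - x0\<bar> < d1 \<Longrightarrow> \<bar>h x - h x0\<bar> < 1/2"
  proof -
    have "x0 \<in> {0..1}" using x0 by auto
    from conth[unfolded continuous_on_iff, rule_format, OF this, of "1/2"]
    show ?thesis using that by (auto simp: dist_real_def)
  qed
  \<comment> \<open>The bound 1/4 keeps the cosine nonnegative within distance \<open>d\<close> of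
    \<open>x0\<close>; the last two entries keep that neighbourhood inside the unit
    interval.\<close>
  define d where "d = Min {d1/2, 1/4, x0, 1 - x0}"
  have d: "d > 0" "d < d1" "d \<le> 1/4" "d \<le> x0" "d \<le> 1 - x0"
    unfolding d_def using d1 x0 by (auto simp: min_def)
  define c where "c = cos (2 * pi * d)"
  have c1: "c < 1" 
  proof -
    have "2 * pi * d \<le> pi" using mult_left_mono[OF d(3), of "2 * pi"] by simp
    then have "cos (2 * pi * d) < cos 0" using d by (intro cos_monotone_0_pi) auto
    then show ?thesis by (simp add: c_def)
  qed
  have c0: "c \<ge> 0" unfolding c_def
  proof (rule cos_ge_zero)
    show "- (pi / 2) \<le> 2 * pi * d" using d(1) pi_gt_zero by (smt (verit) mult_nonneg_nonneg divide_nonneg_nonneg)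
    show "2 * pi * d \<le> pi / 2" using mult_left_mono[OF d(3), of "2 * pi"] by simp
  qed
  \<comment> \<open>With this offset \<open>c + e = 1 - e\<close>, so \<open>p\<close> stays in
    [-1, 1] away from \<open>x0\<close>, whereas \<open>p x0 = 1 + e\<close>.\<close>
  define e where "e = (1 - c) / 2"
  have e: "e > 0" "e \<le> 1/2" "c + e = 1 - e" using c1 c0 by (auto simp: e_def field_simps)
  define p where "p = (\<lambda>x. e + cos (2 * pi * (x - x0)))"
  have contp: "continuous_on S p" for S unfolding p_def by (intro continuous_intros)
  obtain d2 where d2: "d2 > 0" "\<And>t. \<bar>t\<bar> < d2 \<Longrightarrow> cos (2 * pi * t) > 1 - e / 2"
  proof -
    have "isCont (\<lambda>t. cos (2 * pi * t)) 0" by (intro continuous_intros)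
    then have "\<exists>d>0. \<forall>t. dist t 0 < d \<longrightarrow> dist (cos (2 * pi * t)) (cos (2 * pi * 0)) < e/2"
      using e unfolding continuous_at_eps_delta by (metis half_gt_zero_iff)
    then obtain d where d: "d > 0" "\<And>t. \<bar>t\<bar> < d \<Longrightarrow> \<bar>cos (2 * pi * t) - 1\<bar> < e/2"
      by (auto simp: dist_real_def)
    show ?thesis
    proof (rule that[OF d(1)])
      fix t assume "\<bar>t\<bar> < d"
      from d(2)[OF this] show "cos (2 * pi * t) > 1 - e/2" by linarith
    qed
  qed
  define r where "r = min d (d2/2)"
  have r: "r > 0" "r \<le> d" "r < d2" using d d2 by (auto simp: r_def)
  \<comment> \<open>The frequency \<open>n\<close> must vary in the induction, because each cosine
    factor moves it by one in both directions.\<close>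
  have zero: "integral {0..1} (\<lambda>x. f x * cis (2 * pi * of_int n * x) * complex_of_real (p x ^ k)) = 0" for n k
  proof (induction k arbitrary: n)
    case 0 then show ?case using coef by simp
  next
    case (Suc k)
    let ?g = "\<lambda>n x. f x * cis (2 * pi * of_int n * x) * complex_of_real (p x ^ k)"
    have int: "?g n integrable_on {0..1}" for n
      by (intro integrable_continuous_real continuous_intros cont contp)
    have hi: "(?g n has_integral 0) {0..1}" for n
      using int[of n] Suc.IH[of n] by (simp add: has_integral_integral)
    have eq: "f x * cis (2 * pi * of_int n * x) * complex_of_real (p x ^ Suc k) =
      of_real e * ?g n x + (cis (- 2 * pi * x0) / 2) * ?g (n+1) x + (cis (2 * pi * x0) / 2) * ?g (n - 1) x" for x
    proof -
      have 1: "complex_of_real (cos (2 * pi * (x - x0))) = (cis (2 * pi * (x - x0)) + cis (- (2 * pi * (x - x0)))) / 2"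
        by (simp add: complex_eq_iff)
      have 2: "cis (2 * pi * of_int n * x) * cis (2 * pi * (x - x0)) = cis (- 2 * pi * x0) * cis (2 * pi * of_int (n+1) * x)"
        by (simp add: cis_mult algebra_simps)
      have 3: "cis (2 * pi * of_int n * x) * cis (- (2 * pi * (x - x0))) = cis (2 * pi * x0) * cis (2 * pi * of_int (n-1) * x)"
        by (simp add: cis_mult algebra_simps)
      have "cis (2 * pi * of_int n * x) * complex_of_real (p x) = of_real e * cis (2 * pi * of_int n * x) +
         cis (- 2 * pi * x0) * cis (2 * pi * of_int (n+1) * x) / 2 + cis (2 * pi * x0) * cis (2 * pi * of_int (n-1) * x) / 2"
        unfolding p_def of_real_add 1 using 2 3 by (simp add: algebra_simps add_divide_distrib)
      then have "f x * (cis (2 * pi * of_int n * x) * complex_of_real (p x)) * complex_of_real (p x ^ k) = f x * (of_real e * cis (2 * pi * of_int n * x) +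
         cis (- 2 * pi * x0) * cis (2 * pi * of_int (n+1) * x) / 2 + cis (2 * pi * x0) * cis (2 * pi * of_int (n-1) * x) / 2) * complex_of_real (p x ^ k)"
        by simp
      then show ?thesis by (simp add: algebra_simps)
    qed
    have "((\<lambda>x. f x * cis (2 * pi * of_int n * x) * complex_of_real (p x ^ Suc k)) has_integral 
       (of_real e * 0 + (cis (- 2 * pi * x0) / 2) * 0 + (cis (2 * pi * x0) / 2) * 0)) {0..1}"
      unfolding eq by (intro has_integral_add has_integral_mult_right hi)
    then show ?case by (simp add: integral_unique)
  qed
  have hz: "((\<lambda>x. h x * p x ^ k) has_integral 0) {0..1}" for k
  proof -
    have "((\<lambda>x. f x * complex_of_real (p x ^ k)) has_integral 0) {0..1}"
    proof -
      have "(\<lambda>x. f x * complex_of_real (p x ^ k)) integrable_on {0..1}"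
        by (intro integrable_continuous_real continuous_intros cont contp)
      then show ?thesis using zero[of 0 k] by (simp add: has_integral_integral)
    qed
    then have "((\<lambda>x. f x * complex_of_real (p x ^ k) / f x0) has_integral 0 / f x0) {0..1}"
      by (rule has_integral_divide)
    then have "((\<lambda>x. Re (f x * complex_of_real (p x ^ k) / f x0)) has_integral Re (0 / f x0)) {0..1}"
      by (rule has_integral_Re)
    moreover have "Re (f x * complex_of_real (p x ^ k) / f x0) = h x * p x ^ k" for x
    proof -
      have "f x * complex_of_real (p x ^ k) / f x0 = (f x / f x0) * complex_of_real (p x ^ k)" by simp
      then show ?thesis unfolding h_def by (metis Re_complex_of_real Im_complex_of_real times_complex.simps(1) mult_zero_right diff_zero)
    qed
    ultimately show ?thesis by simp
  qed
  \<comment> \<open>Three zones: within \<open>r\<close> the integrand is large, between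
    \<open>r\<close> and \<open>d\<close> it is nonnegative, beyond \<open>d\<close> it is bounded
    by \<open>C\<close> for every \<open>k\<close>.\<close>
  have bound: "h x * p x ^ k \<ge> (if x \<in> {x0 - r..x0 + r} then (1/2) * (1 + e/2) ^ k else 0) - C"
    if x: "x \<in> {0..1}" for x k
  proof -
    have C0: "C \<ge> 0" using C[OF x] by linarith
    consider "\<bar>x - x0\<bar> \<le> r" | "\<bar>x - x0\<bar> > r" "\<bar>x - x0\<bar> \<le> d" | "\<bar>x - x0\<bar> > d" by linarith
    then show ?thesis
    proof cases
      case 1
      then have h: "h x \<ge> 1/2" using d1(2)[OF x] d r h0 by linarith
      have p: "p x \<ge> 1 + e/2" using d2(2)[of "x - x0"] 1 r by (auto simp: p_def)
      have "(1/2) * (1 + e/2) ^ k \<le> h x * p x ^ k"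
        using h p e by (intro mult_mono power_mono) auto
      then show ?thesis using 1 C0 by auto
    next
      case 2
      then have h: "h x \<ge> 1/2" using d1(2)[OF x] d r h0 by linarith
      have "cos (2 * pi * \<bar>x - x0\<bar>) \<ge> 0"
      proof (rule cos_ge_zero)
        show "- (pi / 2) \<le> 2 * pi * \<bar>x - x0\<bar>" using pi_gt_zero by (smt (verit) mult_nonneg_nonneg divide_nonneg_nonneg)
        show "2 * pi * \<bar>x - x0\<bar> \<le> pi / 2" using mult_left_mono[OF order_trans[OF 2(2) d(3)], of "2 * pi"] by simp
      qed
      then have "cos (2 * pi * (x - x0)) \<ge> 0" by (cases "x - x0 \<ge> 0") (auto simp: abs_if cos_diff right_diff_distrib mult.commute[of _ "cos (2 * pi * x0)"] mult.commute[of _ "sin (2 * pi * x0)"])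
      then have "p x \<ge> 0" using e by (simp add: p_def)
      then have "h x * p x ^ k \<ge> 0" using h by simp
      then show ?thesis using 2 C0 by auto
    next
      case 3
      have le: "cos (2 * pi * (x - x0)) \<le> c"
      proof -
        have eq: "cos (2 * pi * (x - x0)) = cos (2 * pi * \<bar>x - x0\<bar>)"
          by (cases "x - x0 \<ge> 0") (auto simp: abs_if cos_diff right_diff_distrib mult.commute[of _ "cos (2 * pi * x0)"] mult.commute[of _ "sin (2 * pi * x0)"])
        show ?thesis
        proof (cases "\<bar>x - x0\<bar> \<le> 1/2")
          case True
          then have "2 * pi * \<bar>x - x0\<bar> \<le> pi" using mult_left_mono[OF True, of "2 * pi"] by simp
          then show ?thesis unfolding eq c_def using 3 d by (intro cos_monotone_0_pi_le) auto
        next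
          case False
          \<comment> \<open>Past half a period the cosine rises again; the choice of
            \<open>d\<close> leaves a distance at least \<open>d\<close> to the full period, so
            reflection reduces to the previous case.\<close>
          have "\<bar>x - x0\<bar> \<le> 1 - d" using x d by auto
          then have a: "1 - \<bar>x - x0\<bar> \<ge> d" by simp
          have b: "2 * pi * (1 - \<bar>x - x0\<bar>) \<le> pi" using mult_left_mono[of "1 - \<bar>x - x0\<bar>" "1/2" "2 * pi"] False by simp
          have "cos (2 * pi * \<bar>x - x0\<bar>) = cos (2 * pi * (1 - \<bar>x - x0\<bar>))"
            by (simp add: right_diff_distrib cos_diff)
          also have "\<dots> \<le> c" unfolding c_def using a b d by (intro cos_monotone_0_pi_le) auto
          finally show ?thesis unfolding eq .
        qed
      qed
      then have "p x \<le> 1 - e" using e by (simp add: p_def)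
      moreover have "p x \<ge> -1" using cos_ge_minus_one[of "2 * pi * (x - x0)"] e unfolding p_def by linarith
      ultimately have "\<bar>p x\<bar> \<le> 1" using e by linarith
      then have "\<bar>p x ^ k\<bar> \<le> 1" by (simp add: power_abs power_le_one)
      then have "\<bar>h x * p x ^ k\<bar> \<le> C * 1" unfolding abs_mult using C[OF x] C0 by (intro mult_mono) auto
      then show ?thesis using 3 r by (auto simp: abs_le_iff)
    qed
  qed
  have key: "r * (1 + e/2) ^ k \<le> C" for k
  proof -
    have sub: "{x0 - r..x0 + r} \<subseteq> {0..1}" using r d by auto
    have i1: "((\<lambda>x. (1/2) * (1 + e/2) ^ k) has_integral ((2 * r) *\<^sub>R ((1/2) * (1 + e/2) ^ k))) {x0 - r..x0 + r}"
      using has_integral_const_real[of "(1/2) * (1 + e/2) ^ k" "x0 - r" "x0 + r"] r by simp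
    have i2: "((\<lambda>x. if x \<in> {x0 - r..x0 + r} then (1/2) * (1 + e/2) ^ k else 0) has_integral r * (1 + e/2) ^ k) {0..1}"
      using has_integral_restrict[OF sub, THEN iffD2, OF i1] r by simp
    have i3: "((\<lambda>x::real. C) has_integral C) {0..1}" using has_integral_const_real[of C 0 1] by simp
    have "r * (1 + e/2) ^ k - C \<le> 0"
      by (rule has_integral_le[OF has_integral_diff[OF i2 i3] hz bound])
    then show ?thesis by simp
  qed
  obtain k where "C / r < (1 + e/2) ^ k" using real_arch_pow[of "1 + e/2" "C/r"] e by auto
  then have "C < r * (1 + e/2) ^ k" using r by (simp add: field_simps)
  with key[of k] show False by simp
qed

section \<open>Summation, integration and the Gaussian transform in one variable\<close>

lemma int_gaussian_summable:
  fixes e K :: real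
  assumes "e > 0"
  shows "(\<lambda>n::int. exp (- e * of_int n ^ 2 + K * \<bar>of_int n\<bar>)) summable_on UNIV"
proof -
  define f where "f = (\<lambda>n::int. exp (- e * of_int n ^ 2 + K * \<bar>of_int n\<bar>) :: real)"
  \<comment> \<open>With this \<open>D\<close> the difference of the two sides of \<open>bd\<close>
    is a perfect square divided by \<open>4 * e\<close>; the surplus \<open>- x\<close> leaves a
    geometric majorant.\<close>
  define D where "D = (K+1)^2 / (4*e)"
  have bd: "- e * x ^ 2 + K * x \<le> D - x" for x :: real
  proof -
    have "0 \<le> (2 * e * x - (K+1))^2 / (4*e)" using assms by simp
    also have "\<dots> = e * x^2 - (K+1) * x + D" using assms by (simp add: D_def power2_diff power_mult_distrib field_simps power2_eq_square)
    finally show ?thesis by (simp add: algebra_simps)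
  qed
  have nat: "(\<lambda>n::nat. exp (- e * of_nat n ^ 2 + K * of_nat n)) summable_on UNIV"
  proof (rule summable_on_comparison_test)
    have "summable (\<lambda>n::nat. exp D * exp (-1) ^ n)"
      by (intro summable_mult summable_geometric) simp
    then show "(\<lambda>n::nat. exp D * exp (-1) ^ n) summable_on UNIV"
      by (intro summable_nonneg_imp_summable_on) auto
    show "exp (- e * of_nat n ^ 2 + K * of_nat n) \<le> exp D * exp (-1) ^ n" for n :: nat
      using bd[of "of_nat n"] by (simp flip: exp_add exp_of_nat_mult)
  qed auto
  have 1: "f summable_on (int ` UNIV)"
    using nat by (subst summable_on_reindex) (auto simp: o_def f_def)
  have 2: "f summable_on ((\<lambda>n. - int n) ` UNIV)"
    using nat by (subst summable_on_reindex) (auto simp: o_def f_def inj_on_def)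
  have "(UNIV::int set) = int ` UNIV \<union> (\<lambda>n. - int n) ` UNIV"
    by (auto simp: image_iff) (metis int_cases2)
  then show ?thesis using summable_on_union[OF 1 2] by (simp add: f_def)
qed

text \<open>The Weierstrass M-test gives uniform convergence along the finite subsets, which carries
  both continuity and the integral through the unordered sum.\<close>

lemma has_sum_integral_unit_interval:
  fixes f :: "'a \<Rightarrow> real \<Rightarrow> complex"
  assumes cont: "\<And>d. continuous_on {0..1} (f d)"
    and bd: "\<And>d x. x \<in> {0..1} \<Longrightarrow> norm (f d x) \<le> M d"
    and M: "M summable_on UNIV"
  shows "continuous_on {0..1} (\<lambda>x. \<Sum>\<^sub>\<infinity>d. f d x)"
    and "((\<lambda>d. integral {0..1} (f d)) has_sum integral {0..1} (\<lambda>x. \<Sum>\<^sub>\<infinity>d. f d x)) UNIV"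
proof -
  have ul: "uniform_limit {0..1} (\<lambda>X y. \<Sum>d\<in>X. f d y) (\<lambda>y. \<Sum>\<^sub>\<infinity>d. f d y) (finite_subsets_at_top UNIV)"
    by (rule Weierstrass_m_test_general[OF bd M])
  have c: "continuous_on {0..1} (\<lambda>y. \<Sum>d\<in>X. f d y)" for X by (intro continuous_intros cont)
  show "continuous_on {0..1} (\<lambda>x. \<Sum>\<^sub>\<infinity>d. f d x)"
    by (rule uniform_limit_theorem[OF _ ul]) (auto intro: c)
  obtain I J where IJ: "\<And>X. ((\<lambda>y. \<Sum>d\<in>X. f d y) has_integral I X) {0..1}"
    "((\<lambda>y. \<Sum>\<^sub>\<infinity>d. f d y) has_integral J) {0..1}" "(I \<longlongrightarrow> J) (finite_subsets_at_top UNIV)"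
    using uniform_limit_integral[OF ul c] by auto
  have "I X = (\<Sum>d\<in>X. integral {0..1} (f d))" if "finite X" for X
    using IJ(1)[of X] integral_sum[OF that, of f "{0..1}"] integrable_continuous_real[OF cont]
    by (simp add: integral_unique)
  then have "((\<lambda>X. \<Sum>d\<in>X. integral {0..1} (f d)) \<longlongrightarrow> J) (finite_subsets_at_top UNIV)"
    using IJ(3) by (rule_tac Lim_transform_eventually[OF IJ(3)]) (auto intro: eventually_finite_subsets_at_top_weakI)
  then show "((\<lambda>d. integral {0..1} (f d)) has_sum integral {0..1} (\<lambda>x. \<Sum>\<^sub>\<infinity>d. f d x)) UNIV"
    unfolding has_sum_def using IJ(2) by (simp add: integral_unique)
qed

text \<open>The symmetric windows are eventually above every finite set of integers, so an unordered
  sum is also the limit along them.\<close>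

lemma has_sum_int_symmetric_limit:
  fixes f :: "int \<Rightarrow> 'a::topological_comm_monoid_add"
  assumes "(f has_sum S) UNIV"
  shows "(\<lambda>K::nat. \<Sum>d\<in>{- int K..int K}. f d) \<longlonglongrightarrow> S"
proof -
  have "filterlim (\<lambda>K::nat. {- int K..int K}) (finite_subsets_at_top UNIV) sequentially"
    unfolding filterlim_finite_subsets_at_top
  proof (intro allI impI)
    fix X :: "int set" assume X: "finite X \<and> X \<subseteq> UNIV"
    define N where "N = nat (Max (insert 0 (abs ` X)))"
    have "X \<subseteq> {- int K..int K}" if "K \<ge> N" for K
    proof
      fix x assume "x \<in> X"
      then have "\<bar>x\<bar> \<le> Max (insert 0 (abs ` X))" using X by (intro Max_ge) auto
      then have "\<bar>x\<bar> \<le> int K" using that unfolding N_def by linarith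
      then show "x \<in> {- int K..int K}" by auto
    qed
    then show "\<forall>\<^sub>F K in sequentially. finite {- int K..int K} \<and> X \<subseteq> {- int K..int K} \<and> {- int K..int K} \<subseteq> UNIV"
      by (auto simp: eventually_sequentially)
  qed
  from filterlim_compose[OF assms[unfolded has_sum_def] this] show ?thesis .
qed

text \<open>Unfolding: integer translates of the unit interval tile the line. A symmetric window of
  translates gives the integral over one long interval; its limit is \<open>S\<close> by hypothesis
  and \<open>I\<close> by dominated convergence.\<close>

lemma integral_unfold_real_line:
  fixes h :: "real \<Rightarrow> complex"
  assumes h: "has_bochner_integral lborel h I" and cont: "continuous_on UNIV h"
    and s: "((\<lambda>d::int. integral {0..1} (\<lambda>x. h (x - of_int d))) has_sum S) UNIV"
  shows "S = I"
proof -
  have hint: "h integrable_on {a..b}" for a b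
    by (intro integrable_continuous_real continuous_on_subset[OF cont]) auto
  have shift: "integral {0..1} (\<lambda>x. h (x - of_int d)) = integral {- of_int d..1 - of_int d} h" for d :: int
  proof -
    have "(h has_integral integral {- of_int d..1 - of_int d} h) {- of_int d..1 - of_int d}"
      by (intro integrable_integral hint)
    from has_integral_affinity[of h _ "- of_int d" "1 - of_int d" 1 "- of_int d"] this
    have "((\<lambda>x. h (x - of_int d)) has_integral integral {- of_int d..1 - of_int d} h) ((\<lambda>x. x + of_int d) ` {- of_int d..1 - of_int d})"
      by (simp add: image_affinity_atLeastAtMost)
    then show ?thesis by (simp add: integral_unique)
  qed
  have sum: "(\<Sum>d\<in>{- int K..int K}. integral {0..1} (\<lambda>x. h (x - of_int d))) = integral {- of_nat K..of_nat K + 1} h" for K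
  proof (induction K)
    case 0 then show ?case by simp
  next
    case (Suc K)
    have eq: "{- int (Suc K)..int (Suc K)} = insert (- int (Suc K)) (insert (int (Suc K)) {- int K..int K})" by auto
    have "(\<Sum>d\<in>{- int (Suc K)..int (Suc K)}. integral {0..1} (\<lambda>x. h (x - of_int d))) =
      integral {of_nat K + 1..of_nat (Suc K) + 1} h + (integral {- of_nat (Suc K)..1 - of_nat (Suc K)} h + integral {- of_nat K..of_nat K + 1} h)"
      unfolding eq using Suc by (simp add: shift add.commute)
    also have "integral {- of_nat (Suc K)..1 - of_nat (Suc K)} h + integral {- of_nat K..of_nat K + 1} h
        = integral {- of_nat (Suc K)..of_nat K + 1} h"
      using Henstock_Kurzweil_Integration.integral_combine[of "- of_nat (Suc K)" "- of_nat K" "of_nat K + 1" h] hint by simp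
    also have "integral {of_nat K + 1..of_nat (Suc K) + 1} h + integral {- of_nat (Suc K)..of_nat K + 1} h
        = integral {- of_nat (Suc K)..of_nat (Suc K) + 1} h"
      using Henstock_Kurzweil_Integration.integral_combine[of "- of_nat (Suc K)" "of_nat K + 1" "of_nat (Suc K) + 1" h] hint
      by (simp add: add.commute)
    finally show ?case .
  qed
  have int: "integrable lborel h" "I = integral\<^sup>L lborel h" using h by (auto simp: has_bochner_integral_iff)
  have [measurable]: "h \<in> borel_measurable borel" using int(1) by auto
  have "(\<lambda>K::nat. \<integral>x. indicator {- of_nat K..of_nat K + 1} x *\<^sub>R h x \<partial>lborel) \<longlonglongrightarrow> integral\<^sup>L lborel h"
  proof (rule integral_dominated_convergence)
    show "integrable lborel (\<lambda>x. norm (h x))" using int by simp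
    show "AE x in lborel. (\<lambda>K::nat. indicator {- of_nat K..of_nat K + 1} x *\<^sub>R h x) \<longlonglongrightarrow> h x"
    proof (rule AE_I2)
      fix x :: real
      obtain N :: nat where N: "\<bar>x\<bar> \<le> of_nat N" using real_arch_simple by blast
      have "indicator {- of_nat K..of_nat K + 1} x *\<^sub>R h x = h x" if "K \<ge> N" for K :: nat
        using that N by (auto simp: indicator_def)
      then have "\<forall>\<^sub>F K in sequentially. indicator {- of_nat K..of_nat K + 1} x *\<^sub>R h x = h x"
        by (auto simp: eventually_sequentially)
      then show "(\<lambda>K::nat. indicator {- of_nat K..of_nat K + 1} x *\<^sub>R h x) \<longlonglongrightarrow> h x"
        by (rule tendsto_eventually)
    qed
  qed (auto simp: indicator_def)
  moreover have "(\<integral>x. indicator {a..b} x *\<^sub>R h x \<partial>lborel) = integral {a..b} h" for a b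
  proof -
    have "integrable lborel (\<lambda>x. indicator {a..b} x *\<^sub>R h x)"
      using int by (intro integrable_mult_indicator) auto
    then show ?thesis using set_borel_integral_eq_integral(2)[of "{a..b}" h]
      by (simp add: set_lebesgue_integral_def set_integrable_def)
  qed
  ultimately have "(\<lambda>K::nat. integral {- of_nat K..of_nat K + 1} h) \<longlonglongrightarrow> I" using int by simp
  with has_sum_int_symmetric_limit[OF s] show ?thesis unfolding sum by (rule LIMSEQ_unique)
qed

text \<open>Derived from the characteristic function of the standard normal law by a real affine
  substitution. No contour shift is needed: the real part of \<open>b\<close> is a translation, and
  the imaginary part only changes the frequency from \<open>k\<close> to \<open>k - Im b / A\<close>
  and the constant.\<close>

lemma gaussian_fourier_transform:
  fixes A k :: real and b :: complex
  assumes A: "A > 0"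
  shows "has_bochner_integral lborel (\<lambda>x. exp (- of_real (pi / A) * (b + of_real x)^2) * cis (2 * pi * k * x))
           (of_real (sqrt A) * exp (- of_real (pi * A * k^2) - 2 * pi * \<i> * k * b))"
proof -
  define t where "t = (k - Im b / A) * sqrt (2 * pi * A)"
  define c where "c = sqrt (2 * pi / A)"
  have c: "c > 0" using A by (simp add: c_def)
  have tc: "t * c = 2 * pi * (k - Im b / A)"
  proof -
    have "sqrt (2 * pi * A) * sqrt (2 * pi / A) = sqrt ((2 * pi)^2)"
      unfolding real_sqrt_mult[symmetric] using A by (simp add: power2_eq_square)
    then have "sqrt (2 * pi * A) * sqrt (2 * pi / A) = 2 * pi" unfolding real_sqrt_abs by simp
    then show ?thesis by (simp add: t_def c_def mult.assoc)
  qed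
  have cc: "c^2 = 2 * pi / A" using A by (simp add: c_def)
  have "integrable std_normal_distribution (\<lambda>x. iexp (t * x))"
    by (rule prob_space.integrable_iexp) (use real_dist_normal_dist in \<open>auto simp: real_distribution_def\<close>)
  moreover have "integral\<^sup>L std_normal_distribution (\<lambda>x. iexp (t * x)) = of_real (exp (- (t^2) / 2))"
    using fun_cong[OF char_std_normal_distribution, of t] by (simp add: char_def)
  ultimately have 1: "has_bochner_integral lborel (\<lambda>x. std_normal_density x *\<^sub>R iexp (t * x)) (of_real (exp (- (t^2) / 2)))"
    unfolding has_bochner_integral_iff
    by (subst (asm) integrable_density, simp, simp, simp, subst (asm) integral_density) auto
  have 2: "has_bochner_integral lborel (\<lambda>x. std_normal_density (c * Re b + c * x) *\<^sub>R iexp (t * (c * Re b + c * x))) (of_real (exp (- (t^2) / 2)) /\<^sub>R \<bar>c\<bar>)"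
    using lborel_has_bochner_integral_real_affine_iff[of c, THEN iffD1, OF _ 1, of "c * Re b"] c by simp
  \<comment> \<open>\<open>D\<close> removes the normalisation of the density, restores the growth
    coming from \<open>Im b\<close>, and compensates the phase of the translation by
    \<open>Re b\<close>.\<close>
  define D where "D = of_real (sqrt (2 * pi)) * of_real (exp (pi * (Im b)^2 / A)) * cis (- 2 * pi * k * Re b)"
  have 3: "has_bochner_integral lborel (\<lambda>x. D * (std_normal_density (c * Re b + c * x) *\<^sub>R iexp (t * (c * Re b + c * x)))) (D * (of_real (exp (- (t^2) / 2)) /\<^sub>R \<bar>c\<bar>))"
    by (intro has_bochner_integral_mult_right 2)
  have eq1: "D * (std_normal_density (c * Re b + c * x) *\<^sub>R iexp (t * (c * Re b + c * x))) =
     exp (- of_real (pi / A) * (b + of_real x)^2) * cis (2 * pi * k * x)" for x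
  proof -
    have a: "(c * Re b + c * x)^2 / 2 = (pi / A) * (Re b + x)^2"
      using cc by (simp add: distrib_left[symmetric] power_mult_distrib)
    have b: "t * (c * Re b + c * x) = 2 * pi * (k - Im b / A) * (Re b + x)"
      using tc by (metis distrib_left mult.assoc)
    have "D * (std_normal_density (c * Re b + c * x) *\<^sub>R iexp (t * (c * Re b + c * x))) =
       of_real (exp (pi * (Im b)^2 / A)) * cis (- 2 * pi * k * Re b) * of_real (exp (- (pi/A) * (Re b + x)^2)) * cis (2 * pi * (k - Im b / A) * (Re b + x))"
      unfolding std_normal_density_def D_def b using a by (simp add: cis_conv_exp scaleR_conv_of_real)
    also have "\<dots> = exp (of_real (pi * (Im b)^2 / A) + \<i> * of_real (- 2 * pi * k * Re b) + of_real (- (pi/A) * (Re b + x)^2) + \<i> * of_real (2 * pi * (k - Im b / A) * (Re b + x)))"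
      unfolding exp_add cis_conv_exp by (simp only: exp_of_real)
    also have "of_real (pi * (Im b)^2 / A) + \<i> * of_real (- 2 * pi * k * Re b) + of_real (- (pi/A) * (Re b + x)^2) + \<i> * of_real (2 * pi * (k - Im b / A) * (Re b + x))
       = - of_real (pi / A) * (b + of_real x)^2 + \<i> * of_real (2 * pi * k * x)"
      using A by (simp add: complex_eq_iff power2_eq_square field_simps)
    finally show ?thesis unfolding exp_add cis_conv_exp .
  qed
  have eq2: "D * (of_real (exp (- (t^2) / 2)) /\<^sub>R \<bar>c\<bar>) = of_real (sqrt A) * exp (- of_real (pi * A * k^2) - 2 * pi * \<i> * k * b)"
  proof -
    have a: "sqrt (2 * pi) / c = sqrt A" using A by (simp add: c_def real_sqrt_divide)
    have b: "t^2 / 2 = pi * A * (k - Im b / A)^2" using A by (simp add: t_def power_mult_distrib)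
    have "D * (of_real (exp (- (t^2) / 2)) /\<^sub>R \<bar>c\<bar>) = of_real (sqrt (2 * pi) / c) * (of_real (exp (pi * (Im b)^2 / A)) * cis (- 2 * pi * k * Re b) * of_real (exp (- (t^2/2))))"
      using c by (simp add: D_def scaleR_conv_of_real field_simps)
    also have "\<dots> = of_real (sqrt A) * exp (of_real (pi * (Im b)^2 / A) + \<i> * of_real (- 2 * pi * k * Re b) + of_real (- (pi * A * (k - Im b / A)^2)))"
      unfolding a b exp_add cis_conv_exp by (simp only: exp_of_real)
    also have "of_real (pi * (Im b)^2 / A) + \<i> * of_real (- 2 * pi * k * Re b) + of_real (- (pi * A * (k - Im b / A)^2)) = - of_real (pi * A * k^2) - 2 * pi * \<i> * k * b"
      using A by (simp add: complex_eq_iff power2_eq_square field_simps)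
    finally show ?thesis .
  qed
  show ?thesis using 3 unfolding eq1 eq2 .
qed

lemma theta_summable:
  fixes A :: real and b :: complex
  assumes A: "A > 0"
  shows "(\<lambda>n::int. norm (exp (- of_real (pi * A) * of_int n ^ 2 + 2 * pi * \<i> * of_int n * b) :: complex)) summable_on UNIV"
proof (rule Infinite_Sum.abs_summable_on_comparison_test')
  show "(\<lambda>n::int. exp (- (pi * A) * of_int n ^ 2 + (2 * pi * \<bar>Im b\<bar>) * \<bar>of_int n\<bar>)) summable_on UNIV"
    using A by (intro int_gaussian_summable) auto
  fix n :: int
  have "Re (- of_real (pi * A) * of_int n ^ 2 + 2 * pi * \<i> * of_int n * b) = - (pi * A) * of_int n ^ 2 - 2 * pi * (of_int n * Im b)"
    by (simp add: power2_eq_square)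
  moreover have "- (of_int n * Im b) \<le> \<bar>Im b\<bar> * \<bar>of_int n\<bar>" by (metis abs_ge_minus_self abs_mult mult.commute)
  then have "2 * pi * (- (of_int n * Im b)) \<le> 2 * pi * (\<bar>Im b\<bar> * \<bar>of_int n\<bar>)" by (intro mult_left_mono) auto
  ultimately show "norm (exp (- of_real (pi * A) * of_int n ^ 2 + 2 * pi * \<i> * of_int n * b)) \<le> exp (- (pi * A) * of_int n ^ 2 + (2 * pi * \<bar>Im b\<bar>) * \<bar>of_int n\<bar>)"
    by simp
qed

text \<open>The bound is uniform in \<open>x\<close> on the unit interval, as the M-test requires of
  a majorant.\<close>

lemma shifted_gaussian_bound:
  fixes A x :: real and b :: complex
  assumes A: "A > 0" and x: "x \<in> {0..1}"
  shows "norm (exp (- of_real (pi / A) * (b + of_real x - of_int d)^2))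
    \<le> exp ((pi / A) * (Im b)^2) * exp (- (pi / A) * of_int d ^ 2 + (2 * (pi / A) * (\<bar>Re b\<bar> + 1)) * \<bar>of_int d\<bar>)"
proof -
  have re: "Re (- of_real (pi / A) * (b + of_real x - of_int d)^2) = (pi / A) * ((Im b)^2 - (Re b + x - of_int d)^2)"
    using A by (simp add: power2_eq_square field_simps)
  have "(Re b + x) * of_int d \<le> \<bar>Re b + x\<bar> * \<bar>of_int d\<bar>" by (metis abs_ge_self abs_mult)
  also have "\<dots> \<le> (\<bar>Re b\<bar> + 1) * \<bar>of_int d\<bar>" using x by (intro mult_right_mono) auto
  finally have "(Im b)^2 - (Re b + x - of_int d)^2 \<le> (Im b)^2 - of_int d ^ 2 + 2 * ((\<bar>Re b\<bar> + 1) * \<bar>of_int d\<bar>)"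
    using zero_le_power2[of "Re b + x"] unfolding power2_diff[of "Re b + x"] by linarith
  then have "(pi / A) * ((Im b)^2 - (Re b + x - of_int d)^2) \<le> (pi / A) * ((Im b)^2 - of_int d ^ 2 + 2 * ((\<bar>Re b\<bar> + 1) * \<bar>of_int d\<bar>))"
    using A by (intro mult_left_mono) auto
  also have "\<dots> = (pi / A) * (Im b)^2 + (- (pi / A) * of_int d ^ 2 + (2 * (pi / A) * (\<bar>Re b\<bar> + 1)) * \<bar>of_int d\<bar>)"
    using A by (simp add: field_simps)
  finally show ?thesis unfolding norm_exp_eq_Re re exp_add[symmetric] by simp
qed

lemma dual_theta_summable:
  fixes A :: real and b :: complex
  assumes A: "A > 0"
  shows "(\<lambda>d::int. norm (exp (- of_real (pi / A) * (b - of_int d)^2) :: complex)) summable_on UNIV"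
proof (rule Infinite_Sum.abs_summable_on_comparison_test')
  show "(\<lambda>d::int. exp ((pi / A) * (Im b)^2) * exp (- (pi / A) * of_int d ^ 2 + (2 * (pi / A) * (\<bar>Re b\<bar> + 1)) * \<bar>of_int d\<bar>)) summable_on UNIV"
    using A by (intro summable_on_cmult_right int_gaussian_summable) auto
qed (use shifted_gaussian_bound[OF A, of 0 b] in auto)

text \<open>Translate the characteristic by a real x. The left side is then a Fourier series by its
  form; the coefficients of the right side unfold to Gaussian transforms on the whole line. Equal
  coefficients force equal continuous functions.\<close>

theorem theta_inversion:
  fixes A :: real and b :: complex
  assumes A: "A > 0"
  shows "(\<Sum>\<^sub>\<infinity>n::int. exp (- of_real (pi * A) * of_int n ^ 2 + 2 * pi * \<i> * of_int n * b))
     = of_real (1 / sqrt A) * (\<Sum>\<^sub>\<infinity>d::int. exp (- of_real (pi / A) * (b - of_int d)^2))"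
proof -
  \<comment> \<open>The half shift makes x = 1/2 the point of interest, inside the open interval
    where vanishing coefficients are conclusive.\<close>
  define \<beta> where "\<beta> = b - 1/2"
  define c where "c = (\<lambda>n::int. exp (- of_real (pi * A) * of_int n ^ 2 + 2 * pi * \<i> * of_int n * \<beta>))"
  define f where "f = (\<lambda>n x. c n * cis (2 * pi * of_int n * x))"
  define g where "g = (\<lambda>(d::int) x::real. exp (- of_real (pi / A) * (\<beta> + of_real x - of_int d)^2))"
  define F where "F = (\<lambda>x. \<Sum>\<^sub>\<infinity>n. f n x)"
  define G where "G = (\<lambda>x. \<Sum>\<^sub>\<infinity>d. g d x)"
  define Mg where "Mg = (\<lambda>d::int. exp ((pi / A) * (Im \<beta>)^2) * exp (- (pi / A) * of_int d ^ 2 + (2 * (pi / A) * (\<bar>Re \<beta>\<bar> + 1)) * \<bar>of_int d\<bar>))"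
  have Mg: "Mg summable_on UNIV"
    unfolding Mg_def using A by (intro summable_on_cmult_right int_gaussian_summable) auto
  have csum: "(\<lambda>n. norm (c n)) summable_on UNIV" unfolding c_def by (rule theta_summable[OF A])
  have fc: "continuous_on S (\<lambda>x. f n x * cis (2 * pi * of_int k * x))" for n k S
    unfolding f_def by (intro continuous_intros)
  have fb: "norm (f n x * cis (2 * pi * of_int k * x)) \<le> norm (c n)" for n k x
    by (simp add: f_def norm_mult)
  have gc: "continuous_on S (\<lambda>x. g d x * cis (2 * pi * of_int k * x))" for d k S
    unfolding g_def by (intro continuous_intros)
  have gb: "norm (g d x * cis (2 * pi * of_int k * x)) \<le> Mg d" if "x \<in> {0..1}" for d k x
    using shifted_gaussian_bound[OF A that, of \<beta> d] by (simp add: g_def Mg_def norm_mult)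
  have Fk: "F x * cis (2 * pi * of_int k * x) = (\<Sum>\<^sub>\<infinity>n. f n x * cis (2 * pi * of_int k * x))" for x k
    unfolding F_def by (simp add: infsum_cmult_left')
  have Gk: "G x * cis (2 * pi * of_int k * x) = (\<Sum>\<^sub>\<infinity>d. g d x * cis (2 * pi * of_int k * x))" for x k
    unfolding G_def by (simp add: infsum_cmult_left')
  have cF: "continuous_on {0..1} (\<lambda>x. F x * cis (2 * pi * of_int k * x))" for k
    unfolding Fk by (rule has_sum_integral_unit_interval(1)[OF fc fb csum])
  have cG: "continuous_on {0..1} (\<lambda>x. G x * cis (2 * pi * of_int k * x))" for k
    unfolding Gk by (rule has_sum_integral_unit_interval(1)[OF gc gb Mg])
  have iF: "integral {0..1} (\<lambda>x. F x * cis (2 * pi * of_int k * x)) = c (- k)" for k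
  proof -
    have s: "((\<lambda>n. integral {0..1} (\<lambda>x. f n x * cis (2 * pi * of_int k * x))) has_sum integral {0..1} (\<lambda>x. F x * cis (2 * pi * of_int k * x))) UNIV"
      unfolding Fk by (rule has_sum_integral_unit_interval(2)[OF fc fb csum])
    have orth: "integral {0..1} (\<lambda>x. cis (2 * pi * of_int j * x)) = (if j = 0 then 1 else 0)" for j :: int
    proof (cases "j = 0")
      case True then show ?thesis by simp
    next
      case False
      have "((\<lambda>x. cis (2 * pi * of_int j * x)) has_integral (cis (2 * pi * of_int j * 1) / (2 * pi * \<i> * of_int j) - cis (2 * pi * of_int j * 0) / (2 * pi * \<i> * of_int j))) {0..1}"
      proof (rule fundamental_theorem_of_calculus)
        fix x :: real assume "x \<in> {0..1}"
        show "((\<lambda>x. cis (2 * pi * of_int j * x) / (2 * pi * \<i> * of_int j)) has_vector_derivative cis (2 * pi * of_int j * x)) (at x within {0..1})"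
          unfolding cis_conv_exp has_real_derivative_iff_has_vector_derivative[symmetric]
          by (rule has_vector_derivative_real_field derivative_eq_intros refl | use False in \<open>simp add: field_simps\<close>)+
      qed simp
      moreover have "cis (2 * pi * of_int j * 1) = 1" using cis_multiple_2pi[of "of_int j"] by (simp add: mult.commute)
      ultimately show ?thesis using False by (simp add: integral_unique)
    qed
    have val: "integral {0..1} (\<lambda>x. f n x * cis (2 * pi * of_int k * x)) = (if n = - k then c n else 0)" for n
    proof -
      have "(\<lambda>x. f n x * cis (2 * pi * of_int k * x)) = (\<lambda>x. c n * cis (2 * pi * of_int (n + k) * x))"
        by (auto simp: f_def cis_mult algebra_simps)
      then show ?thesis using orth[of "n + k"] by (auto simp: eq_neg_iff_add_eq_0)
    qed
    have "((\<lambda>n. if n = - k then c n else 0) has_sum c (- k)) UNIV"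
      by (rule has_sum_finite_neutralI[of "{- k}"]) auto
    with s show ?thesis unfolding val by (rule has_sum_unique)
  qed
  have iG: "integral {0..1} (\<lambda>x. G x * cis (2 * pi * of_int k * x)) = of_real (sqrt A) * c (- k)" for k
  proof -
    define h where "h = (\<lambda>x. exp (- of_real (pi / A) * (\<beta> + of_real x)^2) * cis (2 * pi * of_int k * x))"
    have "has_bochner_integral lborel h (of_real (sqrt A) * exp (- of_real (pi * A * (of_int k)^2) - 2 * pi * \<i> * of_real (of_int k) * \<beta>))"
      unfolding h_def by (rule gaussian_fourier_transform[OF A])
    also have "of_real (sqrt A) * exp (- of_real (pi * A * (of_int k)^2) - 2 * pi * \<i> * of_real (of_int k) * \<beta>) = of_real (sqrt A) * c (- k)"
      unfolding c_def by (rule arg_cong[where f="\<lambda>z. of_real (sqrt A) * exp z"]) simp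
    finally have h: "has_bochner_integral lborel h (of_real (sqrt A) * c (- k))" .
    have eq: "(\<lambda>x. g d x * cis (2 * pi * of_int k * x)) = (\<lambda>x. h (x - of_int d))" for d
    proof
      fix x
      \<comment> \<open>Integrality of \<open>k * d\<close> allows the phase to be translated
        together with the Gaussian, so every term is a translate of one function
        \<open>h\<close>.\<close>
      have "cis (2 * pi * of_int k * (x - of_int d)) = cis (2 * pi * of_int k * x) * cis (2 * pi * of_int (- k * d))"
        by (simp add: cis_mult algebra_simps)
      also have "cis (2 * pi * of_int (- k * d)) = 1" by (rule cis_multiple_2pi) simp
      finally show "g d x * cis (2 * pi * of_int k * x) = h (x - of_int d)"
        by (simp add: g_def h_def algebra_simps)
    qed
    have hc: "continuous_on UNIV h" unfolding h_def by (intro continuous_intros)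
    have "((\<lambda>d. integral {0..1} (\<lambda>x. g d x * cis (2 * pi * of_int k * x))) has_sum integral {0..1} (\<lambda>x. G x * cis (2 * pi * of_int k * x))) UNIV"
      unfolding Gk by (rule has_sum_integral_unit_interval(2)[OF gc gb Mg])
    then show ?thesis unfolding eq by (rule integral_unfold_real_line[OF h hc])
  qed
  define \<Delta> where "\<Delta> = (\<lambda>x. F x - of_real (1 / sqrt A) * G x)"
  have "\<Delta> (1/2) = 0"
  proof (rule vanishing_fourier_coefficients)
    show "continuous_on {0..1} \<Delta>" unfolding \<Delta>_def using cF[of 0] cG[of 0] by (intro continuous_intros) auto
    fix k :: int
    have "integral {0..1} (\<lambda>x. \<Delta> x * cis (2 * pi * of_int k * x)) =
      integral {0..1} (\<lambda>x. F x * cis (2 * pi * of_int k * x) - of_real (1 / sqrt A) * (G x * cis (2 * pi * of_int k * x)))"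
      by (simp add: \<Delta>_def algebra_simps)
    also have "\<dots> = c (- k) - of_real (1 / sqrt A) * (of_real (sqrt A) * c (- k))"
    proof -
      have "((\<lambda>x. F x * cis (2 * pi * of_int k * x)) has_integral c (- k)) {0..1}"
        using integrable_integral[OF integrable_continuous_real[OF cF[of k]]] unfolding iF .
      moreover have "((\<lambda>x. G x * cis (2 * pi * of_int k * x)) has_integral of_real (sqrt A) * c (- k)) {0..1}"
        using integrable_integral[OF integrable_continuous_real[OF cG[of k]]] unfolding iG .
      ultimately show ?thesis by (intro integral_unique has_integral_diff has_integral_mult_right)
    qed
    also have "\<dots> = 0" using A by simp
    finally show "integral {0..1} (\<lambda>x. \<Delta> x * cis (2 * pi * of_int k * x)) = 0" .
  qed auto
  moreover have "F (1/2) = (\<Sum>\<^sub>\<infinity>n::int. exp (- of_real (pi * A) * of_int n ^ 2 + 2 * pi * \<i> * of_int n * b))"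
    unfolding F_def f_def c_def cis_conv_exp exp_add[symmetric] \<beta>_def by (simp add: algebra_simps)
  moreover have "G (1/2) = (\<Sum>\<^sub>\<infinity>d::int. exp (- of_real (pi / A) * (b - of_int d)^2))"
    unfolding G_def g_def \<beta>_def by simp
  ultimately show ?thesis unfolding \<Delta>_def by simp
qed

section \<open>Theta inversion in two variables\<close>

lemma summable_on_Times_mult:
  fixes f :: "'a \<Rightarrow> real" and g :: "'b \<Rightarrow> real"
  assumes f: "f summable_on A" and g: "g summable_on B"
    and nn: "\<And>x. x \<in> A \<Longrightarrow> f x \<ge> 0" "\<And>y. y \<in> B \<Longrightarrow> g y \<ge> 0"
  shows "(\<lambda>(x, y). f x * g y) summable_on A \<times> B"
proof (rule summable_on_SigmaI[where g = "\<lambda>x. f x * infsum g B"])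
  show "((\<lambda>y. case (x, y) of (x, y) \<Rightarrow> f x * g y) has_sum f x * infsum g B) B" for x
    using has_sum_cmult_right[OF has_sum_infsum[OF g]] by simp
  show "(\<lambda>x. f x * infsum g B) summable_on A" by (intro summable_on_cmult_left f)
qed (use nn in auto)

lemma int2_gaussian_summable:
  fixes e K :: real
  assumes "e > 0"
  shows "(\<lambda>(a, b). exp (- e * (of_int a ^ 2 + of_int b ^ 2) + K * (\<bar>of_int a\<bar> + \<bar>of_int b\<bar>))) summable_on (UNIV :: (int \<times> int) set)"
proof -
  have "(\<lambda>(a::int, b::int). exp (- e * of_int a ^ 2 + K * \<bar>of_int a\<bar>) * exp (- e * of_int b ^ 2 + K * \<bar>of_int b\<bar>)) summable_on UNIV \<times> UNIV"
    by (intro summable_on_Times_mult int_gaussian_summable assms) auto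
  then show ?thesis by (simp add: exp_add[symmetric] algebra_simps)
qed

text \<open>Determinant over trace lies below the smaller eigenvalue. After multiplication by
  \<open>\<alpha> - e\<close> and completion of the square, the coefficient left over is
  \<open>e^2\<close>.\<close>

lemma quadratic_form_lower_bound:
  fixes \<alpha> \<beta> \<gamma> :: real
  assumes "\<gamma> > 0" "\<alpha> * \<gamma> - \<beta>^2 > 0"
  obtains e where "e > 0" "\<And>x y. \<alpha> * x^2 + 2 * \<beta> * x * y + \<gamma> * y^2 \<ge> e * (x^2 + y^2)"
proof -
  have a: "\<alpha> > 0"
  proof (rule ccontr)
    assume "\<not> \<alpha> > 0"
    then have "\<alpha> * \<gamma> \<le> 0" using assms(1) by (simp add: mult_nonpos_nonneg)
    then show False using assms(2) by (smt (verit) zero_le_power2)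
  qed
  define e where "e = (\<alpha> * \<gamma> - \<beta>^2) / (\<alpha> + \<gamma>)"
  have e: "e > 0" using assms a by (simp add: e_def)
  have ed: "\<alpha> * \<gamma> - \<beta>^2 = e * (\<alpha> + \<gamma>)" using a assms by (simp add: e_def)
  have ae: "\<alpha> - e > 0"
  proof -
    have "\<alpha> - e = (\<alpha>^2 + \<beta>^2) / (\<alpha> + \<gamma>)" using a assms by (simp add: e_def field_simps power2_eq_square)
    also have "\<dots> > 0" using a assms(1) by (intro divide_pos_pos add_pos_nonneg) auto
    finally show ?thesis .
  qed
  have "\<alpha> * x^2 + 2 * \<beta> * x * y + \<gamma> * y^2 \<ge> e * (x^2 + y^2)" for x y
  proof -
    have "(\<alpha> - e) * (\<alpha> * x^2 + 2 * \<beta> * x * y + \<gamma> * y^2 - e * (x^2 + y^2)) =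
       ((\<alpha> - e) * x + \<beta> * y)^2 + (\<alpha> * \<gamma> - \<beta>^2 - e * (\<alpha> + \<gamma>) + e^2) * y^2"
      by (simp add: power2_eq_square algebra_simps)
    also have "\<dots> \<ge> 0" unfolding ed by simp
    finally show ?thesis using ae by (simp add: zero_le_mult_iff)
  qed
  with e show ?thesis using that by blast
qed

text \<open>One variable is inverted at a time: first \<open>a2\<close> with \<open>a1\<close>
  fixed, then, after an exchange of sums, \<open>a1\<close> with \<open>d2\<close> fixed. The second
  step sees the Schur complement \<open>D / \<gamma>\<close>, so the two square roots multiply to
  that of the determinant.\<close>

theorem theta_inversion_2d:
  fixes \<alpha> \<beta> \<gamma> :: real and b1 b2 :: complex
  assumes pos: "\<gamma> > 0" "\<alpha> * \<gamma> - \<beta>^2 > 0"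
  shows "(\<Sum>\<^sub>\<infinity>(a1::int, a2::int). exp (- of_real pi * (of_real \<alpha> * of_int a1^2 + 2 * of_real \<beta> * of_int a1 * of_int a2 + of_real \<gamma> * of_int a2^2)
           + 2 * pi * \<i> * (of_int a1 * b1 + of_int a2 * b2)))
     = of_real (1 / sqrt (\<alpha> * \<gamma> - \<beta>^2)) *
       (\<Sum>\<^sub>\<infinity>(d1::int, d2::int). exp (- of_real (pi / (\<alpha> * \<gamma> - \<beta>^2)) *
           (of_real \<gamma> * (b1 - of_int d1)^2 - 2 * of_real \<beta> * (b1 - of_int d1) * (b2 - of_int d2) + of_real \<alpha> * (b2 - of_int d2)^2)))"
proof -
  define D where "D = \<alpha> * \<gamma> - \<beta>^2"
  have D: "D > 0" using pos by (simp add: D_def)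
  define f where "f = (\<lambda>(a1::int) (a2::int). exp (- of_real pi * (of_real \<alpha> * of_int a1^2 + 2 * of_real \<beta> * of_int a1 * of_int a2 + of_real \<gamma> * of_int a2^2)
           + 2 * pi * \<i> * (of_int a1 * b1 + of_int a2 * b2)))"
  define g where "g = (\<lambda>(d1::int) (d2::int). exp (- of_real (pi / D) *
           (of_real \<gamma> * (b1 - of_int d1)^2 - 2 * of_real \<beta> * (b1 - of_int d1) * (b2 - of_int d2) + of_real \<alpha> * (b2 - of_int d2)^2)))"
  \<comment> \<open>The half-inverted term, indexed by one original and one dual variable.\<close>
  define h where "h = (\<lambda>(a1::int) (d2::int). exp (- of_real (pi / \<gamma>) * (b2 - of_int d2)^2) *
       exp (- of_real (pi * (D / \<gamma>)) * of_int a1^2 + 2 * pi * \<i> * of_int a1 * (b1 - of_real (\<beta> / \<gamma>) * (b2 - of_int d2))))"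
  have fsum: "(\<lambda>(a1, a2). f a1 a2) summable_on UNIV"
  proof -
    obtain e where e: "e > 0" "\<And>x y. \<alpha> * x^2 + 2 * \<beta> * x * y + \<gamma> * y^2 \<ge> e * (x^2 + y^2)"
      using quadratic_form_lower_bound[OF pos] by metis
    have "(\<lambda>x. norm (case x of (a1, a2) \<Rightarrow> f a1 a2)) summable_on UNIV"
    proof (rule Infinite_Sum.abs_summable_on_comparison_test')
      show "(\<lambda>(a1::int, a2::int). exp (- (pi * e) * (of_int a1 ^ 2 + of_int a2 ^ 2) + (2 * pi * (\<bar>Im b1\<bar> + \<bar>Im b2\<bar>)) * (\<bar>of_int a1\<bar> + \<bar>of_int a2\<bar>))) summable_on UNIV"
        using e by (intro int2_gaussian_summable) auto
      fix x :: "int \<times> int"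
      obtain a1 a2 where x: "x = (a1, a2)" by (cases x)
      have "pi * (e * (of_int a1^2 + of_int a2^2)) \<le> pi * (\<alpha> * of_int a1^2 + 2 * \<beta> * of_int a1 * of_int a2 + \<gamma> * of_int a2^2)"
        by (intro mult_left_mono e) auto
      moreover have "2 * pi * (- (of_int a1 * Im b1 + of_int a2 * Im b2)) \<le> 2 * pi * ((\<bar>Im b1\<bar> + \<bar>Im b2\<bar>) * (\<bar>of_int a1\<bar> + \<bar>of_int a2\<bar>))"
      proof (intro mult_left_mono)
        have "- (of_int a1 * Im b1) \<le> \<bar>Im b1\<bar> * \<bar>of_int a1\<bar>" "- (of_int a2 * Im b2) \<le> \<bar>Im b2\<bar> * \<bar>of_int a2\<bar>"
          by (metis abs_ge_minus_self abs_mult mult.commute)+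
        moreover have "0 \<le> \<bar>Im b1\<bar> * \<bar>real_of_int a2\<bar>" "0 \<le> \<bar>Im b2\<bar> * \<bar>real_of_int a1\<bar>" by auto
        ultimately show "- (of_int a1 * Im b1 + of_int a2 * Im b2) \<le> (\<bar>Im b1\<bar> + \<bar>Im b2\<bar>) * (\<bar>real_of_int a1\<bar> + \<bar>of_int a2\<bar>)"
          unfolding distrib_left distrib_right by linarith
      qed auto
      ultimately show "norm (case x of (a1, a2) \<Rightarrow> f a1 a2) \<le> (case x of (a1, a2) \<Rightarrow> exp (- (pi * e) * (of_int a1 ^ 2 + of_int a2 ^ 2) + (2 * pi * (\<bar>Im b1\<bar> + \<bar>Im b2\<bar>)) * (\<bar>of_int a1\<bar> + \<bar>of_int a2\<bar>)))"
        by (simp add: x f_def power2_eq_square algebra_simps)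
    qed
    then show ?thesis by (rule abs_summable_summable)
  qed
  have gsum: "(\<lambda>(d1, d2). g d1 d2) summable_on UNIV"
  proof -
    have pos': "\<alpha> > 0" 
    proof (rule ccontr)
      assume "\<not> \<alpha> > 0"
      then have "\<alpha> * \<gamma> \<le> 0" using pos(1) by (simp add: mult_nonpos_nonneg)
      then show False using pos(2) by (smt (verit) zero_le_power2)
    qed
    obtain e where e: "e > 0" "\<And>x y. \<gamma> * x^2 + 2 * (- \<beta>) * x * y + \<alpha> * y^2 \<ge> e * (x^2 + y^2)"
      using quadratic_form_lower_bound[of \<alpha> \<gamma> "- \<beta>"] pos pos' by (auto simp: mult.commute)
    define C where "C = \<gamma> * (Im b1)^2 + 2 * (- \<beta>) * Im b1 * Im b2 + \<alpha> * (Im b2)^2"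
    define K where "K = 2 * e * (\<bar>Re b1\<bar> + \<bar>Re b2\<bar>)"
    have "(\<lambda>x. norm (case x of (a1, a2) \<Rightarrow> g a1 a2)) summable_on UNIV"
    proof (rule Infinite_Sum.abs_summable_on_comparison_test')
      show "(\<lambda>x::int \<times> int. exp (pi / D * C) * (case x of (a1, a2) \<Rightarrow> exp (- (pi / D * e) * (of_int a1 ^ 2 + of_int a2 ^ 2) + (pi / D * K) * (\<bar>of_int a1\<bar> + \<bar>of_int a2\<bar>)))) summable_on UNIV"
        using e D by (intro summable_on_cmult_right int2_gaussian_summable) auto
      fix x :: "int \<times> int"
      obtain a1 a2 where x: "x = (a1, a2)" by (cases x)
      let ?x1 = "Re b1 - of_int a1" and ?x2 = "Re b2 - of_int a2"
      have sq: "(r - a)^2 \<ge> a^2 - 2 * (\<bar>r\<bar> * \<bar>a\<bar>)" for r a :: real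
      proof -
        have "r * a \<le> \<bar>r\<bar> * \<bar>a\<bar>" by (metis abs_ge_self abs_mult)
        then show ?thesis using zero_le_power2[of r] unfolding power2_diff by linarith
      qed
      have "e * (of_int a1 ^ 2 + of_int a2 ^ 2) - K * (\<bar>of_int a1\<bar> + \<bar>of_int a2\<bar>) \<le> e * (?x1^2 + ?x2^2)"
      proof -
        have "e * ((of_int a1 ^ 2 - 2 * (\<bar>Re b1\<bar> * \<bar>of_int a1\<bar>)) + (of_int a2 ^ 2 - 2 * (\<bar>Re b2\<bar> * \<bar>of_int a2\<bar>))) \<le> e * (?x1^2 + ?x2^2)"
          using e(1) by (intro mult_left_mono add_mono sq) auto
        moreover have "0 \<le> e * (\<bar>Re b1\<bar> * \<bar>of_int a2\<bar>)" "0 \<le> e * (\<bar>Re b2\<bar> * \<bar>of_int a1\<bar>)" using e by auto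
        ultimately show ?thesis by (simp add: K_def algebra_simps)
      qed
      also have "\<dots> \<le> \<gamma> * ?x1^2 + 2 * (- \<beta>) * ?x1 * ?x2 + \<alpha> * ?x2^2" by (rule e)
      finally have "pi / D * (C - (\<gamma> * ?x1^2 + 2 * (- \<beta>) * ?x1 * ?x2 + \<alpha> * ?x2^2)) \<le> pi / D * (C - (e * (of_int a1 ^ 2 + of_int a2 ^ 2) - K * (\<bar>of_int a1\<bar> + \<bar>of_int a2\<bar>)))"
        using D by (intro mult_left_mono) auto
      also have "\<dots> = pi / D * C + (- (pi / D * e) * (of_int a1 ^ 2 + of_int a2 ^ 2) + (pi / D * K) * (\<bar>of_int a1\<bar> + \<bar>of_int a2\<bar>))"
        by (simp add: right_diff_distrib)
      finally have le: "pi / D * (C - (\<gamma> * ?x1^2 + 2 * (- \<beta>) * ?x1 * ?x2 + \<alpha> * ?x2^2)) \<le> \<dots>" .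
      have "norm (g a1 a2) = exp (Re (- of_real (pi / D) *
           (of_real \<gamma> * (b1 - of_int a1)^2 - 2 * of_real \<beta> * (b1 - of_int a1) * (b2 - of_int a2) + of_real \<alpha> * (b2 - of_int a2)^2)))"
        by (simp add: g_def)
      also have "Re (- of_real (pi / D) *
           (of_real \<gamma> * (b1 - of_int a1)^2 - 2 * of_real \<beta> * (b1 - of_int a1) * (b2 - of_int a2) + of_real \<alpha> * (b2 - of_int a2)^2))
         = pi / D * (C - (\<gamma> * ?x1^2 + 2 * (- \<beta>) * ?x1 * ?x2 + \<alpha> * ?x2^2))"
        using D by (simp add: C_def power2_eq_square) (simp add: field_simps)
      finally show "norm (case x of (a1, a2) \<Rightarrow> g a1 a2) \<le> exp (pi / D * C) * (case x of (a1, a2) \<Rightarrow> exp (- (pi / D * e) * (of_int a1 ^ 2 + of_int a2 ^ 2) + (pi / D * K) * (\<bar>of_int a1\<bar> + \<bar>of_int a2\<bar>)))"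
        using le unfolding x by (simp add: exp_add[symmetric])
    qed
    then show ?thesis by (rule abs_summable_summable)
  qed
  \<comment> \<open>The coupling of \<open>a1\<close> and \<open>d2\<close> in \<open>h\<close> is a
    pure phase, so its norm is a product of two one-variable terms.\<close>
  have hsum: "(\<lambda>(a1, d2). h a1 d2) summable_on UNIV \<times> UNIV"
  proof -
    have "(\<lambda>(a1::int, d2::int). norm (exp (- of_real (pi * (D / \<gamma>)) * of_int a1^2 + 2 * pi * \<i> * of_int a1 * (b1 - of_real (\<beta> / \<gamma>) * b2)))
        * norm (exp (- of_real (pi / \<gamma>) * (b2 - of_int d2)^2))) summable_on UNIV \<times> UNIV"
      using pos D by (intro summable_on_Times_mult theta_summable dual_theta_summable) auto
    also have "(\<lambda>(a1::int, d2::int). norm (exp (- of_real (pi * (D / \<gamma>)) * of_int a1^2 + 2 * pi * \<i> * of_int a1 * (b1 - of_real (\<beta> / \<gamma>) * b2)))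
        * norm (exp (- of_real (pi / \<gamma>) * (b2 - of_int d2)^2))) = (\<lambda>x. norm (case x of (a1, d2) \<Rightarrow> h a1 d2))"
      by (auto simp: h_def norm_mult power2_eq_square)
    finally show ?thesis by (rule abs_summable_summable)
  qed
  \<comment> \<open>The mixed term of the form is read as an imaginary shift of the characteristic
    of \<open>a2\<close>, which the one-variable formula admits.\<close>
  have inner_f: "(\<Sum>\<^sub>\<infinity>a2. f a1 a2) = of_real (1 / sqrt \<gamma>) * (\<Sum>\<^sub>\<infinity>d2. h a1 d2)" for a1
  proof -
    have "(\<Sum>\<^sub>\<infinity>a2. f a1 a2) = (\<Sum>\<^sub>\<infinity>a2::int. exp (- of_real (pi * \<alpha>) * of_int a1^2 + 2 * pi * \<i> * of_int a1 * b1) *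
        exp (- of_real (pi * \<gamma>) * of_int a2 ^ 2 + 2 * pi * \<i> * of_int a2 * (b2 + \<i> * of_real \<beta> * of_int a1)))"
      unfolding f_def exp_add[symmetric] by (intro infsum_cong arg_cong[where f=exp]) (simp add: algebra_simps)
    also have "\<dots> = of_real (1 / sqrt \<gamma>) * (exp (- of_real (pi * \<alpha>) * of_int a1^2 + 2 * pi * \<i> * of_int a1 * b1) *
        (\<Sum>\<^sub>\<infinity>d2::int. exp (- of_real (pi / \<gamma>) * (b2 + \<i> * of_real \<beta> * of_int a1 - of_int d2)^2)))"
      unfolding infsum_cmult_right' theta_inversion[OF pos(1)] by (simp only: mult.left_commute)
    also have "exp (- of_real (pi * \<alpha>) * of_int a1^2 + 2 * pi * \<i> * of_int a1 * b1) *
        (\<Sum>\<^sub>\<infinity>d2::int. exp (- of_real (pi / \<gamma>) * (b2 + \<i> * of_real \<beta> * of_int a1 - of_int d2)^2)) = (\<Sum>\<^sub>\<infinity>d2. h a1 d2)"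
      unfolding infsum_cmult_right'[symmetric] h_def exp_add[symmetric] using pos(1)
      by (intro infsum_cong arg_cong[where f=exp]) (simp add: D_def power2_eq_square field_simps)
    finally show ?thesis .
  qed
  have inner_h: "(\<Sum>\<^sub>\<infinity>a1. h a1 d2) = of_real (1 / sqrt (D / \<gamma>)) * (\<Sum>\<^sub>\<infinity>d1. g d1 d2)" for d2
  proof -
    have "(\<Sum>\<^sub>\<infinity>a1. h a1 d2) = of_real (1 / sqrt (D / \<gamma>)) * (exp (- of_real (pi / \<gamma>) * (b2 - of_int d2)^2) * 
        (\<Sum>\<^sub>\<infinity>d1::int. exp (- of_real (pi / (D / \<gamma>)) * (b1 - of_real (\<beta> / \<gamma>) * (b2 - of_int d2) - of_int d1)^2)))"
      unfolding h_def infsum_cmult_right' using theta_inversion[of "D / \<gamma>" "b1 - of_real (\<beta> / \<gamma>) * (b2 - of_int d2)"] D pos(1)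
      by simp
    also have "exp (- of_real (pi / \<gamma>) * (b2 - of_int d2)^2) * 
        (\<Sum>\<^sub>\<infinity>d1::int. exp (- of_real (pi / (D / \<gamma>)) * (b1 - of_real (\<beta> / \<gamma>) * (b2 - of_int d2) - of_int d1)^2)) = (\<Sum>\<^sub>\<infinity>d1. g d1 d2)"
      unfolding infsum_cmult_right'[symmetric] g_def exp_add[symmetric]
    proof (intro infsum_cong arg_cong[where f=exp])
      fix d1 :: int
      define k1 where "k1 = b1 - of_int d1"
      define k2 where "k2 = b2 - of_int d2"
      have g0: "complex_of_real \<gamma> \<noteq> 0" and D0: "complex_of_real D \<noteq> 0" using pos D by auto
      have Dc: "complex_of_real D = of_real \<alpha> * of_real \<gamma> - of_real \<beta> ^ 2" by (simp add: D_def)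
      have 1: "k1 - of_real (\<beta> / \<gamma>) * k2 = (of_real \<gamma> * k1 - of_real \<beta> * k2) / of_real \<gamma>"
        using g0 by (simp add: field_simps)
      have "of_real \<gamma> * (of_real \<gamma> * k1^2 - 2 * of_real \<beta> * k1 * k2 + of_real \<alpha> * k2^2) = (of_real \<gamma> * k1 - of_real \<beta> * k2)^2 + of_real D * k2^2"
        unfolding Dc by (simp add: power2_eq_square algebra_simps)
      then have 2: "of_real \<gamma> * k1^2 - 2 * of_real \<beta> * k1 * k2 + of_real \<alpha> * k2^2 = ((of_real \<gamma> * k1 - of_real \<beta> * k2)^2 + of_real D * k2^2) / of_real \<gamma>"
        using g0 by (metis nonzero_mult_div_cancel_left)
      have "- of_real (pi / \<gamma>) * k2^2 + - of_real (pi / (D / \<gamma>)) * (k1 - of_real (\<beta> / \<gamma>) * k2)^2 =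
        - of_real (pi / D) * (of_real \<gamma> * k1^2 - 2 * of_real \<beta> * k1 * k2 + of_real \<alpha> * k2^2)"
        unfolding 1 2 using g0 D0 by (simp add: field_simps power2_eq_square)
      moreover have "b1 - of_real (\<beta> / \<gamma>) * (b2 - of_int d2) - of_int d1 = k1 - of_real (\<beta> / \<gamma>) * k2"
        by (simp add: k1_def k2_def)
      ultimately show "- of_real (pi / \<gamma>) * (b2 - of_int d2)^2 + - of_real (pi / (D / \<gamma>)) * (b1 - of_real (\<beta> / \<gamma>) * (b2 - of_int d2) - of_int d1)^2
        = - of_real (pi / D) * (of_real \<gamma> * (b1 - of_int d1)^2 - 2 * of_real \<beta> * (b1 - of_int d1) * (b2 - of_int d2) + of_real \<alpha> * (b2 - of_int d2)^2)"
        by (simp only: k1_def k2_def)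
    qed
    finally show ?thesis .
  qed
  have "infsum (\<lambda>(a1, a2). f a1 a2) UNIV = (\<Sum>\<^sub>\<infinity>a1. \<Sum>\<^sub>\<infinity>a2. f a1 a2)"
    using infsum_Sigma'_banach[of f UNIV "\<lambda>_. UNIV"] fsum by simp
  also have "\<dots> = of_real (1 / sqrt \<gamma>) * (\<Sum>\<^sub>\<infinity>d2. \<Sum>\<^sub>\<infinity>a1. h a1 d2)"
    unfolding inner_f infsum_cmult_right' by (subst infsum_swap_banach[OF hsum]) simp
  also have "\<dots> = of_real (1 / sqrt \<gamma>) * (\<Sum>\<^sub>\<infinity>d2. of_real (1 / sqrt (D / \<gamma>)) * (\<Sum>\<^sub>\<infinity>d1. g d1 d2))"
    unfolding inner_h ..
  also have "of_real (1 / sqrt \<gamma>) * (\<Sum>\<^sub>\<infinity>d2. of_real (1 / sqrt (D / \<gamma>)) * (\<Sum>\<^sub>\<infinity>d1. g d1 d2)) = of_real (1 / sqrt D) * (\<Sum>\<^sub>\<infinity>d2. \<Sum>\<^sub>\<infinity>d1. g d1 d2)"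
    unfolding infsum_cmult_right' using pos(1) D by (simp add: real_sqrt_divide)
  also have "(\<Sum>\<^sub>\<infinity>d2. \<Sum>\<^sub>\<infinity>d1. g d1 d2) = (\<Sum>\<^sub>\<infinity>d1. \<Sum>\<^sub>\<infinity>d2. g d1 d2)"
    using infsum_swap_banach[of g UNIV UNIV] gsum by simp
  also have "\<dots> = infsum (\<lambda>(d1, d2). g d1 d2) UNIV"
    using infsum_Sigma'_banach[of g UNIV "\<lambda>_. UNIV"] gsum by simp
  finally show ?thesis unfolding f_def g_def D_def .
qed

section \<open>Poisson summation with polynomial factors\<close>

text \<open>Convergence at \<open>t = 1\<close> already gives a positive radius, and inside it a
  formal power series is determined by its values near 0.\<close>

lemma entire_power_series_zero:
  fixes c :: "nat \<Rightarrow> complex"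
  assumes "\<And>t. ((\<lambda>n. c n * t ^ n) has_sum 0) UNIV"
  shows "c n = 0"
proof -
  have s: "(\<lambda>n. c n * t ^ n) sums 0" for t using assms has_sum_imp_sums by blast
  have "eventually (\<lambda>z. eval_fps (Abs_fps c) z = eval_fps 0 z) (nhds 0)"
    using s by (auto simp: eval_fps_def sums_iff)
  moreover have "fps_conv_radius (Abs_fps c) > 0"
  proof -
    have "conv_radius c \<ge> norm (1::complex)"
      using s[of 1] by (intro conv_radius_geI) (auto simp: sums_iff)
    then show ?thesis 
      using less_le_trans[of 0 "ereal 1" "conv_radius c"] by (simp add: fps_conv_radius_def)
  qed
  ultimately have "Abs_fps c = 0" by (intro eval_fps_eqD) auto
  then show ?thesis by (metis Abs_fps_inverse UNIV_I fps_nth_Abs_fps fps_zero_nth)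
qed

text \<open>The difference is a power series in \<open>t1\<close> whose coefficients are power
  series in \<open>t2\<close>; the one-variable statement annihilates both layers in turn.\<close>

lemma entire_power_series_unique2:
  fixes f g :: "nat \<times> nat \<Rightarrow> complex"
  assumes f: "\<And>t1 t2. ((\<lambda>(h1, h2). f (h1, h2) * t1 ^ h1 * t2 ^ h2) has_sum S t1 t2) UNIV"
    and g: "\<And>t1 t2. ((\<lambda>(h1, h2). g (h1, h2) * t1 ^ h1 * t2 ^ h2) has_sum S t1 t2) UNIV"
  shows "f = g"
proof
  fix h :: "nat \<times> nat"
  define d where "d = (\<lambda>h. f h - g h)"
  have d: "((\<lambda>(h1, h2). d (h1, h2) * t1 ^ h1 * t2 ^ h2) has_sum 0) (UNIV \<times> UNIV)" for t1 t2
  proof -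
    have "((\<lambda>x. (case x of (h1, h2) \<Rightarrow> f (h1, h2) * t1 ^ h1 * t2 ^ h2) + - (case x of (h1, h2) \<Rightarrow> g (h1, h2) * t1 ^ h1 * t2 ^ h2)) has_sum S t1 t2 + - S t1 t2) UNIV"
      by (intro has_sum_add has_sum_uminusI f g)
    then show ?thesis by (simp add: d_def case_prod_unfold algebra_simps)
  qed
  have inner: "(\<lambda>h2. d (h1, h2) * t2 ^ h2) summable_on UNIV" for h1 t2
  proof -
    have "(\<lambda>(h1, h2). d (h1, h2) * 1 ^ h1 * t2 ^ h2) summable_on (UNIV \<times> UNIV)" using d[of 1 t2] by (rule has_sum_imp_summable)
    from summable_on_SigmaD1[OF this, of h1] show ?thesis by simp
  qed
  have z: "(\<Sum>\<^sub>\<infinity>h2. d (h1, h2) * t2 ^ h2) = 0" for h1 t2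
  proof (rule entire_power_series_zero)
    fix t1
    show "((\<lambda>h1. (\<Sum>\<^sub>\<infinity>h2. d (h1, h2) * t2 ^ h2) * t1 ^ h1) has_sum 0) UNIV"
    proof (rule has_sum_SigmaD[OF d[of t1 t2]])
      fix h1
      have "((\<lambda>h2. d (h1, h2) * t2 ^ h2 * t1 ^ h1) has_sum (\<Sum>\<^sub>\<infinity>h2. d (h1, h2) * t2 ^ h2) * t1 ^ h1) UNIV"
        by (intro has_sum_cmult_left has_sum_infsum inner)
      then show "((\<lambda>h2. case (h1, h2) of (h1, h2) \<Rightarrow> d (h1, h2) * t1 ^ h1 * t2 ^ h2) has_sum (\<Sum>\<^sub>\<infinity>h2. d (h1, h2) * t2 ^ h2) * t1 ^ h1) UNIV"
        by (simp add: mult_ac)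
    qed
  qed
  obtain h1 h2 where h: "h = (h1, h2)" by (cases h)
  have "d (h1, h2) = 0"
  proof (rule entire_power_series_zero[of "\<lambda>h2. d (h1, h2)"])
    fix t show "((\<lambda>n. d (h1, n) * t ^ n) has_sum 0) UNIV"
      using has_sum_infsum[OF inner[of h1 t]] z[of h1 t] by simp
  qed
  then show "f h = g h" by (simp add: h d_def)
qed

text \<open>\<^term>\<open>gauss_coeff\<close> is the coefficient of \<open>t\<^sub>1\<^sup>h\<^sup>1 t\<^sub>2\<^sup>h\<^sup>2\<close> in
  \<open>(a t\<^sub>1\<^sup>2 + 2 b t\<^sub>1 t\<^sub>2 + c t\<^sub>2\<^sup>2)\<^sup>k exp (t\<^sub>1 x\<^sub>1 + t\<^sub>2 x\<^sub>2)\<close>.\<close>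

fun gauss_coeff :: "'a \<Rightarrow> 'a \<Rightarrow> 'a \<Rightarrow> nat \<Rightarrow> nat \<Rightarrow> nat \<Rightarrow> 'a \<Rightarrow> 'a \<Rightarrow> 'a::real_normed_field" where
  "gauss_coeff a b c 0 h1 h2 x1 x2 = x1 ^ h1 / fact h1 * (x2 ^ h2 / fact h2)"
| "gauss_coeff a b c (Suc k) h1 h2 x1 x2 =
     a * (if 2 \<le> h1 then gauss_coeff a b c k (h1 - 2) h2 x1 x2 else 0)
     + 2 * b * (if 1 \<le> h1 \<and> 1 \<le> h2 then gauss_coeff a b c k (h1 - 1) (h2 - 1) x1 x2 else 0)
     + c * (if 2 \<le> h2 then gauss_coeff a b c k h1 (h2 - 2) x1 x2 else 0)"

text \<open>Every factor of the quadratic form uses up two degrees. The cruder count of one degree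
  per factor is what the finite range in \<open>gauss_poly\<close> relies on.\<close>

lemma gauss_coeff_eq_0: "h1 + h2 < k \<Longrightarrow> gauss_coeff a b c k h1 h2 x1 x2 = 0"
proof (induction k arbitrary: h1 h2)
  case (Suc k)
  have "2 \<le> h1 \<Longrightarrow> h1 - 2 + h2 < k" "1 \<le> h1 \<and> 1 \<le> h2 \<Longrightarrow> h1 - 1 + (h2 - 1) < k" "2 \<le> h2 \<Longrightarrow> h1 + (h2 - 2) < k"
    using Suc.prems by auto
  then show ?case using Suc.IH by auto
qed simp

text \<open>The majorant has the same shape with nonnegative data, so absolute convergence follows
  from the same generating function.\<close>

lemma norm_gauss_coeff_le:
  "norm (gauss_coeff a b c k h1 h2 x1 x2) \<le> gauss_coeff (norm a) (norm b) (norm c) k h1 h2 (norm x1) (norm x2)"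
proof (induction k arbitrary: h1 h2)
  case 0 then show ?case by (simp add: norm_mult norm_divide norm_power)
next
  case (Suc k)
  have n: "norm (a * p + 2 * b * q + c * r) \<le> norm a * norm p + 2 * norm b * norm q + norm c * norm r" for p q r :: 'a
    by (rule order_trans[OF norm_triangle_ineq], rule add_mono[OF order_trans[OF norm_triangle_ineq]]) (simp_all add: norm_mult)
  show ?case unfolding gauss_coeff.simps
    by (rule order_trans[OF n]) (intro add_mono mult_left_mono, auto simp: Suc.IH)
qed

text \<open>The index shift behind multiplying a double power series by a monomial; indices out of
  range receive the default 0.\<close>

lemma has_sum_shift2:
  fixes f :: "nat \<times> nat \<Rightarrow> 'a::real_normed_vector"
  assumes "(f has_sum S) UNIV"
  shows "((\<lambda>(h1, h2). if i \<le> h1 \<and> j \<le> h2 then f (h1 - i, h2 - j) else 0) has_sum S) UNIV"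
proof -
  have "((\<lambda>(h1, h2). f (h1 - i, h2 - j)) has_sum S) ({i..} \<times> {j..})"
    using assms
    by (subst has_sum_reindex_bij_witness[of _ "\<lambda>(h1, h2). (h1 + i, h2 + j)" "\<lambda>(h1, h2). (h1 - i, h2 - j)" UNIV f _ S]) auto
  then show ?thesis
    by (rule has_sum_cong_neutral[THEN iffD1, rotated -1]) (auto split: if_splits)
qed

lemma gauss_coeff_has_sum:
  fixes a b c x1 x2 t1 t2 :: "'a::{real_normed_field, banach, second_countable_topology}"
  shows "((\<lambda>(h1, h2). gauss_coeff a b c k h1 h2 x1 x2 * t1 ^ h1 * t2 ^ h2) has_sum
           (a * t1^2 + 2 * b * t1 * t2 + c * t2^2) ^ k * exp (t1 * x1 + t2 * x2)) UNIV"
proof (induction k)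
  case 0
  have e: "((\<lambda>n. x ^ n / fact n * t ^ n) has_sum exp (t * x)) UNIV" 
    and en: "(\<lambda>n. norm (x ^ n / fact n * t ^ n)) summable_on UNIV" for x t :: 'a
  proof -
    have "summable (\<lambda>n. norm ((t * x) ^ n /\<^sub>R fact n))" by (rule summable_norm_exp)
    then have *: "summable (\<lambda>n. norm (x ^ n / fact n * t ^ n))" 
      by (simp add: power_mult_distrib divide_inverse norm_mult norm_inverse mult_ac)
    then show "(\<lambda>n. norm (x ^ n / fact n * t ^ n)) summable_on UNIV"
      by (intro summable_nonneg_imp_summable_on) auto
    have "(\<lambda>n. (t * x) ^ n /\<^sub>R fact n) sums exp (t * x)" by (rule exp_converges)
    then have "(\<lambda>n. x ^ n / fact n * t ^ n) sums exp (t * x)"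
      by (simp add: power_mult_distrib divide_inverse scaleR_conv_of_real mult_ac)
    then show "((\<lambda>n. x ^ n / fact n * t ^ n) has_sum exp (t * x)) UNIV"
      by (rule norm_summable_imp_has_sum[OF *])
  qed
  have "((\<lambda>(h1, h2). (x1 ^ h1 / fact h1 * t1 ^ h1) * (x2 ^ h2 / fact h2 * t2 ^ h2)) has_sum exp (t1 * x1) * exp (t2 * x2)) (UNIV \<times> UNIV)"
  proof (rule has_sum_SigmaI)
    show "((\<lambda>y. case (h1, y) of (h1, h2) \<Rightarrow> (x1 ^ h1 / fact h1 * t1 ^ h1) * (x2 ^ h2 / fact h2 * t2 ^ h2)) has_sum (x1 ^ h1 / fact h1 * t1 ^ h1) * exp (t2 * x2)) UNIV" for h1
      using has_sum_cmult_right[OF e[of x2 t2], of "x1 ^ h1 / fact h1 * t1 ^ h1"] by simp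
    show "((\<lambda>h1. (x1 ^ h1 / fact h1 * t1 ^ h1) * exp (t2 * x2)) has_sum exp (t1 * x1) * exp (t2 * x2)) UNIV"
      by (intro has_sum_cmult_left e)
    have "(\<lambda>(h1, h2). norm (x1 ^ h1 / fact h1 * t1 ^ h1) * norm (x2 ^ h2 / fact h2 * t2 ^ h2)) summable_on UNIV \<times> UNIV"
      by (intro summable_on_Times_mult en) auto
    then have "(\<lambda>x. norm (case x of (h1, h2) \<Rightarrow> (x1 ^ h1 / fact h1 * t1 ^ h1) * (x2 ^ h2 / fact h2 * t2 ^ h2))) summable_on UNIV \<times> UNIV"
      by (simp only: case_prod_unfold norm_mult)
    then show "(\<lambda>(h1, h2). (x1 ^ h1 / fact h1 * t1 ^ h1) * (x2 ^ h2 / fact h2 * t2 ^ h2)) summable_on UNIV \<times> UNIV"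
      by (rule abs_summable_summable)
  qed
  then show ?case by (simp add: exp_add mult_ac)
next
  case (Suc k)
  let ?S = "(a * t1^2 + 2 * b * t1 * t2 + c * t2^2) ^ k * exp (t1 * x1 + t2 * x2)"
  let ?g = "\<lambda>i j (h1, h2). if i \<le> h1 \<and> j \<le> h2 then gauss_coeff a b c k (h1 - i) (h2 - j) x1 x2 * t1 ^ (h1 - i) * t2 ^ (h2 - j) else 0"
  have g: "(?g i j has_sum ?S) UNIV" for i j using has_sum_shift2[OF Suc, of i j] by (simp only: prod.case)
  have "((\<lambda>h. a * t1^2 * ?g 2 0 h + 2 * b * t1 * t2 * ?g 1 1 h + c * t2^2 * ?g 0 2 h) has_sum
      a * t1^2 * ?S + 2 * b * t1 * t2 * ?S + c * t2^2 * ?S) UNIV"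
    by (intro has_sum_add has_sum_cmult_right g)
  also have "a * t1^2 * ?S + 2 * b * t1 * t2 * ?S + c * t2^2 * ?S = (a * t1^2 + 2 * b * t1 * t2 + c * t2^2) ^ Suc k * exp (t1 * x1 + t2 * x2)"
    by (simp add: algebra_simps)
  also have "(\<lambda>h. a * t1^2 * ?g 2 0 h + 2 * b * t1 * t2 * ?g 1 1 h + c * t2^2 * ?g 0 2 h) =
    (\<lambda>(h1, h2). gauss_coeff a b c (Suc k) h1 h2 x1 x2 * t1 ^ h1 * t2 ^ h2)"
  proof (rule ext)
    fix h :: "nat \<times> nat"
    obtain h1 h2 where h: "h = (h1, h2)" by (cases h)
    have p2: "2 \<le> h \<Longrightarrow> t^2 * t ^ (h - 2) = t ^ h" for t :: 'a and h
      by (metis le_add_diff_inverse power_add)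
    have p1: "Suc 0 \<le> h \<Longrightarrow> t * t ^ (h - Suc 0) = t ^ h" for t :: 'a and h
      by (metis Suc_pred' less_eq_Suc_le One_nat_def power_Suc)
    have A: "a * t1^2 * ?g 2 0 (h1, h2) = a * (if 2 \<le> h1 then gauss_coeff a b c k (h1 - 2) h2 x1 x2 else 0) * t1 ^ h1 * t2 ^ h2"
      using p2[of h1 t1] by (auto simp: mult_ac)
    have B: "2 * b * t1 * t2 * ?g 1 1 (h1, h2) = 2 * b * (if 1 \<le> h1 \<and> 1 \<le> h2 then gauss_coeff a b c k (h1 - 1) (h2 - 1) x1 x2 else 0) * t1 ^ h1 * t2 ^ h2"
    proof (cases "1 \<le> h1 \<and> 1 \<le> h2")
      case True
      then have "2 * b * t1 * t2 * ?g 1 1 (h1, h2) = 2 * b * gauss_coeff a b c k (h1 - 1) (h2 - 1) x1 x2 * (t1 * t1 ^ (h1 - Suc 0)) * (t2 * t2 ^ (h2 - Suc 0))"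
        by (simp add: mult_ac)
      then show ?thesis using True by (simp add: p1)
    qed auto
    have C: "c * t2^2 * ?g 0 2 (h1, h2) = c * (if 2 \<le> h2 then gauss_coeff a b c k h1 (h2 - 2) x1 x2 else 0) * t1 ^ h1 * t2 ^ h2"
      using p2[of h2 t2] by (auto simp: mult_ac)
    show "a * t1^2 * ?g 2 0 h + 2 * b * t1 * t2 * ?g 1 1 h + c * t2^2 * ?g 0 2 h = (case h of (h1, h2) \<Rightarrow> gauss_coeff a b c (Suc k) h1 h2 x1 x2 * t1 ^ h1 * t2 ^ h2)"
      using A B C unfolding h prod.case gauss_coeff.simps distrib_right by presburger
  qed
  finally show ?case .
qed

text \<open>Two-variable Hermite polynomials divided by h1! h2!: the Taylor coefficients of exp(Q(t)
  + t x), with Q the quadratic form of \<open>a\<close>, \<open>b\<close>, \<open>c\<close>. Larger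
  \<open>k\<close> contribute nothing.\<close>

definition gauss_poly :: "'a \<Rightarrow> 'a \<Rightarrow> 'a \<Rightarrow> nat \<Rightarrow> nat \<Rightarrow> 'a \<Rightarrow> 'a \<Rightarrow> 'a::real_normed_field" where
  "gauss_poly a b c h1 h2 x1 x2 = (\<Sum>k\<le>h1 + h2. gauss_coeff a b c k h1 h2 x1 x2 / fact k)"

text \<open>Summing over \<open>k\<close> with weights 1/k! exponentiates the form; the array of
  norms justifies exchanging \<open>k\<close> with the two degrees. The explicit bound in the third
  claim controls a further exchange with a lattice sum.\<close>

lemma gauss_poly_has_sum:
  fixes a b c x1 x2 t1 t2 :: "'a::{real_normed_field, banach, second_countable_topology}"
  shows "((\<lambda>(h1, h2). gauss_poly a b c h1 h2 x1 x2 * t1 ^ h1 * t2 ^ h2) has_sum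
           exp (a * t1^2 + 2 * b * t1 * t2 + c * t2^2 + t1 * x1 + t2 * x2)) UNIV"
    (is "(?P has_sum _) _")
    and "(\<lambda>(h1, h2). norm (gauss_poly a b c h1 h2 x1 x2 * t1 ^ h1 * t2 ^ h2)) summable_on UNIV"
    and "(\<Sum>\<^sub>\<infinity>(h1, h2). norm (gauss_poly a b c h1 h2 x1 x2 * t1 ^ h1 * t2 ^ h2)) \<le>
           exp (norm a * norm t1^2 + 2 * norm b * norm t1 * norm t2 + norm c * norm t2^2 + norm t1 * norm x1 + norm t2 * norm x2)"
proof -
  define T where "T = (\<lambda>(k::nat, h1, h2). gauss_coeff a b c k h1 h2 x1 x2 / fact k * t1 ^ h1 * t2 ^ h2)"
  define Tn where "Tn = (\<lambda>(k::nat, h1, h2). gauss_coeff (norm a) (norm b) (norm c) k h1 h2 (norm x1) (norm x2) / fact k * norm t1 ^ h1 * norm t2 ^ h2)"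
  define Q where "Q = a * t1^2 + 2 * b * t1 * t2 + c * t2^2"
  define Qn where "Qn = norm a * norm t1^2 + 2 * norm b * norm t1 * norm t2 + norm c * norm t2^2"
  define L where "L = exp (t1 * x1 + t2 * x2)"
  define Ln where "Ln = exp (norm t1 * norm x1 + norm t2 * norm x2)"
  have Tk: "((\<lambda>h. T (k, h)) has_sum Q ^ k / fact k * L) UNIV" for k
    using has_sum_cmult_left[OF gauss_coeff_has_sum[of a b c k x1 x2 t1 t2], of "1 / fact k"]
    unfolding T_def Q_def L_def by (simp add: case_prod_unfold mult_ac)
  have Tnk: "((\<lambda>h. Tn (k, h)) has_sum Qn ^ k / fact k * Ln) UNIV" for k
    using has_sum_cmult_left[OF gauss_coeff_has_sum[of "norm a" "norm b" "norm c" k "norm x1" "norm x2" "norm t1" "norm t2"], of "1 / fact k"]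
    unfolding Tn_def Qn_def Ln_def by (simp add: case_prod_unfold mult_ac)
  have exps: "((\<lambda>k. q ^ k / fact k) has_sum exp q) UNIV" for q :: "'b::{real_normed_field, banach}"
  proof (rule norm_summable_imp_has_sum)
    show "summable (\<lambda>k. norm (q ^ k / fact k))"
      using summable_norm_exp[of q] by (simp add: divide_inverse norm_mult norm_inverse mult_ac)
    show "(\<lambda>k. q ^ k / fact k) sums exp q"
      using exp_converges[of q] by (simp add: scaleR_conv_of_real divide_inverse mult_ac)
  qed
  have Qn0: "Qn \<ge> 0" by (simp add: Qn_def)
  have Tnn: "Tn x \<ge> 0" for x
  proof -
    obtain k h1 h2 where x: "x = (k, h1, h2)" by (cases x)
    have "0 \<le> gauss_coeff (norm a) (norm b) (norm c) k h1 h2 (norm x1) (norm x2)"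
      using norm_gauss_coeff_le[of a b c k h1 h2 x1 x2] norm_ge_zero order_trans by blast
    then show ?thesis by (simp add: x Tn_def)
  qed
  have Tnsum: "Tn summable_on UNIV \<times> UNIV"
    by (rule summable_on_SigmaI[where g="\<lambda>k. Qn ^ k / fact k * Ln"])
      (rule Tnk, rule summable_on_cmult_left[OF has_sum_imp_summable[OF exps]], rule Tnn)
  have Tnorm: "norm (T x) \<le> Tn x" for x
    by (cases x) (auto simp: T_def Tn_def norm_mult norm_divide norm_power intro!: mult_right_mono divide_right_mono norm_gauss_coeff_le)
  have Tabs: "(\<lambda>x. norm (T x)) summable_on UNIV \<times> UNIV"
    by (rule Infinite_Sum.abs_summable_on_comparison_test'[OF Tnsum Tnorm])
  have Tsum: "T summable_on UNIV \<times> UNIV" by (rule abs_summable_summable[OF Tabs])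
  have Ths: "(T has_sum exp Q * L) (UNIV \<times> UNIV)"
    by (rule has_sum_SigmaI[where g="\<lambda>k. Q ^ k / fact k * L", OF Tk has_sum_cmult_left[OF exps] Tsum])
  have Tnhs: "(Tn has_sum exp Qn * Ln) (UNIV \<times> UNIV)"
    by (rule has_sum_SigmaI[where g="\<lambda>k. Qn ^ k / fact k * Ln", OF Tnk has_sum_cmult_left[OF exps] Tnsum])
  have Pk: "((\<lambda>k. T (k, h)) has_sum ?P h) UNIV" for h
  proof -
    obtain h1 h2 where h: "h = (h1, h2)" by (cases h)
    have "((\<lambda>k. T (k, h)) has_sum (\<Sum>k\<le>h1 + h2. T (k, h))) UNIV"
      by (rule has_sum_finite_neutralI[of "{..h1 + h2}"]) (auto simp: T_def h gauss_coeff_eq_0)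
    then show ?thesis by (simp add: h T_def gauss_poly_def sum_distrib_right)
  qed
  have "((\<lambda>(h, k). T (k, h)) has_sum exp Q * L) (UNIV \<times> UNIV)" using has_sum_swap[THEN iffD1, OF Ths] .
  then have "(?P has_sum exp Q * L) UNIV"
    by (rule has_sum_SigmaD) (use Pk in auto)
  then show "(?P has_sum exp (a * t1^2 + 2 * b * t1 * t2 + c * t2^2 + t1 * x1 + t2 * x2)) UNIV"
    by (simp add: Q_def L_def exp_add[symmetric] add.assoc)
  have swn: "((\<lambda>(h, k). Tn (k, h)) has_sum exp Qn * Ln) (UNIV \<times> UNIV)" using has_sum_swap[THEN iffD1, OF Tnhs] .
  have Tnh: "(\<lambda>k. Tn (k, h)) summable_on UNIV" for h
    using summable_on_SigmaD1[of "\<lambda>h k. Tn (k, h)" UNIV "\<lambda>_. UNIV" h] has_sum_imp_summable[OF swn] by simp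
  have N: "((\<lambda>h. \<Sum>\<^sub>\<infinity>k. Tn (k, h)) has_sum exp Qn * Ln) UNIV"
    by (rule has_sum_SigmaD[OF swn]) (use Tnh in auto)
  have le: "norm (?P h) \<le> (\<Sum>\<^sub>\<infinity>k. Tn (k, h))" for h
    by (rule norm_infsum_le[OF Pk has_sum_infsum[OF Tnh] Tnorm])
  have s: "(\<lambda>h. norm (?P h)) summable_on UNIV"
    by (rule Infinite_Sum.abs_summable_on_comparison_test'[OF has_sum_imp_summable[OF N] le])
  then show "(\<lambda>(h1, h2). norm (gauss_poly a b c h1 h2 x1 x2 * t1 ^ h1 * t2 ^ h2)) summable_on UNIV"
    by (simp add: case_prod_unfold)
  have "(\<Sum>\<^sub>\<infinity>h. norm (?P h)) \<le> (\<Sum>\<^sub>\<infinity>h. \<Sum>\<^sub>\<infinity>k. Tn (k, h))"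
    by (rule infsum_mono[OF s has_sum_imp_summable[OF N] le])
  also have "\<dots> = exp Qn * Ln" using N by (rule infsumI)
  finally show "(\<Sum>\<^sub>\<infinity>(h1, h2). norm (gauss_poly a b c h1 h2 x1 x2 * t1 ^ h1 * t2 ^ h2)) \<le>
           exp (norm a * norm t1^2 + 2 * norm b * norm t1 * norm t2 + norm c * norm t2^2 + norm t1 * norm x1 + norm t2 * norm x2)"
    by (simp add: Qn_def Ln_def exp_add[symmetric] add.assoc case_prod_unfold)
qed

text \<open>Makes the dual side of the Poisson formula, where the quadratic term in t has cancelled,
  a member of the same family.\<close>

lemma gauss_poly_0: "gauss_poly 0 0 0 h1 h2 x1 x2 = x1 ^ h1 / fact h1 * (x2 ^ h2 / fact h2)"
proof -
  have "gauss_coeff 0 0 0 k h1 h2 x1 x2 = 0" if "k > 0" for k using that by (cases k) auto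
  then have "gauss_poly 0 0 0 h1 h2 x1 x2 = (\<Sum>k\<in>{0}. gauss_coeff 0 0 0 k h1 h2 x1 x2 / fact k)"
    unfolding gauss_poly_def by (intro sum.mono_neutral_right) auto
  then show ?thesis by simp
qed

text \<open>The weight \<open>E\<close> decays faster than any exponential in \<open>X1\<close>,
  \<open>X2\<close> grows, so the double family over \<open>i\<close> and the degrees is absolutely
  summable. Taylor coefficients can therefore be taken under the sum over \<open>i\<close>.\<close>

lemma gauss_poly_family:
  fixes E X1 X2 :: "'i \<Rightarrow> complex" and a b c :: complex
  assumes sum: "\<And>s1 s2::real. s1 \<ge> 0 \<Longrightarrow> s2 \<ge> 0 \<Longrightarrow> (\<lambda>i. norm (E i) * exp (s1 * norm (X1 i) + s2 * norm (X2 i))) summable_on UNIV"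
  shows "(\<lambda>i. norm (gauss_poly a b c h1 h2 (X1 i) (X2 i) * E i)) summable_on UNIV"
    and "((\<lambda>(h1, h2). (\<Sum>\<^sub>\<infinity>i. gauss_poly a b c h1 h2 (X1 i) (X2 i) * E i) * t1 ^ h1 * t2 ^ h2)
           has_sum (\<Sum>\<^sub>\<infinity>i. E i * exp (a * t1^2 + 2 * b * t1 * t2 + c * t2^2 + t1 * X1 i + t2 * X2 i))) UNIV"
proof -
  define T where "T = (\<lambda>t1 t2 (i, h1, h2). E i * (gauss_poly a b c h1 h2 (X1 i) (X2 i) * t1 ^ h1 * t2 ^ h2))"
  have Tabs: "(\<lambda>x. norm (T t1 t2 x)) summable_on UNIV \<times> UNIV" for t1 t2
  proof -
    define W where "W = (\<lambda>i. norm (E i) * (\<Sum>\<^sub>\<infinity>(h1, h2). norm (gauss_poly a b c h1 h2 (X1 i) (X2 i) * t1 ^ h1 * t2 ^ h2)))"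
    define Z where "Z = (\<lambda>i. exp (norm a * norm t1^2 + 2 * norm b * norm t1 * norm t2 + norm c * norm t2^2) * (norm (E i) * exp (norm t1 * norm (X1 i) + norm t2 * norm (X2 i))))"
    have Z: "Z summable_on UNIV" unfolding Z_def by (intro summable_on_cmult_right sum) auto
    have WZ: "W i \<le> Z i" for i
      using mult_left_mono[OF gauss_poly_has_sum(3)[of a b c "X1 i" "X2 i" t1 t2], of "norm (E i)"]
      by (simp add: W_def Z_def exp_add mult_ac)
    have W: "W summable_on UNIV"
      by (rule summable_on_comparison_test[OF Z WZ]) (auto simp: W_def intro!: mult_nonneg_nonneg infsum_nonneg)
    show ?thesis
    proof (rule summable_on_SigmaI[OF _ W])
      fix i
      have "((\<lambda>h. norm (E i) * (case h of (h1, h2) \<Rightarrow> norm (gauss_poly a b c h1 h2 (X1 i) (X2 i) * t1 ^ h1 * t2 ^ h2))) has_sum W i) UNIV"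
        unfolding W_def by (intro has_sum_cmult_right has_sum_infsum gauss_poly_has_sum(2))
      then show "((\<lambda>h. norm (T t1 t2 (i, h))) has_sum W i) UNIV"
        by (simp add: T_def case_prod_unfold norm_mult)
    qed auto
  qed
  have T: "T t1 t2 summable_on UNIV \<times> UNIV" for t1 t2 by (rule abs_summable_summable[OF Tabs])
  have sw: "(\<lambda>(h, i). T t1 t2 (i, h)) summable_on UNIV \<times> UNIV" for t1 t2
    using T[of t1 t2] by (subst (asm) summable_on_swap)
  have swn: "(\<lambda>(h, i). norm (T t1 t2 (i, h))) summable_on UNIV \<times> UNIV" for t1 t2
    using Tabs[of t1 t2] by (subst (asm) summable_on_swap)
  have col: "(\<lambda>i. norm (gauss_poly a b c h1 h2 (X1 i) (X2 i) * E i)) summable_on UNIV" for h1 h2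
  proof -
    have "(\<lambda>i. norm (T 1 1 (i, (h1, h2)))) summable_on UNIV"
      by (rule summable_on_SigmaD1[OF swn[of 1 1]]) auto
    then show ?thesis by (simp add: T_def mult.commute)
  qed
  then show "(\<lambda>i. norm (gauss_poly a b c h1 h2 (X1 i) (X2 i) * E i)) summable_on UNIV" .
  have row: "((\<lambda>h. T t1 t2 (i, h)) has_sum E i * exp (a * t1^2 + 2 * b * t1 * t2 + c * t2^2 + t1 * X1 i + t2 * X2 i)) UNIV" for i
    using has_sum_cmult_right[OF gauss_poly_has_sum(1)[of a b c "X1 i" "X2 i" t1 t2], of "E i"]
    by (simp add: T_def case_prod_unfold)
  have "((\<lambda>i. E i * exp (a * t1^2 + 2 * b * t1 * t2 + c * t2^2 + t1 * X1 i + t2 * X2 i)) has_sum infsum (T t1 t2) (UNIV \<times> UNIV)) UNIV"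
    by (rule has_sum_SigmaD[OF has_sum_infsum[OF T]]) (use row in auto)
  then have tot: "infsum (T t1 t2) (UNIV \<times> UNIV) = (\<Sum>\<^sub>\<infinity>i. E i * exp (a * t1^2 + 2 * b * t1 * t2 + c * t2^2 + t1 * X1 i + t2 * X2 i))"
    by (simp add: infsumI)
  have hs: "((\<lambda>(h, i). T t1 t2 (i, h)) has_sum infsum (T t1 t2) (UNIV \<times> UNIV)) (UNIV \<times> UNIV)"
    using has_sum_infsum[OF T[of t1 t2]] by (subst (asm) has_sum_swap)
  have "((\<lambda>h. case h of (h1, h2) \<Rightarrow> (\<Sum>\<^sub>\<infinity>i. gauss_poly a b c h1 h2 (X1 i) (X2 i) * E i) * t1 ^ h1 * t2 ^ h2) has_sum infsum (T t1 t2) (UNIV \<times> UNIV)) UNIV"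
  proof (rule has_sum_SigmaD[OF hs])
    fix h :: "nat \<times> nat"
    obtain h1 h2 where h: "h = (h1, h2)" by (cases h)
    have "((\<lambda>i. gauss_poly a b c h1 h2 (X1 i) (X2 i) * E i * (t1 ^ h1 * t2 ^ h2)) has_sum (\<Sum>\<^sub>\<infinity>i. gauss_poly a b c h1 h2 (X1 i) (X2 i) * E i) * (t1 ^ h1 * t2 ^ h2)) UNIV"
      by (intro has_sum_cmult_left has_sum_infsum abs_summable_summable[OF col])
    then show "((\<lambda>i. case (h, i) of (h, i) \<Rightarrow> T t1 t2 (i, h)) has_sum (case h of (h1, h2) \<Rightarrow> (\<Sum>\<^sub>\<infinity>i. gauss_poly a b c h1 h2 (X1 i) (X2 i) * E i) * t1 ^ h1 * t2 ^ h2)) UNIV"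
      by (simp add: h T_def mult_ac)
  qed
  then show "((\<lambda>(h1, h2). (\<Sum>\<^sub>\<infinity>i. gauss_poly a b c h1 h2 (X1 i) (X2 i) * E i) * t1 ^ h1 * t2 ^ h2)
           has_sum (\<Sum>\<^sub>\<infinity>i. E i * exp (a * t1^2 + 2 * b * t1 * t2 + c * t2^2 + t1 * X1 i + t2 * X2 i))) UNIV"
    unfolding tot .
qed

lemma affine_gaussian_summable:
  fixes e S N p1 p2 :: real
  assumes "e > 0" "N > 0" "S \<ge> 0"
  shows "(\<lambda>(a1::int, a2::int). exp (- e * ((p1 + of_int a1 * N)^2 + (p2 + of_int a2 * N)^2)
      + S * (\<bar>p1 + of_int a1 * N\<bar> + \<bar>p2 + of_int a2 * N\<bar>))) summable_on UNIV"
proof (rule summable_on_comparison_test)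
  let ?K = "2 * e * N * (\<bar>p1\<bar> + \<bar>p2\<bar>) + S * N"
  show "(\<lambda>x::int \<times> int. exp (S * (\<bar>p1\<bar> + \<bar>p2\<bar>)) * (case x of (a1, a2) \<Rightarrow>
     exp (- (e * N^2) * (of_int a1 ^ 2 + of_int a2 ^ 2) + ?K * (\<bar>of_int a1\<bar> + \<bar>of_int a2\<bar>)))) summable_on UNIV"
    using assms by (intro summable_on_cmult_right int2_gaussian_summable) auto
  fix x :: "int \<times> int"
  obtain a1 a2 where x: "x = (a1, a2)" by (cases x)
  have sq: "(p + of_int a * N)^2 \<ge> N^2 * of_int a^2 - 2 * N * (\<bar>p\<bar> * \<bar>of_int a\<bar>)" for p :: real and a :: int
  proof -
    have "- (p * of_int a) \<le> \<bar>p\<bar> * \<bar>of_int a\<bar>" by (metis abs_ge_minus_self abs_mult)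
    then have "2 * N * (- (p * of_int a)) \<le> 2 * N * (\<bar>p\<bar> * \<bar>of_int a\<bar>)" using assms by (intro mult_left_mono) auto
    moreover have "(p + of_int a * N)^2 = p^2 + N^2 * of_int a^2 + 2 * N * (p * of_int a)"
      by (simp add: power2_eq_square algebra_simps)
    ultimately show ?thesis using zero_le_power2[of p] by linarith
  qed
  have ab: "\<bar>p + of_int a * N\<bar> \<le> \<bar>p\<bar> + N * \<bar>of_int a\<bar>" for p :: real and a :: int
    using abs_triangle_ineq[of p "of_int a * N"] assms(2) by (simp add: abs_mult mult.commute)
  have "e * ((N^2 * of_int a1^2 - 2 * N * (\<bar>p1\<bar> * \<bar>of_int a1\<bar>)) + (N^2 * of_int a2^2 - 2 * N * (\<bar>p2\<bar> * \<bar>of_int a2\<bar>)))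
     \<le> e * ((p1 + of_int a1 * N)^2 + (p2 + of_int a2 * N)^2)"
    using assms by (intro mult_left_mono add_mono sq) auto
  moreover have "S * (\<bar>p1 + of_int a1 * N\<bar> + \<bar>p2 + of_int a2 * N\<bar>) \<le> S * ((\<bar>p1\<bar> + N * \<bar>of_int a1\<bar>) + (\<bar>p2\<bar> + N * \<bar>of_int a2\<bar>))"
    using assms by (intro mult_left_mono add_mono ab) auto
  moreover have "0 \<le> e * N * (\<bar>p1\<bar> * \<bar>of_int a2\<bar>)" "0 \<le> e * N * (\<bar>p2\<bar> * \<bar>of_int a1\<bar>)" using assms by auto
  ultimately have "- e * ((p1 + of_int a1 * N)^2 + (p2 + of_int a2 * N)^2) + S * (\<bar>p1 + of_int a1 * N\<bar> + \<bar>p2 + of_int a2 * N\<bar>)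
    \<le> S * (\<bar>p1\<bar> + \<bar>p2\<bar>) + (- (e * N^2) * (of_int a1 ^ 2 + of_int a2 ^ 2) + ?K * (\<bar>of_int a1\<bar> + \<bar>of_int a2\<bar>))"
    by (simp add: algebra_simps)
  then show "(case x of (a1, a2) \<Rightarrow> exp (- e * ((p1 + of_int a1 * N)^2 + (p2 + of_int a2 * N)^2)
      + S * (\<bar>p1 + of_int a1 * N\<bar> + \<bar>p2 + of_int a2 * N\<bar>)))
     \<le> exp (S * (\<bar>p1\<bar> + \<bar>p2\<bar>)) * (case x of (a1, a2) \<Rightarrow>
     exp (- (e * N^2) * (of_int a1 ^ 2 + of_int a2 ^ 2) + ?K * (\<bar>of_int a1\<bar> + \<bar>of_int a2\<bar>)))"
    unfolding x prod.case exp_add[symmetric] exp_le_cancel_iff .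
qed auto

text \<open>For a symmetric matrix S, the form of the adjugate at S v is det S times the form of S
  at v. It passes between a form and its dual without dividing.\<close>

lemma adjugate_quadratic_form:
  fixes \<alpha> \<beta> \<gamma> x y :: "'a::comm_ring_1"
  shows "\<gamma> * (\<alpha> * x + \<beta> * y)^2 - 2 * \<beta> * (\<alpha> * x + \<beta> * y) * (\<beta> * x + \<gamma> * y) + \<alpha> * (\<beta> * x + \<gamma> * y)^2
    = (\<alpha> * \<gamma> - \<beta>^2) * (\<alpha> * x^2 + 2 * \<beta> * x * y + \<gamma> * y^2)"
  by (simp add: power2_eq_square algebra_simps)

text \<open>All degrees are handled at once: both sides are Taylor coefficients in t of one
  identity, an instance of \<open>theta_inversion_2d\<close> for 2N times the given form. The
  arguments of \<open>gauss_poly\<close> are - N / (8 pi) times the inverse form, the one value that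
  cancels the quadratic term in t on the dual side.\<close>

theorem gauss_poly_theta_inversion:
  fixes \<alpha> \<beta> \<gamma> N p1 p2 :: real and b1 b2 :: complex
  assumes pos: "\<gamma> > 0" "\<alpha> * \<gamma> - \<beta>^2 > 0" and N: "N > 0"
  defines "D \<equiv> \<alpha> * \<gamma> - \<beta>^2"
  defines "X1 \<equiv> (\<lambda>(a1::int, a2::int). p1 + of_int a1 * N)"
  defines "X2 \<equiv> (\<lambda>(a1::int, a2::int). p2 + of_int a2 * N)"
  defines "E \<equiv> (\<lambda>a. exp (- of_real (2 * pi / N) * (of_real \<alpha> * of_real (X1 a)^2 + 2 * of_real \<beta> * of_real (X1 a) * of_real (X2 a) + of_real \<gamma> * of_real (X2 a)^2)
           + 2 * pi * \<i> / N * (of_real (X1 a) * b1 + of_real (X2 a) * b2)))"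
  defines "A1 \<equiv> (\<lambda>(d1::int, d2::int). (of_real \<gamma> * (b1 + of_int d1) - of_real \<beta> * (b2 + of_int d2)) / of_real D)"
  defines "A2 \<equiv> (\<lambda>(d1::int, d2::int). (- of_real \<beta> * (b1 + of_int d1) + of_real \<alpha> * (b2 + of_int d2)) / of_real D)"
  defines "F \<equiv> (\<lambda>(d1::int, d2::int). exp (- of_real (pi / (2 * N)) * ((of_real \<gamma> * (b1 + of_int d1)^2 - 2 * of_real \<beta> * (b1 + of_int d1) * (b2 + of_int d2) + of_real \<alpha> * (b2 + of_int d2)^2) / of_real D)
           - 2 * pi * \<i> / N * (of_int d1 * of_real p1 + of_int d2 * of_real p2)))"
  shows "(\<Sum>\<^sub>\<infinity>a. gauss_poly (- of_real (N * \<gamma> / (8 * pi * D))) (of_real (N * \<beta> / (8 * pi * D))) (- of_real (N * \<alpha> / (8 * pi * D))) h1 h2 (of_real (X1 a)) (of_real (X2 a)) * E a)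
     = of_real (1 / (2 * N * sqrt D)) * (\<Sum>\<^sub>\<infinity>d. (\<i> / 2 * A1 d) ^ h1 / fact h1 * ((\<i> / 2 * A2 d) ^ h2 / fact h2) * F d)" (is ?eq)
    and "(\<lambda>a. gauss_poly (- of_real (N * \<gamma> / (8 * pi * D))) (of_real (N * \<beta> / (8 * pi * D))) (- of_real (N * \<alpha> / (8 * pi * D))) h1 h2 (of_real (X1 a)) (of_real (X2 a)) * E a) summable_on UNIV" (is ?sum)
proof -
  have D: "D > 0" using pos by (simp add: D_def)
  have a: "\<alpha> > 0"
  proof (rule ccontr)
    assume "\<not> \<alpha> > 0"
    then have "\<alpha> * \<gamma> \<le> 0" using pos(1) by (simp add: mult_nonpos_nonneg)
    then show False using pos(2) by (smt (verit) zero_le_power2)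
  qed
  have Esum: "(\<lambda>i. norm (E i) * exp (s1 * norm (complex_of_real (X1 i)) + s2 * norm (complex_of_real (X2 i)))) summable_on UNIV"
    if s: "s1 \<ge> 0" "s2 \<ge> 0" for s1 s2 :: real
  proof -
    obtain e where e: "e > 0" "\<And>x y. \<alpha> * x^2 + 2 * \<beta> * x * y + \<gamma> * y^2 \<ge> e * (x^2 + y^2)"
      using quadratic_form_lower_bound[OF pos] by metis
    define S where "S = s1 + s2 + 2 * pi / N * (\<bar>Im b1\<bar> + \<bar>Im b2\<bar>)"
    have S: "S \<ge> 0" using s N by (simp add: S_def)
    show ?thesis
    proof (rule summable_on_comparison_test)
      show "(\<lambda>(a1::int, a2::int). exp (- (2 * pi / N * e) * ((p1 + of_int a1 * N)^2 + (p2 + of_int a2 * N)^2)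
        + S * (\<bar>p1 + of_int a1 * N\<bar> + \<bar>p2 + of_int a2 * N\<bar>))) summable_on UNIV"
        using e N S by (intro affine_gaussian_summable) auto
      fix i :: "int \<times> int"
      let ?x = "X1 i" and ?y = "X2 i"
      have "- (?x * Im b1) \<le> \<bar>Im b1\<bar> * \<bar>?x\<bar>" "- (?y * Im b2) \<le> \<bar>Im b2\<bar> * \<bar>?y\<bar>"
        by (metis abs_ge_minus_self abs_mult mult.commute)+
      then have "2 * pi / N * (- (?x * Im b1) - ?y * Im b2) \<le> 2 * pi / N * (\<bar>Im b1\<bar> * \<bar>?x\<bar> + \<bar>Im b2\<bar> * \<bar>?y\<bar>)"
        using N by (intro mult_left_mono) auto
      also have "\<dots> \<le> 2 * pi / N * (\<bar>Im b1\<bar> * (\<bar>?x\<bar> + \<bar>?y\<bar>) + \<bar>Im b2\<bar> * (\<bar>?x\<bar> + \<bar>?y\<bar>))"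
        using N by (intro mult_left_mono add_mono) auto
      finally have 1: "2 * pi / N * (- (?x * Im b1) - ?y * Im b2) \<le> 2 * pi / N * (\<bar>Im b1\<bar> + \<bar>Im b2\<bar>) * (\<bar>?x\<bar> + \<bar>?y\<bar>)"
        by (simp add: algebra_simps add_divide_distrib)
      have 2: "s1 * \<bar>?x\<bar> + s2 * \<bar>?y\<bar> \<le> (s1 + s2) * (\<bar>?x\<bar> + \<bar>?y\<bar>)"
        using s by (simp add: distrib_left distrib_right)
      have 3: "- (2 * pi / N * (\<alpha> * ?x^2 + 2 * \<beta> * ?x * ?y + \<gamma> * ?y^2)) \<le> - (2 * pi / N * (e * (?x^2 + ?y^2)))"
        using N by (intro le_imp_neg_le mult_left_mono e(2)) auto
      have "Re (- of_real (2 * pi / N) * (of_real \<alpha> * of_real ?x^2 + 2 * of_real \<beta> * of_real ?x * of_real ?y + of_real \<gamma> * of_real ?y^2)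
           + 2 * pi * \<i> / N * (of_real ?x * b1 + of_real ?y * b2))
         = - (2 * pi / N * (\<alpha> * ?x^2 + 2 * \<beta> * ?x * ?y + \<gamma> * ?y^2)) + 2 * pi / N * (- (?x * Im b1) - ?y * Im b2)"
        using N by (simp add: power2_eq_square field_simps)
      also have "\<dots> \<le> - (2 * pi / N * (e * (?x^2 + ?y^2))) + 2 * pi / N * (\<bar>Im b1\<bar> + \<bar>Im b2\<bar>) * (\<bar>?x\<bar> + \<bar>?y\<bar>)"
        by (rule add_mono[OF 3 1])
      finally have "norm (E i) * exp (s1 * norm (complex_of_real ?x) + s2 * norm (complex_of_real ?y)) \<le> exp (- (2 * pi / N * e) * (?x^2 + ?y^2) + S * (\<bar>?x\<bar> + \<bar>?y\<bar>))"
        unfolding E_def norm_exp_eq_Re exp_add[symmetric] exp_le_cancel_iff using 2 by (simp add: S_def distrib_right)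
      then show "norm (E i) * exp (s1 * norm (complex_of_real ?x) + s2 * norm (complex_of_real ?y)) \<le>
         (case i of (a1, a2) \<Rightarrow> exp (- (2 * pi / N * e) * ((p1 + of_int a1 * N)^2 + (p2 + of_int a2 * N)^2)
        + S * (\<bar>p1 + of_int a1 * N\<bar> + \<bar>p2 + of_int a2 * N\<bar>)))"
        unfolding X1_def X2_def case_prod_unfold .
    qed auto
  qed
  \<comment> \<open>The constant is put into the weight so that both sides have the shape required
    by \<open>gauss_poly_family\<close>.\<close>
  define F' where "F' = (\<lambda>d. of_real (1 / (2 * N * sqrt D)) * F d)"
  have Fsum: "(\<lambda>i. norm (F' i) * exp (s1 * norm (\<i> / 2 * A1 i) + s2 * norm (\<i> / 2 * A2 i))) summable_on UNIV"
    if s: "s1 \<ge> 0" "s2 \<ge> 0" for s1 s2 :: real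
  proof -
    obtain e where e: "e > 0" "\<And>x y. \<gamma> * x^2 + 2 * (- \<beta>) * x * y + \<alpha> * y^2 \<ge> e * (x^2 + y^2)"
      using quadratic_form_lower_bound[of \<alpha> \<gamma> "- \<beta>"] pos a by (metis mult.commute power2_minus)
    define Q where "Q = (\<lambda>x y. \<gamma> * x^2 + 2 * (- \<beta>) * x * y + \<alpha> * y^2)"
    define S where "S = (s1 + s2) * ((\<gamma> + \<bar>\<beta>\<bar> + \<alpha>) / (2 * D))"
    have S: "S \<ge> 0" using s pos(1) a D by (simp add: S_def)
    define C where "C = (1 / (2 * N * sqrt D)) * exp (pi / (2 * N * D) * Q (Im b1) (Im b2) + S * (\<bar>Im b1\<bar> + \<bar>Im b2\<bar>))"
    show ?thesis
    proof (rule summable_on_comparison_test)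
      show "(\<lambda>i::int \<times> int. C * (case i of (d1, d2) \<Rightarrow> exp (- (pi / (2 * N * D) * e) * ((Re b1 + of_int d1 * 1)^2 + (Re b2 + of_int d2 * 1)^2)
        + S * (\<bar>Re b1 + of_int d1 * 1\<bar> + \<bar>Re b2 + of_int d2 * 1\<bar>)))) summable_on UNIV"
        using e N S D by (intro summable_on_cmult_right affine_gaussian_summable) auto
      fix i :: "int \<times> int"
      obtain d1 d2 where i: "i = (d1, d2)" by (cases i)
      define k1 where "k1 = b1 + of_int d1"
      define k2 where "k2 = b2 + of_int d2"
      define x where "x = Re b1 + of_int d1"
      define y where "y = Re b2 + of_int d2"
      have kre: "Re k1 = x" "Re k2 = y" "Im k1 = Im b1" "Im k2 = Im b2" by (auto simp: k1_def k2_def x_def y_def)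
      have nF: "norm (F i) = exp (- (pi / (2 * N * D) * (Q x y - Q (Im b1) (Im b2))))"
      proof -
        have "Re (- of_real (pi / (2 * N)) * ((of_real \<gamma> * k1^2 - 2 * of_real \<beta> * k1 * k2 + of_real \<alpha> * k2^2) / of_real D)
           - 2 * pi * \<i> / N * (of_int d1 * of_real p1 + of_int d2 * of_real p2)) = - (pi / (2 * N * D) * (Q x y - Q (Im b1) (Im b2)))"
          using N D by (simp add: Q_def power2_eq_square kre) (simp add: field_simps)
        then show ?thesis unfolding F_def i prod.case norm_exp_eq_Re k1_def[symmetric] k2_def[symmetric] by simp
      qed
      have k: "norm k1 \<le> \<bar>x\<bar> + \<bar>Im b1\<bar>" "norm k2 \<le> \<bar>y\<bar> + \<bar>Im b2\<bar>"
        using cmod_le[of k1] cmod_le[of k2] by (simp_all add: kre)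
      define M where "M = norm k1 + norm k2"
      have M: "M \<le> (\<bar>x\<bar> + \<bar>y\<bar>) + (\<bar>Im b1\<bar> + \<bar>Im b2\<bar>)" "M \<ge> 0" using k by (auto simp: M_def)
      have gen: "norm (of_real u * k1 + of_real v * k2) \<le> (\<bar>u\<bar> + \<bar>v\<bar>) * M" for u v :: real
      proof -
        have "norm (of_real u * k1 + of_real v * k2) \<le> \<bar>u\<bar> * norm k1 + \<bar>v\<bar> * norm k2"
          using norm_triangle_ineq[of "of_real u * k1" "of_real v * k2"] by (simp add: norm_mult)
        also have "\<dots> \<le> (\<bar>u\<bar> + \<bar>v\<bar>) * M" by (simp add: M_def distrib_left distrib_right)
        finally show ?thesis .
      qed
      have A1b: "norm (\<i> / 2 * A1 i) \<le> (\<gamma> + \<bar>\<beta>\<bar> + \<alpha>) / (2 * D) * M"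
      proof -
        have "norm (\<i> / 2 * A1 i) = norm (of_real \<gamma> * k1 + of_real (- \<beta>) * k2) / (2 * D)"
          using D by (simp add: A1_def i k1_def k2_def norm_mult norm_divide)
        also have "\<dots> \<le> (\<gamma> + \<bar>\<beta>\<bar>) * M / (2 * D)" using gen[of \<gamma> "- \<beta>"] D pos(1) by (intro divide_right_mono) auto
        also have "\<dots> \<le> (\<gamma> + \<bar>\<beta>\<bar> + \<alpha>) * M / (2 * D)" using D a M(2) by (intro divide_right_mono mult_right_mono) auto
        finally show ?thesis by simp
      qed
      have A2b: "norm (\<i> / 2 * A2 i) \<le> (\<gamma> + \<bar>\<beta>\<bar> + \<alpha>) / (2 * D) * M"
      proof -
        have "norm (\<i> / 2 * A2 i) = norm (of_real (- \<beta>) * k1 + of_real \<alpha> * k2) / (2 * D)"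
          using D by (simp add: A2_def i k1_def k2_def norm_mult norm_divide)
        also have "\<dots> \<le> (\<bar>\<beta>\<bar> + \<alpha>) * M / (2 * D)" using gen[of "- \<beta>" \<alpha>] D a by (intro divide_right_mono) auto
        also have "\<dots> \<le> (\<gamma> + \<bar>\<beta>\<bar> + \<alpha>) * M / (2 * D)" using D pos(1) M(2) by (intro divide_right_mono mult_right_mono) auto
        finally show ?thesis by simp
      qed
      have "s1 * norm (\<i> / 2 * A1 i) + s2 * norm (\<i> / 2 * A2 i) \<le> s1 * ((\<gamma> + \<bar>\<beta>\<bar> + \<alpha>) / (2 * D) * M) + s2 * ((\<gamma> + \<bar>\<beta>\<bar> + \<alpha>) / (2 * D) * M)"
        using s A1b A2b by (intro add_mono mult_left_mono) auto
      also have "\<dots> = S * M" unfolding S_def by algebra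
      also have "\<dots> \<le> S * ((\<bar>x\<bar> + \<bar>y\<bar>) + (\<bar>Im b1\<bar> + \<bar>Im b2\<bar>))" using S M by (intro mult_left_mono) auto
      finally have 1: "s1 * norm (\<i> / 2 * A1 i) + s2 * norm (\<i> / 2 * A2 i) \<le> S * (\<bar>x\<bar> + \<bar>y\<bar>) + S * (\<bar>Im b1\<bar> + \<bar>Im b2\<bar>)"
        by (simp add: distrib_left)
      have "pi / (2 * N * D) * (e * (x^2 + y^2)) \<le> pi / (2 * N * D) * Q x y"
        unfolding Q_def using N D by (intro mult_left_mono e(2)) auto
      then have 2: "- (pi / (2 * N * D) * (Q x y - Q (Im b1) (Im b2))) \<le> - (pi / (2 * N * D) * e) * (x^2 + y^2) + pi / (2 * N * D) * Q (Im b1) (Im b2)"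
        by (simp add: right_diff_distrib)
      have "norm (F i) * exp (s1 * norm (\<i> / 2 * A1 i) + s2 * norm (\<i> / 2 * A2 i))
        \<le> exp (pi / (2 * N * D) * Q (Im b1) (Im b2) + S * (\<bar>Im b1\<bar> + \<bar>Im b2\<bar>)) * exp (- (pi / (2 * N * D) * e) * (x^2 + y^2) + S * (\<bar>x\<bar> + \<bar>y\<bar>))"
        unfolding nF exp_add[symmetric] exp_le_cancel_iff using 1 2 by linarith
      then have "(1 / (2 * N * sqrt D)) * (norm (F i) * exp (s1 * norm (\<i> / 2 * A1 i) + s2 * norm (\<i> / 2 * A2 i)))
        \<le> C * exp (- (pi / (2 * N * D) * e) * (x^2 + y^2) + S * (\<bar>x\<bar> + \<bar>y\<bar>))"
        unfolding C_def mult.assoc using N D by (intro mult_left_mono) auto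
      then show "norm (F' i) * exp (s1 * norm (\<i> / 2 * A1 i) + s2 * norm (\<i> / 2 * A2 i)) \<le>
         C * (case i of (d1, d2) \<Rightarrow> exp (- (pi / (2 * N * D) * e) * ((Re b1 + of_int d1 * 1)^2 + (Re b2 + of_int d2 * 1)^2)
        + S * (\<bar>Re b1 + of_int d1 * 1\<bar> + \<bar>Re b2 + of_int d2 * 1\<bar>)))"
        unfolding i prod.case mult_1_right x_def[symmetric] y_def[symmetric] using N D
        by (simp add: F'_def norm_mult norm_divide i mult.assoc)
    qed auto
  qed
  define a0 where "a0 = - complex_of_real (N * \<gamma> / (8 * pi * D))"
  define b0 where "b0 = complex_of_real (N * \<beta> / (8 * pi * D))"
  define c0 where "c0 = - complex_of_real (N * \<alpha> / (8 * pi * D))"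
  have key: "(\<Sum>\<^sub>\<infinity>i. E i * exp (a0 * t1^2 + 2 * b0 * t1 * t2 + c0 * t2^2 + t1 * of_real (X1 i) + t2 * of_real (X2 i)))
     = (\<Sum>\<^sub>\<infinity>i. F' i * exp (0 * t1^2 + 2 * 0 * t1 * t2 + 0 * t2^2 + t1 * (\<i> / 2 * A1 i) + t2 * (\<i> / 2 * A2 i)))" for t1 t2
  proof -
    define al be ga n P1 P2 p where "al = complex_of_real \<alpha>" and "be = complex_of_real \<beta>" and "ga = complex_of_real \<gamma>"
      and "n = complex_of_real N" and "P1 = complex_of_real p1" and "P2 = complex_of_real p2" and "p = complex_of_real pi"
    note cdefs = al_def be_def ga_def n_def P1_def P2_def p_def
    have n0: "n \<noteq> 0" and p0: "p \<noteq> 0" using N by (auto simp: cdefs)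
    define d where "d = al * ga - be^2"
    have dD: "d = of_real D" by (simp add: d_def D_def cdefs)
    have d0: "d \<noteq> 0" using D dD by auto
    \<comment> \<open>(\<open>e1\<close>, \<open>e2\<close>) is the inverse form applied to
      (\<open>t1\<close>, \<open>t2\<close>); in these coordinates every quadratic term in t is a
      multiple of \<open>Q e1 e2\<close>.\<close>
    define e1 where "e1 = (ga * t1 - be * t2) / d"
    define e2 where "e2 = (- be * t1 + al * t2) / d"
    have inv: "x = al * ((ga * x - be * y) / d) + be * ((- be * x + al * y) / d)"
       "y = be * ((ga * x - be * y) / d) + ga * ((- be * x + al * y) / d)" for x y
    proof -
      have "al * (ga * x - be * y) + be * (- be * x + al * y) = d * x" 
        "be * (ga * x - be * y) + ga * (- be * x + al * y) = d * y"
        by (simp_all add: d_def power2_eq_square algebra_simps)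
      then show "x = al * ((ga * x - be * y) / d) + be * ((- be * x + al * y) / d)"
       "y = be * ((ga * x - be * y) / d) + ga * ((- be * x + al * y) / d)"
        using d0 by (simp_all add: add_divide_distrib[symmetric])
    qed
    have t1: "t1 = al * e1 + be * e2" and t2: "t2 = be * e1 + ga * e2"
      unfolding e1_def e2_def by (rule inv)+
    define Q where "Q = (\<lambda>x y. al * x^2 + 2 * be * x * y + ga * y^2)"
    have qt: "a0 * t1^2 + 2 * b0 * t1 * t2 + c0 * t2^2 = - (n / (8 * p)) * Q e1 e2"
    proof -
      have "a0 * t1^2 + 2 * b0 * t1 * t2 + c0 * t2^2 = - (n / (8 * p)) * ((ga * t1^2 - 2 * be * t1 * t2 + al * t2^2) / d)"
        unfolding a0_def b0_def c0_def dD using D by (simp add: cdefs field_simps)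
      also have "ga * t1^2 - 2 * be * t1 * t2 + al * t2^2 = d * Q e1 e2"
        unfolding t1 t2 Q_def d_def by (rule adjugate_quadratic_form)
      finally show ?thesis using d0 by simp
    qed
    \<comment> \<open>\<open>B1\<close> and \<open>B2\<close> collect everything linear in the
      summation variable, the source t included; \<open>K\<close> collects what does not depend on
      it.\<close>
    define B1 where "B1 = b1 + 2 * \<i> * (al * P1 + be * P2) - \<i> * n / (2 * p) * t1"
    define B2 where "B2 = b2 + 2 * \<i> * (be * P1 + ga * P2) - \<i> * n / (2 * p) * t2"
    define K where "K = exp (- (2 * p / n) * Q P1 P2 + 2 * p * \<i> / n * (P1 * b1 + P2 * b2) + (t1 * P1 + t2 * P2) - (n / (8 * p)) * Q e1 e2)"
    have lhs: "E i * exp (a0 * t1^2 + 2 * b0 * t1 * t2 + c0 * t2^2 + t1 * of_real (X1 i) + t2 * of_real (X2 i)) =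
       K * (case i of (a1, a2) \<Rightarrow> exp (- of_real pi * (of_real (2 * N * \<alpha>) * of_int a1^2 + 2 * of_real (2 * N * \<beta>) * of_int a1 * of_int a2 + of_real (2 * N * \<gamma>) * of_int a2^2)
           + 2 * pi * \<i> * (of_int a1 * B1 + of_int a2 * B2)))" for i
    proof -
      obtain a1 a2 where i: "i = (a1, a2)" by (cases i)
      define m1 m2 where "m1 = complex_of_int a1" and "m2 = complex_of_int a2"
      have "- (2 * p / n) * Q (P1 + m1 * n) (P2 + m2 * n) + 2 * p * \<i> / n * ((P1 + m1 * n) * b1 + (P2 + m2 * n) * b2)
         + (- (n / (8 * p)) * Q e1 e2 + t1 * (P1 + m1 * n) + t2 * (P2 + m2 * n)) =
         (- (2 * p / n) * Q P1 P2 + 2 * p * \<i> / n * (P1 * b1 + P2 * b2) + (t1 * P1 + t2 * P2) - (n / (8 * p)) * Q e1 e2) +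
         (- p * (2 * n * al * m1^2 + 2 * (2 * n * be) * m1 * m2 + 2 * n * ga * m2^2) + 2 * p * \<i> * (m1 * B1 + m2 * B2))"
      proof -
        have e1: "- (2 * p / n) * Q (P1 + m1 * n) (P2 + m2 * n) = - (2 * p / n) * Q P1 P2 - p * (2 * n * al * m1^2 + 2 * (2 * n * be) * m1 * m2 + 2 * n * ga * m2^2)
            - 4 * p * (m1 * (al * P1 + be * P2) + m2 * (be * P1 + ga * P2))"
          using n0 by (simp add: Q_def field_simps power2_eq_square)
        have e2: "2 * p * \<i> / n * ((P1 + m1 * n) * b1 + (P2 + m2 * n) * b2) = 2 * p * \<i> / n * (P1 * b1 + P2 * b2) + 2 * p * \<i> * (m1 * b1 + m2 * b2)"
          using n0 by (simp add: field_simps)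
        have e3: "2 * p * \<i> * (m1 * B1 + m2 * B2) = 2 * p * \<i> * (m1 * b1 + m2 * b2) - 4 * p * (m1 * (al * P1 + be * P2) + m2 * (be * P1 + ga * P2)) + n * (m1 * t1 + m2 * t2)"
          using p0 by (simp add: B1_def B2_def field_simps)
        show ?thesis unfolding e1 e2 e3 by (simp add: algebra_simps)
      qed
      then have "exp (- (2 * p / n) * Q (P1 + m1 * n) (P2 + m2 * n) + 2 * p * \<i> / n * ((P1 + m1 * n) * b1 + (P2 + m2 * n) * b2)
         + (- (n / (8 * p)) * Q e1 e2 + t1 * (P1 + m1 * n) + t2 * (P2 + m2 * n))) =
         K * exp (- p * (2 * n * al * m1^2 + 2 * (2 * n * be) * m1 * m2 + 2 * n * ga * m2^2) + 2 * p * \<i> * (m1 * B1 + m2 * B2))"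
        unfolding K_def exp_add[symmetric] by (rule arg_cong)
      then show ?thesis
        unfolding qt unfolding E_def i prod.case exp_add[symmetric] X1_def X2_def Q_def cdefs m1_def m2_def
        by (simp only: of_real_mult of_real_add of_real_divide of_real_numeral of_real_of_int_eq)
    qed
    have rhs: "K * exp (- of_real (pi / (4 * N^2 * D)) * (of_real (2 * N * \<gamma>) * (B1 + of_int d1)^2 - 2 * of_real (2 * N * \<beta>) * (B1 + of_int d1) * (B2 + of_int d2) + of_real (2 * N * \<alpha>) * (B2 + of_int d2)^2))
        = F (d1, d2) * exp (t1 * (\<i> / 2 * A1 (d1, d2)) + t2 * (\<i> / 2 * A2 (d1, d2)))" for d1 d2 :: int
    proof -
      define m1 m2 where "m1 = complex_of_int d1" and "m2 = complex_of_int d2"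
      define k1 where "k1 = A1 (d1, d2)"
      define k2 where "k2 = A2 (d1, d2)"
      have bm: "b1 + m1 = al * k1 + be * k2" "b2 + m2 = be * k1 + ga * k2"
        unfolding k1_def k2_def A1_def A2_def prod.case m1_def m2_def dD[symmetric] cdefs[symmetric] by (rule inv)+
      \<comment> \<open>Chosen so that the shifted characteristic is the form applied to k + 2 i r,
        which separates the wanted \<open>Q k1 k2\<close> from the dependence on t.\<close>
      define r1 where "r1 = P1 - n / (4 * p) * e1"
      define r2 where "r2 = P2 - n / (4 * p) * e2"
      have Bm: "B1 + m1 = al * (k1 + 2 * \<i> * r1) + be * (k2 + 2 * \<i> * r2)" "B2 + m2 = be * (k1 + 2 * \<i> * r1) + ga * (k2 + 2 * \<i> * r2)"
      proof -
        have "B1 + m1 = (b1 + m1) + 2 * \<i> * (al * P1 + be * P2) - \<i> * n / (2 * p) * t1" by (simp add: B1_def)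
        also have "\<dots> = al * (k1 + 2 * \<i> * r1) + be * (k2 + 2 * \<i> * r2)"
          unfolding bm t1 r1_def r2_def using p0 by (simp add: field_simps)
        finally show "B1 + m1 = al * (k1 + 2 * \<i> * r1) + be * (k2 + 2 * \<i> * r2)" .
        have "B2 + m2 = (b2 + m2) + 2 * \<i> * (be * P1 + ga * P2) - \<i> * n / (2 * p) * t2" by (simp add: B2_def)
        also have "\<dots> = be * (k1 + 2 * \<i> * r1) + ga * (k2 + 2 * \<i> * r2)"
          unfolding bm t2 r1_def r2_def using p0 by (simp add: field_simps)
        finally show "B2 + m2 = be * (k1 + 2 * \<i> * r1) + ga * (k2 + 2 * \<i> * r2)" .
      qed
      have "- of_real (pi / (4 * N^2 * D)) * (of_real (2 * N * \<gamma>) * (B1 + m1)^2 - 2 * of_real (2 * N * \<beta>) * (B1 + m1) * (B2 + m2) + of_real (2 * N * \<alpha>) * (B2 + m2)^2)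
         = - (p / (2 * n * d)) * (ga * (B1 + m1)^2 - 2 * be * (B1 + m1) * (B2 + m2) + al * (B2 + m2)^2)"
        unfolding dD using N D by (simp add: cdefs field_simps power2_eq_square)
      also have "ga * (B1 + m1)^2 - 2 * be * (B1 + m1) * (B2 + m2) + al * (B2 + m2)^2 = d * Q (k1 + 2 * \<i> * r1) (k2 + 2 * \<i> * r2)"
        unfolding Bm Q_def d_def by (rule adjugate_quadratic_form)
      finally have 1: "- of_real (pi / (4 * N^2 * D)) * (of_real (2 * N * \<gamma>) * (B1 + m1)^2 - 2 * of_real (2 * N * \<beta>) * (B1 + m1) * (B2 + m2) + of_real (2 * N * \<alpha>) * (B2 + m2)^2)
         = - (p / (2 * n)) * Q (k1 + 2 * \<i> * r1) (k2 + 2 * \<i> * r2)" using d0 by simp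
      have 2: "(ga * (b1 + m1)^2 - 2 * be * (b1 + m1) * (b2 + m2) + al * (b2 + m2)^2) / d = Q k1 k2"
        unfolding bm Q_def using adjugate_quadratic_form[of ga al k1 be k2, folded d_def] d0 by simp
      have b: "b1 = al * k1 + be * k2 - m1" "b2 = be * k1 + ga * k2 - m2" using bm by (auto simp: algebra_simps)
      \<comment> \<open>Here the multiple of \<open>Q e1 e2\<close> in \<open>K\<close> cancels
        against the one hidden in \<open>Q r1 r2\<close>, leaving t only linearly.\<close>
      have 3: "(- (2 * p / n) * Q P1 P2 + 2 * p * \<i> / n * (P1 * b1 + P2 * b2) + (t1 * P1 + t2 * P2) - (n / (8 * p)) * Q e1 e2) 
          + - (p / (2 * n)) * Q (k1 + 2 * \<i> * r1) (k2 + 2 * \<i> * r2)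
          = - (p / (2 * n)) * Q k1 k2 - 2 * p * \<i> / n * (m1 * P1 + m2 * P2) + (t1 * (\<i> / 2 * k1) + t2 * (\<i> / 2 * k2))"
      proof -
        have s1: "Q (k1 + 2 * \<i> * r1) (k2 + 2 * \<i> * r2) = Q k1 k2 + 4 * \<i> * ((al * k1 + be * k2) * r1 + (be * k1 + ga * k2) * r2) - 4 * Q r1 r2"
          by (simp add: Q_def power2_eq_square algebra_simps)
        have s2: "Q r1 r2 = Q P1 P2 - n / (2 * p) * (t1 * P1 + t2 * P2) + n^2 / (16 * p^2) * Q e1 e2"
          unfolding Q_def r1_def r2_def t1 t2 using p0 by (simp add: field_simps power2_eq_square)
        have s3: "(al * k1 + be * k2) * r1 + (be * k1 + ga * k2) * r2 = (al * k1 + be * k2) * P1 + (be * k1 + ga * k2) * P2 - n / (4 * p) * (t1 * k1 + t2 * k2)"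
          unfolding r1_def r2_def t1 t2 using p0 by (simp add: field_simps)
        show ?thesis unfolding s1 s2 s3 b using n0 p0 by (simp add: field_simps power2_eq_square)
      qed
      have Feq: "F (d1, d2) = exp (- (p / (2 * n)) * Q k1 k2 - 2 * p * \<i> / n * (m1 * P1 + m2 * P2))"
        unfolding F_def prod.case 2[symmetric] by (simp add: cdefs m1_def m2_def dD)
      show ?thesis
        unfolding Feq K_def m1_def[symmetric] m2_def[symmetric] 1 exp_add[symmetric] k1_def[symmetric] k2_def[symmetric] 3 ..
    qed
    \<comment> \<open>The form in the summation variable is 2N times the given one; its determinant
      \<open>4 * N^2 * D\<close> yields the prefactor 1 / (2 N sqrt D).\<close>
    have pos2: "2 * N * \<gamma> > 0" and det2: "(2 * N * \<alpha>) * (2 * N * \<gamma>) - (2 * N * \<beta>)^2 = 4 * N^2 * D"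
      using N pos(1) by (simp_all add: D_def power2_eq_square algebra_simps)
    have det2p: "(2 * N * \<alpha>) * (2 * N * \<gamma>) - (2 * N * \<beta>)^2 > 0" unfolding det2 using N D by simp
    have sq: "sqrt (4 * N^2 * D) = 2 * N * sqrt D" using N by (simp add: real_sqrt_mult)
    have "(\<Sum>\<^sub>\<infinity>i. E i * exp (a0 * t1^2 + 2 * b0 * t1 * t2 + c0 * t2^2 + t1 * of_real (X1 i) + t2 * of_real (X2 i)))
      = K * (of_real (1 / (2 * N * sqrt D)) *
       (\<Sum>\<^sub>\<infinity>(d1::int, d2::int). exp (- of_real (pi / (4 * N^2 * D)) * (of_real (2 * N * \<gamma>) * (B1 - of_int d1)^2 - 2 * of_real (2 * N * \<beta>) * (B1 - of_int d1) * (B2 - of_int d2) + of_real (2 * N * \<alpha>) * (B2 - of_int d2)^2))))"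
      unfolding lhs infsum_cmult_right' theta_inversion_2d[OF pos2 det2p] unfolding det2 sq ..
    also have "(\<Sum>\<^sub>\<infinity>(d1::int, d2::int). exp (- of_real (pi / (4 * N^2 * D)) * (of_real (2 * N * \<gamma>) * (B1 - of_int d1)^2 - 2 * of_real (2 * N * \<beta>) * (B1 - of_int d1) * (B2 - of_int d2) + of_real (2 * N * \<alpha>) * (B2 - of_int d2)^2)))
      = (\<Sum>\<^sub>\<infinity>(d1::int, d2::int). exp (- of_real (pi / (4 * N^2 * D)) * (of_real (2 * N * \<gamma>) * (B1 + of_int d1)^2 - 2 * of_real (2 * N * \<beta>) * (B1 + of_int d1) * (B2 + of_int d2) + of_real (2 * N * \<alpha>) * (B2 + of_int d2)^2)))"
      \<comment> \<open>Inversion produces b - d; reversing the sign of d gives the b + d of the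
        statement.\<close>
      by (rule infsum_reindex_bij_witness[of _ "\<lambda>(a, b). (- a, - b)" "\<lambda>(a, b). (- a, - b)"]) auto
    also have "K * (of_real (1 / (2 * N * sqrt D)) * \<dots>) = of_real (1 / (2 * N * sqrt D)) * (\<Sum>\<^sub>\<infinity>i. K * (case i of (d1::int, d2::int) \<Rightarrow> exp (- of_real (pi / (4 * N^2 * D)) * (of_real (2 * N * \<gamma>) * (B1 + of_int d1)^2 - 2 * of_real (2 * N * \<beta>) * (B1 + of_int d1) * (B2 + of_int d2) + of_real (2 * N * \<alpha>) * (B2 + of_int d2)^2))))"
      unfolding infsum_cmult_right' by (simp only: mult.left_commute)
    also have "\<dots> = (\<Sum>\<^sub>\<infinity>i. F' i * exp (0 * t1^2 + 2 * 0 * t1 * t2 + 0 * t2^2 + t1 * (\<i> / 2 * A1 i) + t2 * (\<i> / 2 * A2 i)))"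
      unfolding infsum_cmult_right'[symmetric]
    proof (rule infsum_cong)
      fix i :: "int \<times> int"
      obtain d1 d2 where i: "i = (d1, d2)" by (cases i)
      show "of_real (1 / (2 * N * sqrt D)) * (K * (case i of (d1::int, d2::int) \<Rightarrow> exp (- of_real (pi / (4 * N^2 * D)) * (of_real (2 * N * \<gamma>) * (B1 + of_int d1)^2 - 2 * of_real (2 * N * \<beta>) * (B1 + of_int d1) * (B2 + of_int d2) + of_real (2 * N * \<alpha>) * (B2 + of_int d2)^2))))
       = F' i * exp (0 * t1^2 + 2 * 0 * t1 * t2 + 0 * t2^2 + t1 * (\<i> / 2 * A1 i) + t2 * (\<i> / 2 * A2 i))"
        unfolding i prod.case rhs F'_def by (simp add: mult.assoc)
    qed
    finally show ?thesis .
  qed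
  have "(\<lambda>(h1, h2). \<Sum>\<^sub>\<infinity>i. gauss_poly a0 b0 c0 h1 h2 (of_real (X1 i)) (of_real (X2 i)) * E i)
      = (\<lambda>(h1, h2). \<Sum>\<^sub>\<infinity>i. gauss_poly 0 0 0 h1 h2 (\<i> / 2 * A1 i) (\<i> / 2 * A2 i) * F' i)"
  proof (rule entire_power_series_unique2)
    fix t1 t2
    show "((\<lambda>(h1, h2). (case (h1, h2) of (h1, h2) \<Rightarrow> \<Sum>\<^sub>\<infinity>i. gauss_poly a0 b0 c0 h1 h2 (of_real (X1 i)) (of_real (X2 i)) * E i) * t1 ^ h1 * t2 ^ h2)
        has_sum (\<Sum>\<^sub>\<infinity>i. E i * exp (a0 * t1^2 + 2 * b0 * t1 * t2 + c0 * t2^2 + t1 * of_real (X1 i) + t2 * of_real (X2 i)))) UNIV"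
      unfolding prod.case by (rule gauss_poly_family(2)) (rule Esum)
    show "((\<lambda>(h1, h2). (case (h1, h2) of (h1, h2) \<Rightarrow> \<Sum>\<^sub>\<infinity>i. gauss_poly 0 0 0 h1 h2 (\<i> / 2 * A1 i) (\<i> / 2 * A2 i) * F' i) * t1 ^ h1 * t2 ^ h2)
        has_sum (\<Sum>\<^sub>\<infinity>i. E i * exp (a0 * t1^2 + 2 * b0 * t1 * t2 + c0 * t2^2 + t1 * of_real (X1 i) + t2 * of_real (X2 i)))) UNIV"
      unfolding prod.case key by (rule gauss_poly_family(2)) (rule Fsum)
  qed
  from fun_cong[OF this, of "(h1, h2)"]
  have "(\<Sum>\<^sub>\<infinity>i. gauss_poly a0 b0 c0 h1 h2 (of_real (X1 i)) (of_real (X2 i)) * E i)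
     = (\<Sum>\<^sub>\<infinity>i. gauss_poly 0 0 0 h1 h2 (\<i> / 2 * A1 i) (\<i> / 2 * A2 i) * F' i)" by simp
  also have "\<dots> = (\<Sum>\<^sub>\<infinity>d. of_real (1 / (2 * N * sqrt D)) * ((\<i> / 2 * A1 d) ^ h1 / fact h1 * ((\<i> / 2 * A2 d) ^ h2 / fact h2) * F d))"
    unfolding gauss_poly_0 F'_def by (simp only: mult.left_commute mult.commute mult.assoc)
  finally show ?eq unfolding infsum_cmult_right' a0_def b0_def c0_def .
  show ?sum
    by (rule abs_summable_summable, rule gauss_poly_family(1)) (rule Esum)
qed

section \<open>The heat operator\<close>

text \<open>Polynomial functions together with an upper bound for the degree. The bound is what
  shows that the power series of the heat operator terminates; \<open>mono\<close> lets summands be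
  brought to a common bound.\<close>

inductive poly_deg :: "nat \<Rightarrow> (complex^2^'i \<Rightarrow> complex) \<Rightarrow> bool" where
  const: "poly_deg 0 (\<lambda>x. c)"
| var: "poly_deg 1 (\<lambda>x. x $ i $ j)"
| add: "poly_deg d p \<Longrightarrow> poly_deg d q \<Longrightarrow> poly_deg d (\<lambda>x. p x + q x)"
| mult: "poly_deg d p \<Longrightarrow> poly_deg d' q \<Longrightarrow> poly_deg (d + d') (\<lambda>x. p x * q x)"
| mono: "poly_deg d p \<Longrightarrow> d \<le> d' \<Longrightarrow> poly_deg d' p"

lemma poly_mat_imp_poly_deg:
  assumes "poly_mat R"
  shows "\<exists>d. poly_deg d R"
proof -
  have "\<exists>d. poly_deg d (\<lambda>x::complex^2^'i. F (\<lambda>(i, j). x $ i $ j))" if "mpoly_fun F" for F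
    using that
  proof induction
    case (const c) then show ?case using poly_deg.const by blast
  next
    case (var k) then show ?case using poly_deg.var[of "fst k" "snd k"] by (auto simp: case_prod_unfold)
  next
    case (add p q)
    then obtain d d' where A: "poly_deg d (\<lambda>x::complex^2^'i. p (\<lambda>(i, j). x $ i $ j))" and B: "poly_deg d' (\<lambda>x::complex^2^'i. q (\<lambda>(i, j). x $ i $ j))" by blast
    then have "poly_deg (max d d') (\<lambda>x::complex^2^'i. p (\<lambda>(i, j). x $ i $ j) + q (\<lambda>(i, j). x $ i $ j))"
      by (intro poly_deg.add poly_deg.mono[OF A] poly_deg.mono[OF B]) auto
    then show ?case by blast
  next
    case (mult p q) then show ?case using poly_deg.mult by blast
  qed
  from this[OF assms[unfolded poly_mat_def]] show ?thesis by (simp add: case_prod_unfold vec_lambda_eta)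
qed

lemma poly_deg_sum: "finite A \<Longrightarrow> (\<And>a. a \<in> A \<Longrightarrow> poly_deg d (p a)) \<Longrightarrow> poly_deg d (\<lambda>x. \<Sum>a\<in>A. p a x)"
proof (induction A rule: finite_induct)
  case empty then show ?case using poly_deg.mono[OF poly_deg.const] by simp
next
  case (insert a A) then show ?case by (auto intro: poly_deg.add)
qed

lemma poly_deg_cmult: "poly_deg d p \<Longrightarrow> poly_deg d (\<lambda>x. c * p x)"
  using poly_deg.mult[OF poly_deg.const] by simp

lemma poly_deg_power: "poly_deg d p \<Longrightarrow> poly_deg (n * d) (\<lambda>x. p x ^ n)"
proof (induction n)
  case 0 then show ?case using poly_deg.const[of 1] by simp
next
  case (Suc n) then show ?case using poly_deg.mult[of d p "n * d"] by simp
qed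

definition mscale :: "complex \<Rightarrow> complex^2^'i \<Rightarrow> complex^2^'i" where
  "mscale t v = (\<chi> a b. t * v $ a $ b)"

text \<open>Truncated subtraction makes \<open>d - 1\<close> useless at degree 0, hence the clause
  that the gradient then vanishes. Derivatives are demanded along every complex direction, because
  invariance along one non-coordinate direction is exploited below.\<close>

definition is_gradient :: "nat \<Rightarrow> (complex^2^('i::finite) \<Rightarrow> complex) \<Rightarrow> ('i \<Rightarrow> 2 \<Rightarrow> complex^2^'i \<Rightarrow> complex) \<Rightarrow> bool" where
  "is_gradient d p G \<longleftrightarrow> (\<forall>i j. poly_deg (d - 1) (G i j) \<and> (d = 0 \<longrightarrow> G i j = (\<lambda>x. 0))) \<and>
    (\<forall>x v. ((\<lambda>t. p (x + mscale t v)) has_field_derivative (\<Sum>i\<in>UNIV. \<Sum>j\<in>UNIV. v $ i $ j * G i j x)) (at 0))"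

lemma is_gradientD:
  assumes "is_gradient d p G"
  shows "poly_deg (d - 1) (G i j)" "d = 0 \<Longrightarrow> G i j = (\<lambda>x. 0)"
    "((\<lambda>t. p (x + mscale t v)) has_field_derivative (\<Sum>i\<in>UNIV. \<Sum>j\<in>UNIV. v $ i $ j * G i j x)) (at 0)"
  using assms unfolding is_gradient_def by auto

lemma poly_deg_gradient:
  fixes p :: "complex^2^('i::finite) \<Rightarrow> complex"
  assumes "poly_deg d p"
  shows "\<exists>G. is_gradient d p G"
  using assms
proof induction
  case (const c)
  show ?case by (unfold is_gradient_def, rule exI[of _ "\<lambda>i j x. 0"]) (auto intro: poly_deg.const)
next
  case (var i j)
  show ?case
  proof (unfold is_gradient_def, rule exI[of _ "\<lambda>a b x. if a = i \<and> b = j then 1 else 0"], intro conjI allI)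
    fix x v :: "complex^2^'i"
    have "(\<Sum>a\<in>UNIV. \<Sum>b\<in>UNIV. v $ a $ b * (if a = i \<and> b = j then 1 else 0)) = (\<Sum>a\<in>UNIV. if a = i then \<Sum>b\<in>UNIV. (if b = j then v $ a $ b else 0) else 0)"
        by (intro sum.cong refl) (auto simp: if_distrib[of "(*) z" for z] cong: if_cong intro!: sum.cong)
    then have s: "(\<Sum>a\<in>UNIV. \<Sum>b\<in>UNIV. v $ a $ b * (if a = i \<and> b = j then 1 else 0)) = v $ i $ j" by simp
    show "((\<lambda>t. (x + mscale t v) $ i $ j) has_field_derivative (\<Sum>a\<in>UNIV. \<Sum>b\<in>UNIV. v $ a $ b * (if a = i \<and> b = j then 1 else 0))) (at 0)"
      unfolding s mscale_def by (auto intro!: derivative_eq_intros)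
  qed (auto intro: poly_deg.const)
next
  case (add d p q)
  then obtain G H where "is_gradient d p G" and "is_gradient d q H" by blast
  note G = is_gradientD[OF this(1)] and H = is_gradientD[OF this(2)]
  show ?case
  proof (unfold is_gradient_def, rule exI[of _ "\<lambda>i j x. G i j x + H i j x"], intro conjI allI)
    fix x v :: "complex^2^'i"
    show "((\<lambda>t. p (x + mscale t v) + q (x + mscale t v)) has_field_derivative (\<Sum>i\<in>UNIV. \<Sum>j\<in>UNIV. v $ i $ j * (G i j x + H i j x))) (at 0)"
      using DERIV_add[OF G(3) H(3)] by (simp add: distrib_left sum.distrib)
  qed (use G H in \<open>auto intro: poly_deg.add\<close>)
next
  case (mult d p d' q)
  then obtain G H where "is_gradient d p G" and "is_gradient d' q H" by blast
  note G = is_gradientD[OF this(1)] and H = is_gradientD[OF this(2)]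
  show ?case
  proof (unfold is_gradient_def, rule exI[of _ "\<lambda>i j x. G i j x * q x + H i j x * p x"], intro conjI allI)
    fix x v :: "complex^2^'i"
    have [simp]: "mscale 0 v = 0" by (simp add: mscale_def vec_eq_iff)
    show "((\<lambda>t. p (x + mscale t v) * q (x + mscale t v)) has_field_derivative (\<Sum>i\<in>UNIV. \<Sum>j\<in>UNIV. v $ i $ j * (G i j x * q x + H i j x * p x))) (at 0)"
      using DERIV_mult[OF G(3)[of x v] H(3)[of x v]]
      by (simp add: distrib_left sum.distrib sum_distrib_left sum_distrib_right mult_ac)
  next
    fix i j
    have "poly_deg (d + d' - 1) (\<lambda>x. G i j x * q x)"
    proof (cases "d = 0")
      case True then show ?thesis using G(2) poly_deg.mono[OF poly_deg.const] by simp
    next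
      case False then show ?thesis using poly_deg.mult[OF G(1) mult.hyps(2), of i j] by (simp add: Nat.add_diff_assoc2)
    qed
    moreover have "poly_deg (d + d' - 1) (\<lambda>x. H i j x * p x)"
    proof (cases "d' = 0")
      case True then show ?thesis using H(2) poly_deg.mono[OF poly_deg.const] by simp
    next
      case False then show ?thesis using poly_deg.mult[OF H(1) mult.hyps(1), of i j] by (simp add: add.commute)
    qed
    ultimately show "poly_deg (d + d' - 1) (\<lambda>x. G i j x * q x + H i j x * p x)" by (rule poly_deg.add)
  qed (use G H in auto)
next
  case (mono d p d')
  then obtain G where "is_gradient d p G" by blast
  note G = is_gradientD[OF this]
  have Gd: "poly_deg (d' - 1) (G i j)" for i j
    using poly_deg.mono[OF G(1), of "d' - 1"] mono.hyps by auto
  show ?case by (unfold is_gradient_def, rule exI[of _ G]) (use G Gd mono.hyps in auto)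
qed

text \<open>\<open>pd\<close> is a \<open>deriv\<close>, whose value says nothing unless the
  derivative exists. The gradient obtained by induction on the polynomial proves existence and
  identifies the value.\<close>

lemma poly_deg_pd:
  fixes p :: "complex^2^('i::finite) \<Rightarrow> complex"
  assumes "poly_deg d p"
  shows "poly_deg (d - 1) (pd i j p)" "d = 0 \<Longrightarrow> pd i j p = (\<lambda>x. 0)"
    and "((\<lambda>t. p (x + mscale t v)) has_field_derivative (\<Sum>i\<in>UNIV. \<Sum>j\<in>UNIV. v $ i $ j * pd i j p x)) (at 0)"
proof -
  obtain G where "is_gradient d p G" using poly_deg_gradient[OF assms] by blast
  note G = is_gradientD[OF this]
  have pd: "pd i j p = G i j" for i j
  proof
    fix x
    define v :: "complex^2^'i" where "v = (\<chi> a b. if a = i \<and> b = j then 1 else 0)"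
    have v: "(\<chi> a b. if a = i \<and> b = j then t else 0) = mscale t v" for t
      by (auto simp: mscale_def v_def vec_eq_iff)
    have "(\<Sum>a\<in>UNIV. \<Sum>b\<in>UNIV. v $ a $ b * G a b x) = (\<Sum>a\<in>UNIV. if a = i then \<Sum>b\<in>UNIV. (if b = j then G a b x else 0) else 0)"
      by (intro sum.cong refl) (auto simp: v_def if_distrib[of "\<lambda>z. z * y" for y] cong: if_cong intro!: sum.cong)
    then have s: "(\<Sum>a\<in>UNIV. \<Sum>b\<in>UNIV. v $ a $ b * G a b x) = G i j x" by simp
    show "pd i j p x = G i j x" unfolding pd_def v using DERIV_imp_deriv[OF G(3)[of x v]] s by simp
  qed
  show "poly_deg (d - 1) (pd i j p)" "d = 0 \<Longrightarrow> pd i j p = (\<lambda>x. 0)"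
    "((\<lambda>t. p (x + mscale t v)) has_field_derivative (\<Sum>i\<in>UNIV. \<Sum>j\<in>UNIV. v $ i $ j * pd i j p x)) (at 0)"
    using G by (auto simp: pd)
qed

lemma pd_deriv:
  fixes p :: "complex^2^('i::finite) \<Rightarrow> complex"
  assumes "poly_deg d p"
  shows "((\<lambda>t. p (x + (\<chi> a b. if a = i \<and> b = j then t else 0))) has_field_derivative pd i j p x) (at 0)"
proof -
  define v :: "complex^2^'i" where "v = (\<chi> a b. if a = i \<and> b = j then 1 else 0)"
  have v: "(\<chi> a b. if a = i \<and> b = j then t else 0) = mscale t v" for t
    by (auto simp: mscale_def v_def vec_eq_iff)
  have "((\<lambda>t. p (x + mscale t v)) has_field_derivative deriv (\<lambda>t. p (x + mscale t v)) 0) (at 0)"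
    using poly_deg_pd(3)[OF assms, of x v] DERIV_imp_deriv[OF poly_deg_pd(3)[OF assms, of x v]] by simp
  then show ?thesis unfolding v pd_def .
qed

lemma zero_matrix [simp]: "(\<chi> a b. 0) = (0 :: complex^2^'i)"
  by (simp add: vec_eq_iff)

lemma pd_add: "poly_deg d p \<Longrightarrow> poly_deg d' q \<Longrightarrow> pd i j (\<lambda>x. p x + q x) = (\<lambda>x. pd i j p x + pd i j q x)"
  unfolding fun_eq_iff pd_def[of i j "\<lambda>x. p x + q x"]
  by (intro allI DERIV_imp_deriv DERIV_add pd_deriv)

lemma pd_mult: "poly_deg d p \<Longrightarrow> poly_deg d' q \<Longrightarrow> pd i j (\<lambda>x. p x * q x) = (\<lambda>x. pd i j p x * q x + p x * pd i j q x)"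
proof (rule ext)
  fix x assume p: "poly_deg d p" and q: "poly_deg d' q"
  show "pd i j (\<lambda>x. p x * q x) x = pd i j p x * q x + p x * pd i j q x"
    unfolding pd_def[of i j "\<lambda>x. p x * q x"]
    using DERIV_mult[OF pd_deriv[OF p, of x i j] pd_deriv[OF q, of x i j]]
    by (intro DERIV_imp_deriv) (simp add: mult.commute)
qed

lemma pd_const: "pd i j (\<lambda>x. c) = (\<lambda>x. 0)"
  by (simp add: pd_def fun_eq_iff)

lemma pd_cmult: "poly_deg d p \<Longrightarrow> pd i j (\<lambda>x. c * p x) = (\<lambda>x. c * pd i j p x)"
  using pd_mult[OF poly_deg.const[of c], of d p i j] by (simp add: pd_const)

text \<open>Recording a drop by one degree is enough for nilpotency, although two derivatives are
  taken.\<close>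

lemma poly_deg_lapY:
  assumes "poly_deg d p"
  shows "poly_deg (d - 1) (lapY Yi p)" "d = 0 \<Longrightarrow> lapY Yi p = (\<lambda>x. 0)"
proof -
  have "poly_deg (d - 1) (\<lambda>x. complex_of_real (Yi$j$l) * pd i j (pd i l p) x)" for i j l
    by (intro poly_deg_cmult poly_deg.mono[OF poly_deg_pd(1)[OF poly_deg_pd(1)[OF assms]]]) auto
  then show "poly_deg (d - 1) (lapY Yi p)" unfolding lapY_def[abs_def] by (intro poly_deg_sum) auto
  show "lapY Yi p = (\<lambda>x. 0)" if "d = 0"
    using poly_deg_pd(2)[OF assms that] by (simp add: lapY_def[abs_def] pd_const)
qed

lemma lapY_add:
  assumes p: "poly_deg d p" and q: "poly_deg d' q"
  shows "lapY Yi (\<lambda>x. p x + q x) = (\<lambda>x. lapY Yi p x + lapY Yi q x)"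
  unfolding lapY_def[abs_def] pd_add[OF p q] pd_add[OF poly_deg_pd(1)[OF p] poly_deg_pd(1)[OF q]]
  by (simp add: distrib_left sum.distrib)

lemma lapY_cmult:
  assumes p: "poly_deg d p"
  shows "lapY Yi (\<lambda>x. c * p x) = (\<lambda>x. c * lapY Yi p x)"
  unfolding lapY_def[abs_def] pd_cmult[OF p] pd_cmult[OF poly_deg_pd(1)[OF p]]
  by (simp add: sum_distrib_left mult_ac)

lemma lapY_0: "lapY Yi (\<lambda>x. 0) = (\<lambda>x. 0)"
  by (rule poly_deg_lapY(2)[OF poly_deg.const]) simp

lemma lapY_sum:
  assumes "finite A" "\<And>a. a \<in> A \<Longrightarrow> poly_deg d (p a)"
  shows "lapY Yi (\<lambda>x. \<Sum>a\<in>A. p a x) = (\<lambda>x. \<Sum>a\<in>A. lapY Yi (p a) x)"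
  using assms
proof (induction A rule: finite_induct)
  case (insert a A)
  have "poly_deg d (p a)" "poly_deg d (\<lambda>x. \<Sum>a\<in>A. p a x)" using insert by (auto intro: poly_deg_sum)
  from lapY_add[OF this] show ?case using insert by simp
qed (simp add: lapY_0)

lemma poly_deg_lapY_iter: "poly_deg d p \<Longrightarrow> poly_deg (d - k) ((lapY Yi ^^ k) p)"
proof (induction k)
  case (Suc k) then show ?case using poly_deg_lapY(1)[of "d - k" "(lapY Yi ^^ k) p" Yi] by simp
qed simp

lemma lapY_iter_eq_0: "poly_deg d p \<Longrightarrow> d < k \<Longrightarrow> (lapY Yi ^^ k) p = (\<lambda>x. 0)"
proof (induction k)
  case (Suc k)
  show ?case
  proof (cases "d < k")
    case True then show ?thesis using Suc by (simp add: lapY_0)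
  next
    case False
    then have "d - k = 0" "d = k" using Suc by auto
    then show ?thesis using poly_deg_lapY(2)[OF poly_deg_lapY_iter[OF Suc.prems(1), where k=k]] by simp
  qed
qed simp

lemma lapY_iter_sum:
  assumes "finite A" "\<And>a. a \<in> A \<Longrightarrow> poly_deg d (p a)"
  shows "(lapY Yi ^^ k) (\<lambda>x. \<Sum>a\<in>A. p a x) = (\<lambda>x. \<Sum>a\<in>A. (lapY Yi ^^ k) (p a) x)"
proof (induction k)
  case (Suc k)
  have "poly_deg d ((lapY Yi ^^ k) (p a))" if "a \<in> A" for a
    using poly_deg.mono[OF poly_deg_lapY_iter[OF assms(2)[OF that]]] by auto
  from lapY_sum[OF assms(1) this] Suc show ?case by simp
qed simp

text \<open>Any cutoff at least as large as the degree bound works, so several polynomials can be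
  expanded over the same range.\<close>

lemma heatop_finite:
  assumes "poly_deg d p" "d \<le> n"
  shows "heatop Yi p x = (\<Sum>k\<le>n. complex_of_real ((- 1 / (8 * pi)) ^ k / fact k) * ((lapY Yi ^^ k) p) x)"
  unfolding heatop_def
  by (rule suminf_finite) (use lapY_iter_eq_0[OF assms(1)] assms(2) in auto)

lemma heatop_sum:
  assumes A: "finite A" "\<And>a. a \<in> A \<Longrightarrow> poly_deg d (p a)"
  shows "heatop Yi (\<lambda>x. \<Sum>a\<in>A. p a x) x = (\<Sum>a\<in>A. heatop Yi (p a) x)"
proof -
  have "heatop Yi (p a) x = (\<Sum>k\<le>d. complex_of_real ((- 1 / (8 * pi)) ^ k / fact k) * ((lapY Yi ^^ k) (p a)) x)" if "a \<in> A" for a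
    by (rule heatop_finite[OF A(2)[OF that]]) simp
  moreover have "heatop Yi (\<lambda>x. \<Sum>a\<in>A. p a x) x = (\<Sum>k\<le>d. complex_of_real ((- 1 / (8 * pi)) ^ k / fact k) * ((lapY Yi ^^ k) (\<lambda>x. \<Sum>a\<in>A. p a x)) x)"
    by (rule heatop_finite[OF poly_deg_sum[OF A]]) auto
  ultimately show ?thesis
    by (simp add: lapY_iter_sum[OF A] sum_distrib_left sum.swap[of _ A])
qed

lemma poly_deg_heatop: "poly_deg d p \<Longrightarrow> poly_deg d (heatop Yi p)"
proof -
  assume p: "poly_deg d p"
  have "heatop Yi p = (\<lambda>x. \<Sum>k\<le>d. complex_of_real ((- 1 / (8 * pi)) ^ k / fact k) * ((lapY Yi ^^ k) p) x)"
    using heatop_finite[OF p] by blast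
  then show ?thesis
    by (simp only:) (intro poly_deg_sum poly_deg_cmult poly_deg.mono[OF poly_deg_lapY_iter[OF p]], auto)
qed

section \<open>Invariance and monomials along one direction\<close>

text \<open>Independence of a direction, phrased by translations: in this form it passes through
  \<open>pd\<close>, \<open>lapY\<close> and \<open>heatop\<close> directly from their
  definitions.\<close>

definition trans_inv :: "(complex^2^'i) set \<Rightarrow> (complex^2^'i \<Rightarrow> complex) \<Rightarrow> bool" where
  "trans_inv W R \<longleftrightarrow> (\<forall>x. \<forall>w\<in>W. R (x + w) = R x)"

lemma trans_inv_pd:
  fixes R :: "complex^2^('i::finite) \<Rightarrow> complex"
  assumes W: "trans_inv W R"
  shows "trans_inv W (pd i j R)"
proof -
  have "R (x + w + v) = R (x + v)" if "w \<in> W" for x w v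
  proof -
    have "R (x + w + v) = R ((x + v) + w)" by (simp add: algebra_simps)
    also have "\<dots> = R (x + v)" using W that unfolding trans_inv_def by blast
    finally show ?thesis .
  qed
  then show ?thesis unfolding trans_inv_def pd_def by simp
qed

lemma trans_inv_lapY: "trans_inv W R \<Longrightarrow> trans_inv W (lapY Yi R)"
  using trans_inv_pd[OF trans_inv_pd[of W R]] unfolding trans_inv_def lapY_def by simp

lemma trans_inv_lapY_iter: "trans_inv W R \<Longrightarrow> trans_inv W ((lapY Yi ^^ k) R)"
  by (induction k) (auto intro: trans_inv_lapY)

lemma trans_inv_heatop: "trans_inv W R \<Longrightarrow> trans_inv W (heatop Yi R)"
  using trans_inv_lapY_iter[of W R _ Yi] unfolding trans_inv_def heatop_def by simp

text \<open>With \<open>n\<close> the coordinates of \<open>g *v uzp\<close>, this linear form takes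
  at a lattice pair the value X of column \<open>j\<close>.\<close>

definition lincol :: "('i \<Rightarrow> complex) \<Rightarrow> 2 \<Rightarrow> complex^2^('i::finite) \<Rightarrow> complex" where
  "lincol n j x = (\<Sum>i\<in>UNIV. n i * x $ i $ j)"

definition colmat :: "('i \<Rightarrow> complex) \<Rightarrow> 2 \<Rightarrow> complex^2^('i::finite)" where
  "colmat n l = (\<chi> a b. if b = l then n a else 0)"

lemma poly_deg_lincol: "poly_deg 1 (lincol n j)"
  unfolding lincol_def[abs_def] by (intro poly_deg_sum poly_deg_cmult poly_deg.var) auto

lemma pd_lincol: "pd i j (lincol n l) = (\<lambda>x. if j = l then n i else 0)"
proof
  fix x
  have "lincol n l (x + (\<chi> a b. if a = i \<and> b = j then t else 0)) = lincol n l x + (if j = l then n i else 0) * t" for t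
  proof -
    have "(\<Sum>a\<in>UNIV. n a * (if a = i \<and> l = j then t else 0)) = (\<Sum>a\<in>UNIV. if a = i then n a * (if l = j then t else 0) else 0)"
      by (intro sum.cong) auto
    then show ?thesis by (auto simp: lincol_def distrib_left sum.distrib)
  qed
  then show "pd i j (lincol n l) x = (if j = l then n i else 0)"
    unfolding pd_def by (auto intro!: DERIV_imp_deriv derivative_eq_intros)
qed

text \<open>Divided powers, so that a derivative lowers an exponent without a numerical factor and
  the case \<open>k = 0\<close> of \<open>gauss_coeff\<close> is matched exactly.\<close>

definition lmono :: "('i \<Rightarrow> complex) \<Rightarrow> nat \<Rightarrow> nat \<Rightarrow> complex^2^('i::finite) \<Rightarrow> complex" where
  "lmono n h1 h2 x = lincol n 1 x ^ h1 / fact h1 * (lincol n 2 x ^ h2 / fact h2)"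

lemma poly_deg_divide_const: "poly_deg d p \<Longrightarrow> poly_deg d (\<lambda>x. p x / c)"
  using poly_deg_cmult[of d p "1/c"] by simp

lemma poly_deg_lmono: "poly_deg (h1 + h2) (lmono n h1 h2)"
  unfolding lmono_def[abs_def]
  using poly_deg_power[OF poly_deg_lincol, of h1 n 1] poly_deg_power[OF poly_deg_lincol, of h2 n 2]
  by (intro poly_deg.mult poly_deg_divide_const) auto

lemma pd_power: "poly_deg d p \<Longrightarrow> pd i j (\<lambda>x. p x ^ Suc k) = (\<lambda>x. of_nat (Suc k) * p x ^ k * pd i j p x)"
proof (rule ext)
  fix x assume p: "poly_deg d p"
  show "pd i j (\<lambda>x. p x ^ Suc k) x = of_nat (Suc k) * p x ^ k * pd i j p x"
    unfolding pd_def[of i j "\<lambda>x. p x ^ Suc k"]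
    using DERIV_power[OF pd_deriv[OF p, of x i j], of "Suc k"]
    by (intro DERIV_imp_deriv) (simp add: mult_ac)
qed

lemma pd_powfact:
  "pd i j (\<lambda>x. lincol n l x ^ h / fact h) = (\<lambda>x. if j = l \<and> 1 \<le> h then n i * (lincol n l x ^ (h - 1) / fact (h - 1)) else 0)"
proof (cases h)
  case 0 then show ?thesis by (simp add: pd_const)
next
  case (Suc k)
  have "pd i j (\<lambda>x. (1 / fact h) * lincol n l x ^ Suc k) = (\<lambda>x. (1 / fact h) * pd i j (\<lambda>x. lincol n l x ^ Suc k) x)"
    by (rule pd_cmult[OF poly_deg_power[OF poly_deg_lincol]])
  moreover have "complex_of_nat (Suc k) / fact (Suc k) = 1 / fact k"
    by (simp add: fact_Suc del: of_nat_Suc)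
  then have "(1 / fact (Suc k)) * (complex_of_nat (Suc k) * a * b) = b * (a / fact k)" for a b :: complex
    by (metis (no_types, lifting) mult.commute mult.left_commute times_divide_eq_left times_divide_eq_right mult_1)
  ultimately show ?thesis unfolding pd_power[OF poly_deg_lincol] pd_lincol Suc
    by (simp add: fun_eq_iff)
qed

lemma pd_lmono:
  "pd i j (lmono n h1 h2) = (\<lambda>x. n i * (if j = 1 then (if 1 \<le> h1 then lmono n (h1 - 1) h2 x else 0)
      else (if 1 \<le> h2 then lmono n h1 (h2 - 1) x else 0)))"
proof -
  have 1: "poly_deg (h * 1) (\<lambda>x. lincol n l x ^ h / fact h)" for h l
    by (intro poly_deg_divide_const poly_deg_power poly_deg_lincol)
  have "pd i j (lmono n h1 h2) = (\<lambda>x. pd i j (\<lambda>x. lincol n 1 x ^ h1 / fact h1) x * (lincol n 2 x ^ h2 / fact h2) + (lincol n 1 x ^ h1 / fact h1) * pd i j (\<lambda>x. lincol n 2 x ^ h2 / fact h2) x)"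
    unfolding lmono_def[abs_def] by (rule pd_mult[OF 1 1])
  then show ?thesis unfolding pd_powfact lmono_def[abs_def]
    using exhaust_2[of j] by (auto simp: fun_eq_iff mult_ac)
qed

text \<open>By Leibniz, the second derivatives of the monomial contribute the norm of
  \<open>n\<close> times the form \<open>Yi\<close>, which is \<open>gauss_coeff\<close> with
  \<open>k = 1\<close>; the cross terms contain derivatives of \<open>R\<close> along
  \<open>n\<close> and vanish. Symmetry of \<open>Yi\<close> merges its two mixed entries into the
  coefficient \<open>2 * b\<close>.\<close>

lemma lapY_lmono_mult:
  fixes n :: "'i::finite \<Rightarrow> complex" and Yi :: "real^2^2"
  assumes R: "poly_deg d R" and inv: "trans_inv (range (\<lambda>(t, l). mscale t (colmat n l))) R"
    and sym: "Yi $ 1 $ 2 = Yi $ 2 $ 1"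
  defines "N \<equiv> \<Sum>i\<in>UNIV. n i ^ 2"
  shows "lapY Yi (\<lambda>x. lmono n h1 h2 x * R x) =
    (\<lambda>x. gauss_coeff (N * Yi$1$1) (N * Yi$1$2) (N * Yi$2$2) 1 h1 h2 (lincol n 1 x) (lincol n 2 x) * R x + lmono n h1 h2 x * lapY Yi R x)"
proof
  fix x
  define M where "M = lmono n h1 h2"
  have M: "poly_deg (h1 + h2) M" unfolding M_def by (rule poly_deg_lmono)
  note pdM = poly_deg_pd(1)[OF M] and pdR = poly_deg_pd(1)[OF R]
  \<comment> \<open>The sum is the derivative of \<open>R\<close> along the column direction
    \<open>n\<close>, where \<open>R\<close> is constant.\<close>
  have orth: "(\<Sum>i\<in>UNIV. n i * pd i l R x) = 0" for l
  proof -
    have "(\<lambda>t. R (x + mscale t (colmat n l))) = (\<lambda>t. R x)"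
      using inv unfolding trans_inv_def by auto
    with poly_deg_pd(3)[OF R, of x "colmat n l"]
    have "((\<lambda>t. R x) has_field_derivative (\<Sum>i\<in>UNIV. \<Sum>j\<in>UNIV. colmat n l $ i $ j * pd i j R x)) (at 0)" by simp
    then have "(\<Sum>i\<in>UNIV. \<Sum>j\<in>UNIV. colmat n l $ i $ j * pd i j R x) = 0"
      using DERIV_unique[OF _ DERIV_const] by blast
    moreover have "(\<Sum>j\<in>UNIV. colmat n l $ i $ j * pd i j R x) = n i * pd i l R x" for i
    proof -
      have "(\<Sum>j\<in>UNIV. colmat n l $ i $ j * pd i j R x) = (\<Sum>j\<in>UNIV. if j = l then n i * pd i j R x else 0)"
        by (intro sum.cong) (auto simp: colmat_def)
      then show ?thesis by simp
    qed
    ultimately show ?thesis by simp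
  qed
  define m where "m = (\<lambda>j::2. if j = 1 then (if 1 \<le> h1 then lmono n (h1 - 1) h2 else (\<lambda>x. 0)) else (if 1 \<le> h2 then lmono n h1 (h2 - 1) else (\<lambda>x. 0)))"
  have pM: "pd i j M = (\<lambda>x. n i * m j x)" for i j unfolding M_def pd_lmono m_def by (auto simp: fun_eq_iff)
  have dm: "poly_deg (h1 + h2) (m j)" for j
    unfolding m_def by (simp, intro conjI impI poly_deg.mono[OF poly_deg_lmono] poly_deg.mono[OF poly_deg.const]) auto
  \<comment> \<open>The twice lowered monomial at \<open>x\<close>, with value 0 wherever an
    exponent would become negative.\<close>
  define m2 where "m2 = (\<lambda>(j::2) (l::2). if j = 1 then (if l = 1 then (if 2 \<le> h1 then lmono n (h1 - 2) h2 x else 0) else (if 1 \<le> h1 \<and> 1 \<le> h2 then lmono n (h1 - 1) (h2 - 1) x else 0))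
      else (if l = 1 then (if 1 \<le> h1 \<and> 1 \<le> h2 then lmono n (h1 - 1) (h2 - 1) x else 0) else (if 2 \<le> h2 then lmono n h1 (h2 - 2) x else 0)))"
  have "pd i j (m l) x = n i * m2 j l" for i j l
    using exhaust_2[of j] exhaust_2[of l]
    by (auto simp: m_def m2_def pd_lmono pd_const numeral_2_eq_2)
  then have ppM: "pd i j (pd i l M) x = n i ^ 2 * m2 j l" for i j l
    unfolding pM pd_cmult[OF dm] by (simp add: power2_eq_square)
  have pp: "pd i j (pd i l (\<lambda>x. M x * R x)) x = n i ^ 2 * m2 j l * R x + m l x * (n i * pd i j R x) + m j x * (n i * pd i l R x) + M x * pd i j (pd i l R) x" for i j l
  proof -
    have "pd i j (pd i l (\<lambda>x. M x * R x)) = pd i j (\<lambda>x. pd i l M x * R x + M x * pd i l R x)"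
      unfolding pd_mult[OF M R] ..
    also have "\<dots> = (\<lambda>x. pd i j (\<lambda>x. pd i l M x * R x) x + pd i j (\<lambda>x. M x * pd i l R x) x)"
      by (rule pd_add[OF poly_deg.mult[OF pdM R] poly_deg.mult[OF M pdR]])
    also have "\<dots> = (\<lambda>x. (pd i j (pd i l M) x * R x + pd i l M x * pd i j R x) + (pd i j M x * pd i l R x + M x * pd i j (pd i l R) x))"
      unfolding pd_mult[OF pdM R] pd_mult[OF M pdR] ..
    finally have "pd i j (pd i l (\<lambda>x. M x * R x)) x = (pd i j (pd i l M) x * R x + pd i l M x * pd i j R x) + (pd i j M x * pd i l R x + M x * pd i j (pd i l R) x)"
      by simp
    then show ?thesis unfolding ppM unfolding pM by (simp add: mult_ac)
  qed
  \<comment> \<open>The row index is moved innermost so that the sums in \<open>orth\<close>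
    appear.\<close>
  have sw: "(\<Sum>i\<in>UNIV. \<Sum>j\<in>UNIV. \<Sum>l\<in>UNIV. f i j l) = (\<Sum>j\<in>UNIV. \<Sum>l\<in>UNIV. \<Sum>i\<in>UNIV. f i j l)" for f :: "'i \<Rightarrow> 2 \<Rightarrow> 2 \<Rightarrow> complex"
    by (subst sum.swap, intro sum.cong refl, rule sum.swap)
  have "lapY Yi (\<lambda>x. M x * R x) x = (\<Sum>j\<in>UNIV. \<Sum>l\<in>UNIV. \<Sum>i\<in>UNIV. complex_of_real (Yi$j$l) *
     (n i ^ 2 * m2 j l * R x + m l x * (n i * pd i j R x) + m j x * (n i * pd i l R x) + M x * pd i j (pd i l R) x))"
    unfolding lapY_def pp sw ..
  also have "\<dots> = (\<Sum>j\<in>UNIV. \<Sum>l\<in>UNIV. complex_of_real (Yi$j$l) * (N * m2 j l * R x)) + M x * lapY Yi R x"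
  proof -
    have "(\<Sum>i\<in>UNIV. complex_of_real (Yi$j$l) * (n i ^ 2 * m2 j l * R x + m l x * (n i * pd i j R x) + m j x * (n i * pd i l R x) + M x * pd i j (pd i l R) x))
      = complex_of_real (Yi$j$l) * (N * m2 j l * R x + m l x * (\<Sum>i\<in>UNIV. n i * pd i j R x) + m j x * (\<Sum>i\<in>UNIV. n i * pd i l R x)) + M x * (\<Sum>i\<in>UNIV. complex_of_real (Yi$j$l) * pd i j (pd i l R) x)" for j l
      unfolding N_def by (simp add: sum.distrib distrib_left sum_distrib_left sum_distrib_right mult_ac)
    then show ?thesis unfolding orth lapY_def sw by (simp add: sum.distrib sum_distrib_left)
  qed
  also have "(\<Sum>j\<in>UNIV. \<Sum>l\<in>UNIV. complex_of_real (Yi$j$l) * (N * m2 j l * R x)) = gauss_coeff (N * Yi$1$1) (N * Yi$1$2) (N * Yi$2$2) 1 h1 h2 (lincol n 1 x) (lincol n 2 x) * R x"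
  proof -
    have "gauss_coeff (N * Yi$1$1) (N * Yi$1$2) (N * Yi$2$2) 1 h1 h2 (lincol n 1 x) (lincol n 2 x)
      = N * Yi$1$1 * m2 1 1 + 2 * (N * Yi$1$2) * m2 1 2 + N * Yi$2$2 * m2 2 2"
      by (simp add: m2_def lmono_def)
    moreover have "m2 2 1 = m2 1 2" by (simp add: m2_def)
    ultimately show ?thesis unfolding sum_2 using sym by (simp add: algebra_simps)
  qed
  finally show "lapY Yi (\<lambda>x. lmono n h1 h2 x * R x) x = gauss_coeff (N * Yi$1$1) (N * Yi$1$2) (N * Yi$2$2) 1 h1 h2 (lincol n 1 x) (lincol n 2 x) * R x + lmono n h1 h2 x * lapY Yi R x"
    unfolding M_def .
qed


section \<open>The exponential of the product rule\<close>

lemma gauss_coeff_scale: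
  "gauss_coeff (s * a) (s * b) (s * c) k h1 h2 x1 x2 = s ^ k * gauss_coeff a b c k h1 h2 x1 x2"
  by (induction k arbitrary: h1 h2) (auto simp: algebra_simps)

lemma poly_deg_gauss_coeff:
  "poly_deg (h1 + h2) (\<lambda>x. gauss_coeff a b c k h1 h2 (lincol n 1 x) (lincol n 2 x))"
proof (induction k arbitrary: h1 h2)
  case 0
  show ?case using poly_deg_lmono[of h1 h2 n] by (simp add: lmono_def[abs_def])
next
  case (Suc k)
  have z: "poly_deg (h1 + h2) (\<lambda>x. 0)" by (rule poly_deg.mono[OF poly_deg.const]) simp
  have i: "poly_deg (h1 + h2) (\<lambda>x. if C then gauss_coeff a b c k i j (lincol n 1 x) (lincol n 2 x) else 0)"
    if "C \<Longrightarrow> i + j \<le> h1 + h2" for C i j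
  proof (cases C)
    case True
    show ?thesis using poly_deg.mono[OF Suc that[OF True]] True by simp
  qed (simp add: z)
  show ?case unfolding gauss_coeff.simps
    by (intro poly_deg.add poly_deg_cmult i) auto
qed

text \<open>Pascal's rule, in the form needed for the induction step of a binomial theorem for
  operators.\<close>

lemma binomial_leibniz:
  fixes f :: "nat \<Rightarrow> 'a::comm_ring_1"
  shows "(\<Sum>k\<le>n. of_nat (n choose k) * f (Suc k)) + (\<Sum>k\<le>n. of_nat (n choose k) * f k)
    = (\<Sum>k\<le>Suc n. of_nat (Suc n choose k) * f k)"
proof -
  have "(\<Sum>k\<le>Suc n. of_nat (Suc n choose k) * f k) = f 0 + (\<Sum>k\<le>n. of_nat (Suc n choose Suc k) * f (Suc k))"
    by (subst sum.atMost_Suc_shift) simp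
  also have "\<dots> = (\<Sum>k\<le>n. of_nat (n choose k) * f (Suc k)) + (f 0 + (\<Sum>k\<le>n. of_nat (n choose Suc k) * f (Suc k)))"
    by (simp add: sum.distrib algebra_simps)
  also have "f 0 + (\<Sum>k\<le>n. of_nat (n choose Suc k) * f (Suc k)) = (\<Sum>k\<le>Suc n. of_nat (n choose k) * f k)"
    by (subst sum.atMost_Suc_shift) simp
  also have "\<dots> = (\<Sum>k\<le>n. of_nat (n choose k) * f k)" by (simp add: binomial_eq_0)
  finally show ?thesis by simp
qed

lemma lapY_lincomb3:
  assumes f: "poly_deg d f1" "poly_deg d f2" "poly_deg d f3"
  shows "lapY Yi (\<lambda>x. a * f1 x + b * f2 x + c * f3 x) = (\<lambda>x. a * lapY Yi f1 x + b * lapY Yi f2 x + c * lapY Yi f3 x)"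
  unfolding lapY_add[OF poly_deg.add[OF poly_deg_cmult[OF f(1)] poly_deg_cmult[OF f(2)]] poly_deg_cmult[OF f(3)]]
    lapY_add[OF poly_deg_cmult[OF f(1)] poly_deg_cmult[OF f(2)]]
    lapY_cmult[OF f(1)] lapY_cmult[OF f(2)] lapY_cmult[OF f(3)] ..

text \<open>The complex bilinear square of \<open>n\<close>, without conjugation; for
  \<open>g *v uzp\<close> it equals N.\<close>

definition lapN :: "('i::finite \<Rightarrow> complex) \<Rightarrow> complex" where
  "lapN n = (\<Sum>i\<in>UNIV. n i ^ 2)"

context
  fixes n :: "'i::finite \<Rightarrow> complex" and Yi :: "real^2^2" and R :: "complex^2^'i \<Rightarrow> complex" and d :: nat
  assumes R: "poly_deg d R" and inv: "trans_inv (range (\<lambda>(t, l). mscale t (colmat n l))) R"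
    and sym: "Yi $ 1 $ 2 = Yi $ 2 $ 1"
begin

abbreviation "gcX k h1 h2 \<equiv> (\<lambda>x. gauss_coeff (lapN n * Yi$1$1) (lapN n * Yi$1$2) (lapN n * Yi$2$2) k h1 h2 (lincol n 1 x) (lincol n 2 x))"

text \<open>On the factor in X the operator multiplies the generating function by the quadratic
  form, hence \<open>k\<close> becomes \<open>Suc k\<close>. \<open>R'\<close> is kept arbitrary
  because iterates of \<open>lapY\<close> on \<open>R\<close> are inserted for it.\<close>

lemma lapY_gauss_coeff_mult:
  assumes R: "poly_deg d' R'" and inv: "trans_inv (range (\<lambda>(t, l). mscale t (colmat n l))) R'"
  shows "lapY Yi (\<lambda>x. gcX k h1 h2 x * R' x) = (\<lambda>x. gcX (Suc k) h1 h2 x * R' x + gcX k h1 h2 x * lapY Yi R' x)"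
proof (induction k arbitrary: h1 h2)
  case 0
  show ?case using lapY_lmono_mult[OF R inv sym, of h1 h2] by (simp add: lmono_def[abs_def] lapN_def)
next
  case (Suc k)
  define g where "g = (\<lambda>b k h1 h2 x. if b then gcX k h1 h2 x else 0)"
  have g: "lapY Yi (\<lambda>x. g b k h1 h2 x * R' x) = (\<lambda>x. g b (Suc k) h1 h2 x * R' x + g b k h1 h2 x * lapY Yi R' x)" for b h1 h2
    using Suc by (cases b) (auto simp: g_def lapY_0)
  have gd: "poly_deg (h1 + h2 + d') (\<lambda>x. g b k i j x * R' x)" if "i \<le> h1" "j \<le> h2" for b i j
  proof (cases b)
    case True
    have "poly_deg (h1 + h2 + d') (\<lambda>x. gcX k i j x * R' x)"
      by (rule poly_deg.mono[OF poly_deg.mult[OF poly_deg_gauss_coeff R]]) (use that in simp)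
    then show ?thesis using True by (simp add: g_def)
  next
    case False
    have "poly_deg (h1 + h2 + d') (\<lambda>x. 0)" by (rule poly_deg.mono[OF poly_deg.const]) simp
    then show ?thesis using False by (simp add: g_def)
  qed
  have step: "gcX (Suc k) h1 h2 x = (lapN n * Yi$1$1 * g (2 \<le> h1) k (h1 - 2) h2 x + 2 * (lapN n * Yi$1$2) * g (1 \<le> h1 \<and> 1 \<le> h2) k (h1 - 1) (h2 - 1) x
      + lapN n * Yi$2$2 * g (2 \<le> h2) k h1 (h2 - 2) x)" for k h1 h2 x
    by (auto simp: g_def)
  have "lapY Yi (\<lambda>x. gcX (Suc k) h1 h2 x * R' x) = lapY Yi (\<lambda>x. (lapN n * Yi$1$1 * (g (2 \<le> h1) k (h1 - 2) h2 x * R' x) + 2 * (lapN n * Yi$1$2) * (g (1 \<le> h1 \<and> 1 \<le> h2) k (h1 - 1) (h2 - 1) x * R' x))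
      + lapN n * Yi$2$2 * (g (2 \<le> h2) k h1 (h2 - 2) x * R' x))"
    unfolding step distrib_right mult.assoc ..
  also have "\<dots> = (\<lambda>x. (lapN n * Yi$1$1 * (g (2 \<le> h1) (Suc k) (h1 - 2) h2 x * R' x + g (2 \<le> h1) k (h1 - 2) h2 x * lapY Yi R' x)
      + 2 * (lapN n * Yi$1$2) * (g (1 \<le> h1 \<and> 1 \<le> h2) (Suc k) (h1 - 1) (h2 - 1) x * R' x + g (1 \<le> h1 \<and> 1 \<le> h2) k (h1 - 1) (h2 - 1) x * lapY Yi R' x))
      + lapN n * Yi$2$2 * (g (2 \<le> h2) (Suc k) h1 (h2 - 2) x * R' x + g (2 \<le> h2) k h1 (h2 - 2) x * lapY Yi R' x))"
    by (subst lapY_lincomb3[where d = "h1 + h2 + d'"]) (simp_all add: gd g)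
  also have "\<dots> = (\<lambda>x. gcX (Suc (Suc k)) h1 h2 x * R' x + gcX (Suc k) h1 h2 x * lapY Yi R' x)"
    unfolding step[of "Suc k"] step[of k] by (simp only: distrib_right distrib_left mult.assoc add_ac mult.commute[of 2] mult.left_commute[of 2])
  finally show ?case .
qed

text \<open>The operator is a sum of two commuting actions, one on each factor, so its powers follow
  the binomial theorem.\<close>

lemma lapY_iter_gauss_mult:
  "(lapY Yi ^^ m) (\<lambda>x. lmono n h1 h2 x * R x) = (\<lambda>x. \<Sum>k\<le>m. of_nat (m choose k) * (gcX k h1 h2 x * (lapY Yi ^^ (m - k)) R x))"
proof (induction m)
  case 0 show ?case by (simp add: lmono_def[abs_def])
next
  case (Suc m)
  let ?r = "\<lambda>k. (lapY Yi ^^ k) R"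
  have r: "poly_deg d (?r k)" "trans_inv (range (\<lambda>(t, l). mscale t (colmat n l))) (?r k)" for k
    using poly_deg.mono[OF poly_deg_lapY_iter[OF R], of k d] trans_inv_lapY_iter[OF inv] by auto
  have p: "poly_deg (h1 + h2 + d) (\<lambda>x. gcX k h1 h2 x * ?r j x)" for k j
    by (rule poly_deg.mult[OF poly_deg_gauss_coeff r(1)])
  have "(lapY Yi ^^ Suc m) (\<lambda>x. lmono n h1 h2 x * R x) = lapY Yi (\<lambda>x. \<Sum>k\<le>m. of_nat (m choose k) * (gcX k h1 h2 x * ?r (m - k) x))"
    using Suc by simp
  also have "\<dots> = (\<lambda>x. \<Sum>k\<le>m. lapY Yi (\<lambda>x. of_nat (m choose k) * (gcX k h1 h2 x * ?r (m - k) x)) x)"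
    by (rule lapY_sum) (auto intro!: poly_deg_cmult p)
  also have "\<dots> = (\<lambda>x. \<Sum>k\<le>m. of_nat (m choose k) * (gcX (Suc k) h1 h2 x * ?r (m - k) x + gcX k h1 h2 x * ?r (Suc (m - k)) x))"
    unfolding lapY_cmult[OF p] lapY_gauss_coeff_mult[OF r] by simp
  also have "\<dots> = (\<lambda>x. \<Sum>k\<le>Suc m. of_nat (Suc m choose k) * (gcX k h1 h2 x * ?r (Suc m - k) x))"
  proof
    fix x
    have "(\<Sum>k\<le>m. of_nat (m choose k) * (gcX (Suc k) h1 h2 x * ?r (m - k) x + gcX k h1 h2 x * ?r (Suc (m - k)) x))
       = (\<Sum>k\<le>m. of_nat (m choose k) * (gcX (Suc k) h1 h2 x * ?r (Suc m - Suc k) x)) + (\<Sum>k\<le>m. of_nat (m choose k) * (gcX k h1 h2 x * ?r (Suc m - k) x))"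
      unfolding sum.distrib[symmetric] by (intro sum.cong refl) (simp only: Suc_diff_le diff_Suc_Suc distrib_left atMost_iff)
    also have "\<dots> = (\<Sum>k\<le>Suc m. of_nat (Suc m choose k) * (gcX k h1 h2 x * ?r (Suc m - k) x))"
      by (rule binomial_leibniz)
    finally show "(\<Sum>k\<le>m. of_nat (m choose k) * (gcX (Suc k) h1 h2 x * ?r (m - k) x + gcX k h1 h2 x * ?r (Suc (m - k)) x))
       = (\<Sum>k\<le>Suc m. of_nat (Suc m choose k) * (gcX k h1 h2 x * ?r (Suc m - k) x))" .
  qed
  finally show ?case .
qed

text \<open>The exponential of a sum of commuting actions is a product of exponentials; the Cauchy
  product applies because both series are finite. The factor in X sums to
  \<open>gauss_poly\<close>.\<close>

lemma heatop_lmono_mult: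
  "heatop Yi (\<lambda>x. lmono n h1 h2 x * R x) x =
    gauss_poly (of_real (- 1 / (8 * pi)) * (lapN n * Yi$1$1)) (of_real (- 1 / (8 * pi)) * (lapN n * Yi$1$2)) (of_real (- 1 / (8 * pi)) * (lapN n * Yi$2$2))
      h1 h2 (lincol n 1 x) (lincol n 2 x) * heatop Yi R x"
proof -
  let ?s = "complex_of_real (- 1 / (8 * pi))"
  define a where "a = (\<lambda>k. ?s ^ k / fact k * gcX k h1 h2 x)"
  define b where "b = (\<lambda>k. ?s ^ k / fact k * (lapY Yi ^^ k) R x)"
  have az: "a k = 0" if "k \<notin> {..h1 + h2}" for k using that by (simp add: a_def gauss_coeff_eq_0)
  have bz: "b k = 0" if "k \<notin> {..d}" for k using that lapY_iter_eq_0[OF R] by (simp add: b_def)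
  have "summable (\<lambda>k. norm (a k))" "summable (\<lambda>k. norm (b k))"
    by (rule summable_finite[of "{..h1 + h2}"]; use az in simp) (rule summable_finite[of "{..d}"]; use bz in simp)
  from Cauchy_product[OF this] have c: "(\<Sum>k. a k) * (\<Sum>k. b k) = (\<Sum>k. \<Sum>i\<le>k. a i * b (k - i))" .
  have "(\<Sum>k. a k) = (\<Sum>k\<le>h1 + h2. a k)" by (rule suminf_finite) (use az in auto)
  also have "\<dots> = gauss_poly (?s * (lapN n * Yi$1$1)) (?s * (lapN n * Yi$1$2)) (?s * (lapN n * Yi$2$2)) h1 h2 (lincol n 1 x) (lincol n 2 x)"
    unfolding gauss_poly_def gauss_coeff_scale a_def by (intro sum.cong refl) (simp only: times_divide_eq_left)
  finally have A: "(\<Sum>k. a k) = \<dots>" .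
  have B: "(\<Sum>k. b k) = heatop Yi R x" unfolding heatop_def b_def by (simp add: of_real_divide of_real_power)
  have "heatop Yi (\<lambda>x. lmono n h1 h2 x * R x) x = (\<Sum>m. \<Sum>i\<le>m. a i * b (m - i))"
    unfolding heatop_def lapY_iter_gauss_mult
  proof (intro suminf_cong)
    fix m
    have "complex_of_real ((- 1 / (8 * pi)) ^ m / fact m) * (of_nat (m choose i) * (gcX i h1 h2 x * (lapY Yi ^^ (m - i)) R x)) = a i * b (m - i)" if "i \<le> m" for i
    proof -
      have f: "complex_of_nat (m choose i) / fact m = 1 / (fact i * fact (m - i))"
        using binomial_fact[OF that, where 'a=complex] by simp
      have "complex_of_real ((- 1 / (8 * pi)) ^ m / fact m) * (of_nat (m choose i) * (gcX i h1 h2 x * (lapY Yi ^^ (m - i)) R x))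
        = ?s ^ m * (of_nat (m choose i) / fact m) * (gcX i h1 h2 x * (lapY Yi ^^ (m - i)) R x)"
        by (simp add: of_real_divide of_real_power)
      also have "?s ^ m = ?s ^ i * ?s ^ (m - i)" using that by (metis le_add_diff_inverse power_add)
      finally show ?thesis unfolding f a_def b_def by (simp add: field_simps)
    qed
    then show "complex_of_real ((- 1 / (8 * pi)) ^ m / fact m) * (\<Sum>k\<le>m. of_nat (m choose k) * (gcX k h1 h2 x * (lapY Yi ^^ (m - k)) R x)) = (\<Sum>i\<le>m. a i * b (m - i))"
      unfolding sum_distrib_left by (intro sum.cong refl) simp
  qed
  then show ?thesis using A B c by simp
qed

end

section \<open>Gaussian bounds over lattices\<close>

text \<open>The Gaussian is a product over coordinates, and finite products of absolutely summable
  families are summable over functions; vectors are then identified with functions.\<close>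

lemma int_vec_gaussian_summable:
  assumes "e > (0::real)"
  shows "(\<lambda>k::int^'n::finite. exp (- e * (\<Sum>i\<in>UNIV. of_int (k $ i) ^ 2))) summable_on UNIV"
proof -
  have "(\<lambda>n::int. exp (- e * of_int n ^ 2 + 0 * \<bar>of_int n\<bar>)) summable_on UNIV"
    by (rule int_gaussian_summable[OF assms])
  then have 1: "Infinite_Set_Sum.abs_summable_on (\<lambda>n::int. exp (- e * of_int n ^ 2)) UNIV"
    unfolding abs_summable_equivalent[symmetric] by (simp only: real_norm_def abs_exp_cancel mult_zero_left add_0_right)
  have "Infinite_Set_Sum.abs_summable_on (\<lambda>g::'n \<Rightarrow> int. \<Prod>i\<in>UNIV. exp (- e * of_int (g i) ^ 2)) (PiE UNIV (\<lambda>_. UNIV))"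
    by (rule abs_summable_on_prod_PiE[OF _ _ 1]) auto
  then have "(\<lambda>g::'n \<Rightarrow> int. \<Prod>i\<in>UNIV. exp (- e * of_int (g i) ^ 2)) summable_on UNIV"
    unfolding abs_summable_equivalent[symmetric] PiE_UNIV_domain by (auto simp: abs_prod)
  then have s: "(\<lambda>g::'n \<Rightarrow> int. exp (- e * (\<Sum>i\<in>UNIV. of_int (g i) ^ 2))) summable_on UNIV"
    by (simp add: exp_sum[symmetric] sum_distrib_left)
  have "bij_betw (\<lambda>k::int^'n. ($) k) UNIV UNIV"
    by (rule bij_betw_byWitness[of _ vec_lambda]) (auto simp: vec_lambda_eta)
  from summable_on_reindex_bij_betw[OF this, of "\<lambda>g. exp (- e * (\<Sum>i\<in>UNIV. of_int (g i) ^ 2))"] s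
  show ?thesis by simp
qed

lemma norm_add_square_ge:
  fixes x y :: "'a::real_inner"
  shows "norm (x + y) ^ 2 \<ge> norm y ^ 2 / 2 - norm x ^ 2"
proof -
  have "norm y \<le> norm (x + y) + norm x" by (metis add_diff_cancel_left' norm_triangle_ineq4)
  then have "norm y ^ 2 \<le> (norm (x + y) + norm x)^2" by (intro power_mono) auto
  also have "\<dots> \<le> 2 * norm (x + y) ^ 2 + 2 * norm x ^ 2"
    using zero_le_power2[of "norm (x + y) - norm x"] by (simp add: power2_eq_square algebra_simps)
  finally show ?thesis by simp
qed

text \<open>An injective basis matrix is bounded below, which transports Gaussian decay from integer
  vectors. Removing the offset \<open>s\<close> costs half of the rate and a constant
  factor.\<close>

lemma lattice_coset_gaussian_summable:
  fixes L :: "(real^('p::finite + bool)) set"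
  assumes L: "is_lattice L" and e: "e > 0"
  shows "(\<lambda>v. exp (- e * norm v ^ 2)) summable_on {v. v - s \<in> L}"
proof -
  obtain B :: "real^('p + bool)^('p + bool)" where B: "invertible B" "L = range (\<lambda>k::int^('p + bool). B *v (\<chi> i. of_int (k$i)))"
    using L unfolding is_lattice_def by blast
  define f where "f = (\<lambda>k::int^('p + bool). (\<chi> i. of_int (k$i)) :: real^('p + bool))"
  have injB: "inj ((*v) B)" using B(1) by (simp add: invertible_eq_bij bij_is_inj)
  obtain c where c: "c > 0" "\<And>x. c * norm x \<le> norm (B *v x)"
    using linear_inj_bounded_below_pos[OF matrix_vector_mul_linear injB] by blast
  have img: "{v. v - s \<in> L} = (\<lambda>k. s + B *v f k) ` UNIV"
    unfolding B(2) f_def by (auto simp: image_iff algebra_simps)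
  have injf: "inj f" unfolding f_def inj_def by (auto simp: vec_eq_iff)
  have inj: "inj (\<lambda>k. s + B *v f k)" using injB injf by (auto simp: inj_def)
  show ?thesis unfolding img
  proof (subst summable_on_reindex[OF inj], rule summable_on_comparison_test)
    show "(\<lambda>k::int^('p + bool). exp (e * norm s ^ 2) * exp (- (e * c^2 / 2) * (\<Sum>i\<in>UNIV. of_int (k $ i) ^ 2))) summable_on UNIV"
      using e c by (intro summable_on_cmult_right int_vec_gaussian_summable) auto
    fix k :: "int^('p + bool)"
    have n: "norm (f k) ^ 2 = (\<Sum>i\<in>UNIV. of_int (k $ i) ^ 2)"
      by (simp add: norm_vec_def L2_set_def f_def sum_nonneg)
    have "c^2 * norm (f k)^2 \<le> norm (B *v f k) ^ 2"
      using c(2)[of "f k"] c(1) power_mono[of "c * norm (f k)" "norm (B *v f k)" 2] by (simp add: power_mult_distrib)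
    then have "c^2 * norm (f k)^2 / 2 - norm s ^ 2 \<le> norm (s + B *v f k) ^ 2"
      using norm_add_square_ge[of "B *v f k" s] by linarith
    then have "e * (c^2 * norm (f k)^2 / 2 - norm s ^ 2) \<le> e * norm (s + B *v f k) ^ 2"
      using e by (intro mult_left_mono) auto
    then show "((\<lambda>v. exp (- e * norm v ^ 2)) \<circ> (\<lambda>k. s + B *v f k)) k \<le> exp (e * norm s ^ 2) * exp (- (e * c^2 / 2) * (\<Sum>i\<in>UNIV. of_int (k $ i) ^ 2))"
      unfolding o_def exp_add[symmetric] exp_le_cancel_iff n[symmetric] by (simp add: algebra_simps)
  qed auto
qed

lemma coset2_gaussian_summable:
  fixes L :: "(real^('p::finite + bool)) set"
  assumes L: "is_lattice L" and e: "e > 0"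
  shows "(\<lambda>v. exp (- e * (norm (v$1) ^ 2 + norm (v$2) ^ 2))) summable_on coset2 \<sigma> L"
proof -
  have s: "(\<lambda>(x, y). exp (- e * norm x ^ 2) * exp (- e * norm y ^ 2)) summable_on {v. v - \<sigma>$1 \<in> L} \<times> {v. v - \<sigma>$2 \<in> L}"
    by (intro summable_on_Times_mult lattice_coset_gaussian_summable L e) auto
  have "bij_betw (\<lambda>v. (v$1, v$2)) (coset2 \<sigma> L) ({v. v - \<sigma>$1 \<in> L} \<times> {v. v - \<sigma>$2 \<in> L})"
    by (rule bij_betw_byWitness[of _ "\<lambda>(x, y). \<chi> j. if j = 1 then x else y"])
      (auto simp: coset2_def vec_eq_iff forall_2)
  from summable_on_reindex_bij_betw[OF this, of "\<lambda>(x, y). exp (- e * norm x ^ 2) * exp (- e * norm y ^ 2)"] s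
  show ?thesis by (simp add: exp_add[symmetric] algebra_simps)
qed

section \<open>Growth of polynomials and their values at real points\<close>

lemma power_exp_square_bound:
  fixes e :: real
  assumes "e > 0"
  shows "\<exists>C\<ge>0. \<forall>x\<ge>0. x ^ n \<le> C * exp (e * x^2)"
proof (intro exI conjI allI impI)
  \<comment> \<open>The witness is exp of the maximum of n x - e x^2, after bounding
    \<open>x ^ n\<close> by exp(n x).\<close>
  show "exp (of_nat n ^ 2 / (4 * e)) \<ge> 0" by simp
  fix x :: real assume "x \<ge> 0"
  have "x ^ n \<le> exp x ^ n" using \<open>x \<ge> 0\<close> order_trans[OF _ exp_ge_add_one_self[of x], of x] by (intro power_mono) auto
  also have "\<dots> = exp (of_nat n * x)" by (simp add: exp_of_nat_mult)
  also have "\<dots> \<le> exp (of_nat n ^ 2 / (4 * e) + e * x^2)"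
  proof -
    have "0 \<le> (2 * e * x - of_nat n)^2 / (4 * e)" using assms by simp
    also have "\<dots> = e * x^2 - of_nat n * x + of_nat n ^ 2 / (4 * e)" using assms by (simp add: power2_diff power_mult_distrib field_simps power2_eq_square)
    finally show ?thesis by simp
  qed
  finally show "x ^ n \<le> exp (of_nat n ^ 2 / (4 * e)) * exp (e * x^2)" by (simp add: exp_add)
qed

text \<open>The rate must be arbitrary in the induction: a product of polynomials spends half of it
  on each factor.\<close>

lemma poly_deg_exp_bound:
  fixes p :: "complex^2^('i::finite) \<Rightarrow> complex"
  assumes "poly_deg d p" "e > 0"
  shows "\<exists>C\<ge>0. \<forall>x. norm (p x) \<le> C * exp (e * (\<Sum>i\<in>UNIV. \<Sum>j\<in>UNIV. norm (x $ i $ j) ^ 2))"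
  using assms
proof (induction arbitrary: e)
  case (const c)
  have "norm c \<le> norm c * exp (e * (\<Sum>i\<in>UNIV. \<Sum>j\<in>UNIV. norm (x $ i $ j) ^ 2))" for x :: "complex^2^'i"
    using const by (simp add: mult_left_le[of "norm c"] sum_nonneg mult_le_cancel_left1)
  then show ?case by (intro exI[of _ "norm c"]) auto
next
  case (var i j)
  obtain C where C: "C \<ge> 0" "\<And>x. x \<ge> 0 \<Longrightarrow> x ^ 1 \<le> C * exp (e * x^2)" using power_exp_square_bound[OF var, of 1] by blast
  have "norm (x $ i $ j) \<le> C * exp (e * (\<Sum>i\<in>UNIV. \<Sum>j\<in>UNIV. norm (x $ i $ j) ^ 2))" for x :: "complex^2^'i"
  proof -
    have "norm (x $ i $ j) ^ 2 \<le> (\<Sum>j\<in>UNIV. norm (x $ i $ j) ^ 2)" by (rule member_le_sum) auto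
    also have "\<dots> \<le> (\<Sum>i\<in>UNIV. \<Sum>j\<in>UNIV. norm (x $ i $ j) ^ 2)"
      by (rule member_le_sum[where f="\<lambda>i. \<Sum>j\<in>UNIV. norm (x $ i $ j) ^ 2"]) (auto intro: sum_nonneg)
    finally have le: "norm (x $ i $ j) ^ 2 \<le> \<dots>" .
    have "norm (x $ i $ j) \<le> C * exp (e * norm (x $ i $ j)^2)" using C(2)[of "norm (x $ i $ j)"] by simp
    also have "\<dots> \<le> C * exp (e * (\<Sum>i\<in>UNIV. \<Sum>j\<in>UNIV. norm (x $ i $ j) ^ 2))"
      using le C(1) var by (intro mult_left_mono) auto
    finally show ?thesis .
  qed
  then show ?case using C(1) by blast
next
  case (add d p q)
  obtain C1 C2 where C: "C1 \<ge> 0" "C2 \<ge> 0" "\<And>x. norm (p x) \<le> C1 * exp (e * (\<Sum>i\<in>UNIV. \<Sum>j\<in>UNIV. norm (x $ i $ j) ^ 2))"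
    "\<And>x. norm (q x) \<le> C2 * exp (e * (\<Sum>i\<in>UNIV. \<Sum>j\<in>UNIV. norm (x $ i $ j) ^ 2))"
    using add.IH(1)[OF add.prems] add.IH(2)[OF add.prems] by blast
  have "norm (p x + q x) \<le> (C1 + C2) * exp (e * (\<Sum>i\<in>UNIV. \<Sum>j\<in>UNIV. norm (x $ i $ j) ^ 2))" for x
    using norm_triangle_ineq[of "p x" "q x"] C(3)[of x] C(4)[of x] unfolding distrib_right by linarith
  then show ?case using C(1,2) by (intro exI[of _ "C1 + C2"]) auto
next
  case (mult d p d' q)
  have "e / 2 > 0" using mult.prems by simp
  then obtain C1 C2 where C: "C1 \<ge> 0" "C2 \<ge> 0" "\<And>x. norm (p x) \<le> C1 * exp (e / 2 * (\<Sum>i\<in>UNIV. \<Sum>j\<in>UNIV. norm (x $ i $ j) ^ 2))"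
    "\<And>x. norm (q x) \<le> C2 * exp (e / 2 * (\<Sum>i\<in>UNIV. \<Sum>j\<in>UNIV. norm (x $ i $ j) ^ 2))"
    using mult.IH(1) mult.IH(2) by blast
  have "norm (p x * q x) \<le> (C1 * C2) * exp (e * (\<Sum>i\<in>UNIV. \<Sum>j\<in>UNIV. norm (x $ i $ j) ^ 2))" for x
  proof -
    let ?s = "\<Sum>i\<in>UNIV. \<Sum>j\<in>UNIV. norm (x $ i $ j) ^ 2"
    have "norm (p x * q x) \<le> (C1 * exp (e / 2 * ?s)) * (C2 * exp (e / 2 * ?s))"
      unfolding norm_mult by (intro mult_mono C) (auto simp: C)
    also have "\<dots> = (C1 * C2) * (exp (e / 2 * ?s) * exp (e / 2 * ?s))" by simp
    also have "exp (e / 2 * ?s) * exp (e / 2 * ?s) = exp (e * ?s)" unfolding exp_add[symmetric] by simp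
    finally show ?thesis .
  qed
  then show ?case using C(1,2) by (intro exI[of _ "C1 * C2"]) auto
next
  case (mono d p d') then show ?case by blast
qed

lemma poly_deg_line:
  fixes p :: "complex^2^('i::finite) \<Rightarrow> complex"
  assumes "poly_deg d p"
  shows "\<exists>q. \<forall>t. p (a + mscale t b) = poly q t"
  using assms
proof induction
  case (const c) show ?case by (rule exI[of _ "[:c:]"]) simp
next
  case (var i j) show ?case by (rule exI[of _ "[:a $ i $ j, b $ i $ j:]"]) (simp add: mscale_def)
next
  case (add d p q)
  then obtain r s where "\<And>t. p (a + mscale t b) = poly r t" "\<And>t. q (a + mscale t b) = poly s t" by blast
  then show ?case by (intro exI[of _ "r + s"]) simp
next
  case (mult d p d' q)
  then obtain r s where "\<And>t. p (a + mscale t b) = poly r t" "\<And>t. q (a + mscale t b) = poly s t" by blast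
  then show ?case by (intro exI[of _ "r * s"]) simp
qed

text \<open>Along the complex line through \<open>Re x\<close> in direction \<open>Im x\<close> a polynomial function becomes
  a polynomial in one variable, so its values on real points determine it.\<close>

lemma poly_deg_eq_on_reals:
  fixes p q :: "complex^2^('i::finite) \<Rightarrow> complex"
  assumes p: "poly_deg d p" and q: "poly_deg d' q"
    and eq: "\<And>r :: real^2^'i. p (\<chi> i j. of_real (r $ i $ j)) = q (\<chi> i j. of_real (r $ i $ j))"
  shows "p = q"
proof
  fix x
  define a :: "complex^2^'i" where "a = (\<chi> i j. of_real (Re (x $ i $ j)))"
  define b :: "complex^2^'i" where "b = (\<chi> i j. of_real (Im (x $ i $ j)))"
  obtain r where r: "\<And>t. p (a + mscale t b) = poly r t"
    using poly_deg_line[OF p] by blast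
  obtain s where s: "\<And>t. q (a + mscale t b) = poly s t"
    using poly_deg_line[OF q] by blast
  note rs = r s
  have "poly (r - s) (of_real t) = 0" for t
  proof -
    have "a + mscale (of_real t) b = (\<chi> i j. of_real (((\<chi> i j. Re (x $ i $ j) + t * Im (x $ i $ j)) :: real^2^'i) $ i $ j))"
      by (simp add: a_def b_def mscale_def vec_eq_iff)
    then have "p (a + mscale (of_real t) b) = q (a + mscale (of_real t) b)" by (simp only: eq)
    then show ?thesis by (simp add: rs)
  qed
  then have "range complex_of_real \<subseteq> {t. poly (r - s) t = 0}" by auto
  moreover have "infinite (range complex_of_real)"
    using infinite_UNIV_char_0[where 'a=real] by (simp add: finite_image_iff inj_on_def)
  ultimately have "r - s = 0" using poly_roots_finite[of "r - s"] finite_subset by blast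
  then have "p (a + mscale \<i> b) = q (a + mscale \<i> b)" using rs by simp
  moreover have "a + mscale \<i> b = x" by (simp add: a_def b_def mscale_def vec_eq_iff complex_eq[symmetric])
  ultimately show "p x = q x" by simp
qed

section \<open>Geometry of the splitting\<close>

lemma bf_sym: "bf x y = bf y x"
  by (simp add: bf_def mult_ac)

lemma bf_add_left: "bf (x + y) z = bf x z + bf y z"
  by (simp add: bf_def algebra_simps sum.distrib)

lemma bf_scale_left: "bf (a *\<^sub>R x) z = a * bf x z"
  by (simp add: bf_def algebra_simps sum_distrib_left)

lemma bf_add_right: "bf z (x + y) = bf z x + bf z y"
  by (simp add: bf_sym[of z] bf_add_left)

lemma bf_scale_right: "bf z (a *\<^sub>R x) = a * bf z x"
  by (simp add: bf_sym[of z] bf_scale_left)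

lemma bf_minus_left: "bf (- x) z = - bf x z"
  using bf_scale_left[of "-1" x z] by simp

lemma bf_minus_right: "bf z (- x) = - bf z x"
  using bf_scale_right[of z "-1" x] by simp

lemma bf_diff_left: "bf (x - y) z = bf x z - bf y z"
  using bf_add_left[of x "- y"] by (simp add: bf_minus_left)

lemma bf_diff_right: "bf z (x - y) = bf z x - bf z y"
  using bf_add_right[of z x "- y"] by (simp add: bf_minus_right)

lemma bf_zero_left [simp]: "bf 0 z = 0"
  by (simp add: bf_def)

lemma bf_zero_right [simp]: "bf z 0 = 0"
  by (simp add: bf_def)

lemmas bf_simps = bf_add_left bf_add_right bf_scale_left bf_scale_right bf_minus_left bf_minus_right
  bf_diff_left bf_diff_right

lemma bf_axis: "bf x (axis i 1) = sgnc i * x $ i"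
proof -
  have "bf x (axis i 1) = (\<Sum>j\<in>UNIV. if j = i then sgnc i * x $ i else 0)"
    unfolding bf_def by (intro sum.cong) (auto simp: axis_def)
  then show ?thesis by simp
qed

lemma bf_nondegenerate: "(\<And>y. bf x y = 0) \<Longrightarrow> x = 0"
proof -
  assume a: "\<And>y. bf x y = 0"
  have "x $ i = 0" for i
    using a[of "axis i 1"] by (cases i) (auto simp: bf_axis sgnc_def)
  then show "x = 0" by (simp add: vec_eq_iff)
qed

lemma subspace_perpV: "subspace (perpV S)"
  by (auto simp: subspace_def perpV_def bf_simps)

text \<open>\<open>projV\<close> is a definite description, so its value is known only once
  uniqueness holds; nondegeneracy of the form on \<open>S\<close> provides it.\<close>

lemma projV_eqI:
  assumes "subspace S" "s \<in> S" "\<And>t. t \<in> S \<Longrightarrow> bf (v - s) t = 0"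
    and nd: "\<And>t. t \<in> S \<Longrightarrow> (\<And>t'. t' \<in> S \<Longrightarrow> bf t t' = 0) \<Longrightarrow> t = 0"
  shows "projV S v = s"
  unfolding projV_def
proof (rule the_equality)
  show "s \<in> S \<and> (\<forall>t\<in>S. bf (v - s) t = 0)" using assms by auto
  fix s' assume s': "s' \<in> S \<and> (\<forall>t\<in>S. bf (v - s') t = 0)"
  have "s' - s = 0"
  proof (rule nd)
    show "s' - s \<in> S" using assms s' by (simp add: subspace_diff)
    fix t assume "t \<in> S"
    then have "bf (v - s) t - bf (v - s') t = 0" using assms(3) s' by simp
    then show "bf (s' - s) t = 0" by (simp add: bf_simps)
  qed
  then show "s' = s" by simp
qed

lemma matrix_inv_right_left:
  fixes A :: "real^'n^'n"
  assumes "invertible A"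
  shows "A ** matrix_inv A = mat 1" "matrix_inv A ** A = mat 1"
  using someI_ex[of "\<lambda>A'. A ** A' = mat 1 \<and> A' ** A = mat 1"] assms
  unfolding invertible_def matrix_inv_def by auto

text \<open>With \<open>neg_part\<close>, these are the coordinate projections along the signature.
  The form is the difference, and the Euclidean product the sum, of the products of parts, which
  makes definiteness on \<open>z\<close> and its complement visible.\<close>

definition pos_part :: "real^('p::finite + bool) \<Rightarrow> real^('p + bool)" where
  "pos_part x = (\<chi> i. case i of Inl p \<Rightarrow> x $ i | Inr b \<Rightarrow> 0)"

definition neg_part :: "real^('p::finite + bool) \<Rightarrow> real^('p + bool)" where
  "neg_part x = (\<chi> i. case i of Inl p \<Rightarrow> 0 | Inr b \<Rightarrow> x $ i)"

lemma pos_neg_part: "pos_part x + neg_part x = x"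
  by (simp add: vec_eq_iff pos_part_def neg_part_def split: sum.splits)

lemma linear_pos_part: "linear pos_part"
  by (rule linearI) (simp_all add: vec_eq_iff pos_part_def split: sum.splits)

lemma linear_neg_part: "linear neg_part"
  by (rule linearI) (simp_all add: vec_eq_iff neg_part_def split: sum.splits)

lemma sum_sum_type: "(\<Sum>i\<in>UNIV. f i) = (\<Sum>p\<in>UNIV. f (Inl p)) + (\<Sum>b\<in>UNIV. f (Inr b))"
  for f :: "'a::finite + 'b::finite \<Rightarrow> 'c::comm_monoid_add"
proof -
  have "(\<Sum>i\<in>UNIV. f i) = sum f (range Inl \<union> range Inr)" by (simp add: UNIV_sum)
  also have "\<dots> = sum f (range Inl) + sum f (range Inr)" by (rule sum.union_disjoint) auto
  finally show ?thesis by (simp add: sum.reindex)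
qed

lemma bf_inner: "bf x y = pos_part x \<bullet> pos_part y - neg_part x \<bullet> neg_part y"
  by (simp add: bf_def inner_vec_def sum_sum_type pos_part_def neg_part_def sgnc_def sum_negf)

lemma inner_parts: "x \<bullet> y = pos_part x \<bullet> pos_part y + neg_part x \<bullet> neg_part y"
  by (simp add: inner_vec_def sum_sum_type pos_part_def neg_part_def)

locale splitting =
  fixes L M :: "(real^('p::finite + bool)) set"
    and u u' :: "real^('p + bool)"
    and g :: "real^('p + bool)^('p + bool)"
    and z w wp :: "(real^('p + bool)) set"
    and uz uzp \<mu> \<mu>M :: "real^('p + bool)"
  assumes L: "is_lattice L" and u_in: "u \<in> L" and u'_in: "u' \<in> L"
    and uu: "bf u u = 0" and u'u': "bf u' u' = 0" and uu': "bf u u' = 1"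
    and M_perp: "M \<subseteq> perpV {u, u'}"
    and L_split: "L = {x + of_int a *\<^sub>R u + of_int b *\<^sub>R u' | x a b. x \<in> M}"
    and g_SO: "SO_V g"
    and z_def: "z = {x. g *v x \<in> z0}"
    and uz_def: "uz = projV z u"
    and uzp_def: "uzp = projV (perpV z) u"
    and w_def: "w = z \<inter> perpV {uz}"
    and wp_def: "wp = perpV z \<inter> perpV {uzp}"
    and \<mu>_def: "\<mu> = - u' + (1 / (2 * bf uzp uzp)) *\<^sub>R uzp + (1 / (2 * bf uz uz)) *\<^sub>R uz"
    and \<mu>M_def: "\<mu>M = projV (span M) \<mu>"
begin

lemma bf_g: "bf (g *v x) (g *v y) = bf x y"
  using g_SO by (simp add: SO_V_def)

lemma invertible_g: "invertible g"
  using g_SO by (simp add: SO_V_def invertible_det_nz)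

definition "gi = matrix_inv g"

lemma g_gi [simp]: "g *v (gi *v x) = x"
  using matrix_inv_right_left(1)[OF invertible_g] by (simp add: gi_def matrix_vector_mul_assoc)

lemma gi_g [simp]: "gi *v (g *v x) = x"
  using matrix_inv_right_left(2)[OF invertible_g] by (simp add: gi_def matrix_vector_mul_assoc)

lemma bf_gi: "bf (gi *v x) y = bf x (g *v y)" "bf y (gi *v x) = bf (g *v y) x"
  using bf_g[of "gi *v x" y] bf_g[of y "gi *v x"] by simp_all

lemma z_iff: "x \<in> z \<longleftrightarrow> pos_part (g *v x) = 0"
  by (auto simp: z_def z0_def vec_eq_iff pos_part_def split: sum.splits)

lemma perp_z_iff: "x \<in> perpV z \<longleftrightarrow> neg_part (g *v x) = 0"
proof
  assume x: "x \<in> perpV z"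
  have "(g *v x) $ Inr b = 0" for b
  proof -
    have "gi *v axis (Inr b) 1 \<in> z" by (simp add: z_def z0_def axis_def)
    then have "bf x (gi *v axis (Inr b) 1) = 0" using x by (simp add: perpV_def)
    then show ?thesis by (simp add: bf_gi bf_axis sgnc_def)
  qed
  then show "neg_part (g *v x) = 0" by (simp add: vec_eq_iff neg_part_def split: sum.splits)
next
  assume x: "neg_part (g *v x) = 0"
  have "bf x s = 0" if "s \<in> z" for s
    using bf_g[of x s] that x by (simp add: z_iff bf_inner[of "g *v x"])
  then show "x \<in> perpV z" by (simp add: perpV_def)
qed

lemma subspace_z: "subspace z"
  by (auto simp: subspace_def z_iff matrix_vector_right_distrib linear_0[OF linear_pos_part] linear_add[OF linear_pos_part]
      matrix_vector_mult_scaleR linear_cmul[OF linear_pos_part])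

lemma bf_z: "x \<in> z \<Longrightarrow> bf x x = - (norm (g *v x)^2)"
  using bf_g[of x x] bf_inner[of "g *v x" "g *v x"] inner_parts[of "g *v x" "g *v x"]
  by (simp add: z_iff power2_norm_eq_inner)

lemma bf_perp_z: "x \<in> perpV z \<Longrightarrow> bf x x = norm (g *v x)^2"
  using bf_g[of x x] bf_inner[of "g *v x" "g *v x"] inner_parts[of "g *v x" "g *v x"]
  by (simp add: perp_z_iff power2_norm_eq_inner)

lemma g_eq_0: "g *v x = 0 \<longleftrightarrow> x = 0"
  by (metis gi_g matrix_vector_mult_0_right)

lemma z_definite: "x \<in> z \<Longrightarrow> bf x x = 0 \<Longrightarrow> x = 0"
  using bf_z g_eq_0 by simp

lemma perp_z_definite: "x \<in> perpV z \<Longrightarrow> bf x x = 0 \<Longrightarrow> x = 0"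
  using bf_perp_z g_eq_0 by simp

text \<open>Explicit candidates for the projections to the complement of \<open>z\<close> and to
  \<open>z\<close>: move to standard position by \<open>g\<close>, cut coordinates, move
  back.\<close>

definition "px x = gi *v pos_part (g *v x)"
definition "nx x = gi *v neg_part (g *v x)"

lemma pos_part_idem [simp]: "pos_part (pos_part x) = pos_part x" "neg_part (neg_part x) = neg_part x"
  "pos_part (neg_part x) = 0" "neg_part (pos_part x) = 0"
  by (simp_all add: vec_eq_iff pos_part_def neg_part_def split: sum.splits)

lemma px_nx: "px x + nx x = x"
  unfolding px_def nx_def by (simp add: matrix_vector_right_distrib[symmetric] pos_neg_part)

lemma px_in: "px x \<in> perpV z" and nx_in: "nx x \<in> z"
  by (simp_all add: perp_z_iff z_iff px_def nx_def)

lemma z_perp: "x \<in> z \<Longrightarrow> y \<in> perpV z \<Longrightarrow> bf x y = 0" "x \<in> z \<Longrightarrow> y \<in> perpV z \<Longrightarrow> bf y x = 0"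
  unfolding perpV_def by (auto simp: bf_sym[of x y])

lemma projV_z: "projV z x = nx x"
proof (rule projV_eqI[OF subspace_z nx_in])
  fix t assume t: "t \<in> z"
  have "x - nx x = px x" using px_nx[of x] by (simp add: algebra_simps)
  then show "bf (x - nx x) t = 0" using z_perp(2)[OF t px_in] by simp
qed (use z_definite in blast)

lemma projV_perp_z: "projV (perpV z) x = px x"
proof (rule projV_eqI[OF subspace_perpV px_in])
  fix t assume t: "t \<in> perpV z"
  have "x - px x = nx x" using px_nx[of x] by (simp add: algebra_simps)
  then show "bf (x - px x) t = 0" using z_perp(1)[OF nx_in t] by simp
qed (use perp_z_definite in blast)

lemma uz: "uz = nx u" and uzp: "uzp = px u"
  by (simp_all add: uz_def uzp_def projV_z projV_perp_z)

lemma uz_in: "uz \<in> z" and uzp_in: "uzp \<in> perpV z"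
  by (simp_all add: uz uzp nx_in px_in)

lemma u_eq: "u = uzp + uz"
  by (simp add: uz uzp px_nx)

definition "N = bf uzp uzp"

lemma N_uz: "bf uz uz = - N"
  using uu z_perp[OF uz_in uzp_in] by (simp add: u_eq N_def bf_simps)

text \<open>If N were 0, definiteness would kill both components of \<open>u\<close>, against (u,
  u') = 1.\<close>

lemma N_pos: "N > 0"
proof -
  have "N \<noteq> 0"
  proof
    assume "N = 0"
    then have "uzp = 0" using perp_z_definite[OF uzp_in] by (simp add: N_def)
    moreover have "uz = 0" using z_definite[OF uz_in] N_uz \<open>N = 0\<close> by simp
    ultimately have "bf u u' = 0" by (simp add: u_eq)
    then show False using uu' by simp
  qed
  moreover have "N \<ge> 0" using bf_perp_z[OF uzp_in] by (simp add: N_def)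
  ultimately show ?thesis by simp
qed

text \<open>Subtracting the component along \<open>uzp\<close>, respectively \<open>uz\<close>,
  gives the projections to \<open>wp\<close> and \<open>w\<close>. The plus sign in
  \<open>Wn\<close> comes from (\<open>uz\<close>, \<open>uz\<close>) = - N.\<close>

definition "Wp x = px x - (bf x uzp / N) *\<^sub>R uzp"
definition "Wn x = nx x + (bf x uz / N) *\<^sub>R uz"

lemma bf_px: "bf (px x) y = bf x (px y)" "y \<in> perpV z \<Longrightarrow> bf (px x) y = bf x y"
proof -
  have "bf (px x) (px y + nx y) = bf (px x) (px y)" by (simp add: bf_add_right z_perp[OF nx_in px_in])
  moreover have "bf (px x + nx x) (px y) = bf (px x) (px y)" by (simp add: bf_add_left z_perp[OF nx_in px_in])
  ultimately show "bf (px x) y = bf x (px y)" by (simp add: px_nx)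
  show "bf (px x) y = bf x y" if "y \<in> perpV z"
  proof -
    have "bf (px x + nx x) y = bf (px x) y" by (simp add: bf_add_left z_perp(1)[OF nx_in that])
    then show ?thesis by (simp add: px_nx)
  qed
qed

lemma bf_nx:
  assumes "y \<in> z"
  shows "bf (nx x) y = bf x y"
proof -
  have "bf (px x + nx x) y = bf (nx x) y" by (simp add: bf_add_left z_perp(2)[OF assms px_in])
  then show ?thesis by (simp add: px_nx)
qed

lemma subspace_wp: "subspace wp" and subspace_w: "subspace w"
  unfolding wp_def w_def by (intro subspace_inter subspace_perpV subspace_z)+

lemma Wp_in: "Wp x \<in> wp"
  unfolding wp_def
proof
  show "Wp x \<in> perpV z" unfolding Wp_def by (intro subspace_diff subspace_scale subspace_perpV px_in uzp_in)
  show "Wp x \<in> perpV {uzp}" using N_pos bf_px(2)[OF uzp_in] by (simp add: perpV_def Wp_def bf_simps N_def[symmetric])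
qed

lemma Wn_in: "Wn x \<in> w"
  unfolding w_def
proof
  show "Wn x \<in> z" unfolding Wn_def by (intro subspace_add subspace_scale subspace_z nx_in uz_in)
  show "Wn x \<in> perpV {uz}" using N_pos bf_nx[OF uz_in] N_uz by (simp add: perpV_def Wn_def bf_simps)
qed

lemma projV_wp: "projV wp x = Wp x"
proof (rule projV_eqI[OF subspace_wp Wp_in])
  fix t assume t: "t \<in> wp"
  then have t': "t \<in> perpV z" "bf uzp t = 0" by (auto simp: wp_def perpV_def bf_sym)
  then show "bf (x - Wp x) t = 0" using bf_px(2)[OF t'(1)] by (simp add: Wp_def bf_simps)
next
  fix t assume "t \<in> wp" "\<And>t'. t' \<in> wp \<Longrightarrow> bf t t' = 0"
  then show "t = 0" using perp_z_definite by (auto simp: wp_def)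
qed

lemma projV_w: "projV w x = Wn x"
proof (rule projV_eqI[OF subspace_w Wn_in])
  fix t assume t: "t \<in> w"
  then have t': "t \<in> z" "bf uz t = 0" by (auto simp: w_def perpV_def bf_sym)
  then show "bf (x - Wn x) t = 0" using bf_nx[OF t'(1)] by (simp add: Wn_def bf_simps)
next
  fix t assume "t \<in> w" "\<And>t'. t' \<in> w \<Longrightarrow> bf t t' = 0"
  then show "t = 0" using z_definite by (auto simp: w_def)
qed

lemma linear_px: "linear px" and linear_nx: "linear nx"
  unfolding px_def[abs_def] nx_def[abs_def]
  by (auto intro!: linearI simp: matrix_vector_right_distrib matrix_vector_mult_scaleR linear_add[OF linear_pos_part] linear_add[OF linear_neg_part]
     linear_cmul[OF linear_pos_part] linear_cmul[OF linear_neg_part])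

lemma linear_Wp: "linear Wp"
  by (rule linearI) (simp_all add: Wp_def linear_add[OF linear_px] linear_cmul[OF linear_px] bf_simps algebra_simps add_divide_distrib)

lemma linear_Wn: "linear Wn"
  by (rule linearI) (simp_all add: Wn_def linear_add[OF linear_nx] linear_cmul[OF linear_nx] bf_simps algebra_simps add_divide_distrib)

text \<open>Isolates the contribution of X = (x, \<open>uzp\<close>) to the exponent as a rank one
  term over N; its counterpart for \<open>z\<close> has the opposite sign.\<close>

lemma bf_proj_perp_z: "bf (px x) (px y) = bf (Wp x) (Wp y) + bf x uzp * bf y uzp / N"
proof -
  have 1: "px x = Wp x + (bf x uzp / N) *\<^sub>R uzp" for x by (simp add: Wp_def)
  have 2: "bf (Wp x) uzp = 0" "bf uzp (Wp x) = 0" for x using Wp_in[of x] by (auto simp: wp_def perpV_def bf_sym)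
  show ?thesis unfolding 1 using N_pos by (simp add: bf_simps 2 N_def[symmetric])
qed

lemma bf_proj_z: "bf (nx x) (nx y) = bf (Wn x) (Wn y) - bf x uz * bf y uz / N"
proof -
  have 1: "nx x = Wn x + (- bf x uz / N) *\<^sub>R uz" for x by (simp add: Wn_def)
  have 2: "bf (Wn x) uz = 0" "bf uz (Wn x) = 0" for x using Wn_in[of x] by (auto simp: w_def perpV_def bf_sym)
  show ?thesis unfolding 1 using N_pos by (simp add: bf_simps 2 N_uz)
qed

text \<open>The columns of the lattice basis are combinations of \<open>M\<close>, \<open>u\<close>
  and \<open>u'\<close>, hence so is every vector; orthogonality then removes the two hyperbolic
  coordinates.\<close>

lemma span_M: "span M = perpV {u, u'}"
proof
  show "span M \<subseteq> perpV {u, u'}" by (rule span_minimal[OF M_perp subspace_perpV])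
  have gen: "\<exists>m\<in>span M. \<exists>a b. v = m + a *\<^sub>R u + b *\<^sub>R u'" for v
  proof -
    define S where "S = {m + a *\<^sub>R u + b *\<^sub>R u' | m a b. m \<in> span M}"
    have S: "subspace S" unfolding subspace_def
    proof (intro conjI allI ballI)
      have "0 = 0 + 0 *\<^sub>R u + 0 *\<^sub>R u'" by simp
      then show "0 \<in> S" unfolding S_def using span_zero by blast
    next
      fix x y assume "x \<in> S" "y \<in> S"
      then obtain m a b m' a' b' where "x = m + a *\<^sub>R u + b *\<^sub>R u'" "y = m' + a' *\<^sub>R u + b' *\<^sub>R u'" "m \<in> span M" "m' \<in> span M"
        unfolding S_def by blast
      then have "x + y = (m + m') + (a + a') *\<^sub>R u + (b + b') *\<^sub>R u'" "m + m' \<in> span M"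
        by (simp_all add: algebra_simps span_add)
      then show "x + y \<in> S" unfolding S_def by blast
    next
      fix c x assume "x \<in> S"
      then obtain m a b where "x = m + a *\<^sub>R u + b *\<^sub>R u'" "m \<in> span M"
        unfolding S_def by blast
      then have "c *\<^sub>R x = c *\<^sub>R m + (c * a) *\<^sub>R u + (c * b) *\<^sub>R u'" "c *\<^sub>R m \<in> span M"
        by (simp_all add: algebra_simps span_scale)
      then show "c *\<^sub>R x \<in> S" unfolding S_def by blast
    qed
    have "L \<subseteq> S" unfolding L_split S_def using span_base by blast
    obtain B :: "real^('p + bool)^('p + bool)" where B: "invertible B" "L = range (\<lambda>k::int^('p + bool). B *v (\<chi> i. of_int (k$i)))"
      using L unfolding is_lattice_def by blast
    have "B *v axis i 1 \<in> S" for i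
    proof -
      have "B *v (\<chi> j. of_int ((axis i 1 :: int^('p + bool)) $ j)) \<in> L" unfolding B(2) by blast
      moreover have "(\<chi> j. of_int ((axis i 1 :: int^('p + bool)) $ j)) = (axis i 1 :: real^('p + bool))" by (simp add: vec_eq_iff axis_def)
      ultimately show ?thesis using \<open>L \<subseteq> S\<close> by auto
    qed
    then have "(\<Sum>i\<in>UNIV. (matrix_inv B *v v) $ i *\<^sub>R (B *v axis i 1)) \<in> S"
      by (intro subspace_sum subspace_scale S)
    also have "(\<Sum>i\<in>UNIV. (matrix_inv B *v v) $ i *\<^sub>R (B *v axis i 1)) = B *v (\<Sum>i\<in>UNIV. (matrix_inv B *v v) $ i *\<^sub>R axis i 1)"
      by (simp add: linear_sum[OF matrix_vector_mul_linear] matrix_vector_mult_scaleR)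
    also have "(\<Sum>i\<in>UNIV. (matrix_inv B *v v) $ i *\<^sub>R axis i 1) = matrix_inv B *v v"
      by (simp add: vec_eq_iff axis_def if_distrib[of "(*) c" for c] cong: if_cong)
    also have "B *v (matrix_inv B *v v) = v"
      using matrix_inv_right_left(1)[OF B(1)] by (simp add: matrix_vector_mul_assoc)
    finally show ?thesis unfolding S_def by blast
  qed
  show "perpV {u, u'} \<subseteq> span M"
  proof
    fix v assume v: "v \<in> perpV {u, u'}"
    obtain m a b where m: "m \<in> span M" "v = m + a *\<^sub>R u + b *\<^sub>R u'" using gen by blast
    have mp: "bf m u = 0" "bf m u' = 0" using m(1) span_minimal[OF M_perp subspace_perpV] by (auto simp: perpV_def)
    have "bf v u' = a" "bf v u = b" using mp uu uu' u'u' by (simp_all add: m(2) bf_simps bf_sym[of u' u])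
    then have "a = 0" "b = 0" using v by (auto simp: perpV_def)
    then show "v \<in> span M" using m by simp
  qed
qed

lemma projV_span_M: "projV (span M) x = x - bf x u' *\<^sub>R u - bf x u *\<^sub>R u'"
proof (rule projV_eqI[OF subspace_span])
  show "x - bf x u' *\<^sub>R u - bf x u *\<^sub>R u' \<in> span M"
    unfolding span_M perpV_def using uu uu' u'u' by (simp add: bf_simps bf_sym[of u' u])
  fix t assume "t \<in> span M"
  then show "bf (x - (x - bf x u' *\<^sub>R u - bf x u *\<^sub>R u')) t = 0"
    unfolding span_M perpV_def by (simp add: bf_simps bf_sym)
next
  fix t assume t: "t \<in> span M" "\<And>t'. t' \<in> span M \<Longrightarrow> bf t t' = 0"
  have tp: "bf t u = 0" "bf t u' = 0" using t(1) by (auto simp: span_M perpV_def)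
  show "t = 0"
  proof (rule bf_nondegenerate)
    fix y
    have "y - bf y u' *\<^sub>R u - bf y u *\<^sub>R u' \<in> span M"
      unfolding span_M perpV_def using uu uu' u'u' by (simp add: bf_simps bf_sym[of u' u])
    from t(2)[OF this] show "bf t y = 0" using tp by (simp add: bf_simps)
  qed
qed

text \<open>Describes \<open>M\<close> inside \<open>L\<close> by orthogonality, so that membership
  in cosets of \<open>M\<close> can be checked with closure properties of \<open>L\<close>.\<close>

lemma M_iff: "x \<in> M \<longleftrightarrow> x \<in> L \<and> bf x u = 0 \<and> bf x u' = 0"
proof
  assume x: "x \<in> M"
  then have "x = x + of_int 0 *\<^sub>R u + of_int 0 *\<^sub>R u'" by simp
  then have "x \<in> L" unfolding L_split using x by blast
  then show "x \<in> L \<and> bf x u = 0 \<and> bf x u' = 0" using M_perp x by (auto simp: perpV_def)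
next
  assume x: "x \<in> L \<and> bf x u = 0 \<and> bf x u' = 0"
  then obtain m a b where m: "m \<in> M" "x = m + of_int a *\<^sub>R u + of_int b *\<^sub>R u'" unfolding L_split by blast
  have mp: "bf m u = 0" "bf m u' = 0" using m(1) M_perp by (auto simp: perpV_def)
  have "bf x u' = of_int a" "bf x u = of_int b" using mp uu uu' u'u' by (simp_all add: m(2) bf_simps bf_sym[of u' u])
  then have "a = 0" "b = 0" using x by auto
  then show "x \<in> M" using m by simp
qed

lemma bf_uz_uzp: "bf x uz = bf x u - bf x uzp"
  by (simp add: u_eq bf_simps)

text \<open>Adding multiples of \<open>u\<close> to a vector is invisible in \<open>w\<close> and
  its complement: this is what frees the Poisson variable from the smaller theta function.\<close>

lemma Wp_u: "Wp u = 0" and Wn_u: "Wn u = 0"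
proof -
  have "bf u uzp = N" using z_perp(1)[OF uz_in uzp_in] by (simp add: u_eq bf_simps N_def)
  then show "Wp u = 0" using N_pos by (simp add: Wp_def uzp[symmetric])
  have "bf u uz = - N" using z_perp(2)[OF uz_in uzp_in] by (simp add: u_eq bf_simps N_uz)
  then show "Wn u = 0" using N_pos by (simp add: Wn_def uz[symmetric])
qed

lemma px_uzp: "px uzp = uzp" "nx uzp = 0" "px uz = 0" "nx uz = uz"
proof -
  show "px uzp = uzp" "nx uz = uz" by (simp_all add: uzp uz px_def nx_def)
  show "nx uzp = 0" "px uz = 0" by (simp_all add: uzp uz px_def nx_def)
qed

lemma \<mu>_eq: "\<mu> = - u' + (1 / (2 * N)) *\<^sub>R uzp - (1 / (2 * N)) *\<^sub>R uz"
  by (simp add: \<mu>_def N_uz N_def[symmetric])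

lemma \<mu>M_eq: "\<mu>M = \<mu> - bf \<mu> u' *\<^sub>R u"
proof -
  have "bf uzp u = N" "bf uz u = - N" using z_perp[OF uz_in uzp_in] by (simp_all add: u_eq bf_simps N_uz N_def)
  then have "bf \<mu> u = 0" using N_pos uu' by (simp add: \<mu>_eq bf_simps bf_sym[of u' u])
  then show ?thesis by (simp add: \<mu>M_def projV_span_M)
qed

lemma Wp_uzp: "Wp uzp = 0" "Wp uz = 0" "Wn uzp = 0" "Wn uz = 0"
  using N_pos z_perp[OF uz_in uzp_in] by (simp_all add: Wp_def Wn_def px_uzp N_def[symmetric] N_uz)

text \<open>The corrections in \<open>\<mu>\<close> along \<open>uzp\<close>, \<open>uz\<close> and
  \<open>u\<close> are all killed by both projections, leaving \<open>- u'\<close>.\<close>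

lemma Wp_\<mu>M: "Wp \<mu>M = - Wp u'" and Wn_\<mu>M: "Wn \<mu>M = - Wn u'"
  unfolding \<mu>M_eq \<mu>_eq
  by (simp_all add: linear_diff[OF linear_Wp] linear_add[OF linear_Wp] linear_cmul[OF linear_Wp] linear_neg[OF linear_Wp] Wp_u Wn_u Wp_uzp
      linear_diff[OF linear_Wn] linear_add[OF linear_Wn] linear_cmul[OF linear_Wn] linear_neg[OF linear_Wn])

lemma bf_\<mu>: "bf x \<mu> = - bf x u' + bf x uzp / (2 * N) - bf x uz / (2 * N)"
  by (simp add: \<mu>_eq bf_simps)

lemma bf_u_\<mu>: "bf u \<mu> = 0"
proof -
  have "bf u uzp = N" "bf u uz = - N"
    using z_perp[OF uz_in uzp_in] by (simp_all add: u_eq bf_simps N_uz N_def)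
  then show ?thesis using N_pos uu' by (simp add: bf_\<mu>)
qed

text \<open>Explains the coefficients 1 / (2 N) in \<open>\<mu>\<close>: on \<open>span M\<close>
  the pairings with \<open>uzp\<close> and \<open>uz\<close> are opposite, so the two halves add up
  to (x, \<open>uzp\<close>) / N, the linear form in the Poisson phase.\<close>

lemma bf_\<mu>M:
  assumes "x \<in> span M"
  shows "bf x \<mu>M = bf x uzp / N"
proof -
  have x: "bf x u = 0" "bf x u' = 0" using assms by (auto simp: span_M perpV_def)
  have y: "bf x uz = - bf x uzp" using bf_uz_uzp[of x] x by simp
  have "bf x \<mu>M = bf x \<mu>" by (simp only: \<mu>M_eq bf_simps x mult_zero_right diff_zero)
  also have "\<dots> = bf x uzp / N" unfolding bf_\<mu> x y using N_pos by simp
  finally show ?thesis .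
qed

text \<open>Enters through the half shift of the lattice point in the phase of the smaller theta
  function.\<close>

lemma bf_\<mu>M_\<mu>M: "bf \<mu>M \<mu>M = (1 - 2 * bf u' uzp) / N"
proof -
  have "bf \<mu>M \<mu>M = bf \<mu> \<mu>"
    by (simp only: \<mu>M_eq bf_simps bf_u_\<mu> bf_sym[of \<mu> u] uu mult_zero_right diff_zero)
  also have "\<dots> = - bf u' \<mu> + bf uzp \<mu> / (2 * N) - bf uz \<mu> / (2 * N)"
    by (subst \<mu>_eq) (simp add: bf_simps)
  also have "bf u' \<mu> = bf u' uzp / (2 * N) - (1 - bf u' uzp) / (2 * N)"
    by (simp add: bf_\<mu> u'u' bf_uz_uzp bf_sym[of u' u] uu')
  also have "bf uzp \<mu> = - bf u' uzp + 1 / 2"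
    using z_perp[OF uz_in uzp_in] N_pos by (simp add: bf_\<mu> bf_sym[of uzp u'] N_def[symmetric])
  also have "bf uz \<mu> = - (1 - bf u' uzp) + 1 / 2"
    using z_perp[OF uz_in uzp_in] N_pos uu' by (simp add: bf_\<mu> bf_sym[of uz u'] N_uz bf_uz_uzp[of u'] bf_sym[of u' u])
  also have "- (bf u' uzp / (2 * N) - (1 - bf u' uzp) / (2 * N)) + (- bf u' uzp + 1 / 2) / (2 * N) - (- (1 - bf u' uzp) + 1 / 2) / (2 * N)
      = (1 - 2 * bf u' uzp) / N"
    using N_pos by (simp add: field_simps)
  finally show ?thesis .
qed

end

section \<open>The heat operator on the split polynomial\<close>

lemma lapY_iter_cmult:
  assumes "poly_deg d p"
  shows "(lapY Yi ^^ k) (\<lambda>x. c * p x) = (\<lambda>x. c * (lapY Yi ^^ k) p x)"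
proof (induction k)
  case (Suc k) then show ?case using lapY_cmult[OF poly_deg_lapY_iter[OF assms]] by simp
qed simp

lemma heatop_cmult:
  assumes "poly_deg d p"
  shows "heatop Yi (\<lambda>x. c * p x) x = c * heatop Yi p x"
  unfolding heatop_finite[OF assms order_refl] heatop_finite[OF poly_deg_cmult[OF assms] order_refl] lapY_iter_cmult[OF assms]
  by (simp add: sum_distrib_left mult_ac)

lemma capply_add: "capply A (x + y) = capply A x + capply A y"
  by (simp add: capply_def vec_eq_iff distrib_left sum.distrib)

lemma capply_diff: "capply A (x - y) = capply A x - capply A y"
  by (simp add: capply_def vec_eq_iff right_diff_distrib sum_subtractf)

lemma capply_cmat: "capply A (cmat v) = cmat (mapv ((*v) A) v)"
  by (simp add: capply_def cmat_def mapv_def vec_eq_iff matrix_vector_mult_def)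

lemma capply_mscale_colmat:
  "capply A (mscale t (colmat (\<lambda>i. complex_of_real (x $ i)) l)) = mscale t (colmat (\<lambda>i. complex_of_real ((A *v x) $ i)) l)"
  by (simp add: capply_def mscale_def colmat_def vec_eq_iff matrix_vector_mult_def sum_distrib_left mult_ac)

lemma lincol_cmat: "lincol (\<lambda>i. complex_of_real (x $ i)) j (cmat v) = complex_of_real (x \<bullet> v $ j)"
  by (simp add: lincol_def cmat_def inner_vec_def)

text \<open>Only finitely many pieces occur, so a maximum of their bounds exists;
  \<open>heatop_sum\<close> asks for a single one.\<close>

lemma poly_deg_prod_common:
  fixes f :: "nat \<Rightarrow> nat \<Rightarrow> complex^2^('i::finite) \<Rightarrow> complex"
  assumes "\<And>h1 h2. poly_mat (f h1 h2)"
  obtains d where "\<And>h1 h2. h1 \<le> m \<Longrightarrow> h2 \<le> m \<Longrightarrow> poly_deg d (f h1 h2)"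
proof -
  define D where "D = (\<lambda>h1 h2. SOME d. poly_deg d (f h1 h2))"
  have D: "poly_deg (D h1 h2) (f h1 h2)" for h1 h2
    unfolding D_def by (rule someI_ex[OF poly_mat_imp_poly_deg[OF assms]])
  define d where "d = Max ((\<lambda>(h1, h2). D h1 h2) ` ({..m} \<times> {..m}))"
  have "poly_deg d (f h1 h2)" if "h1 \<le> m" "h2 \<le> m" for h1 h2
  proof (rule poly_deg.mono[OF D])
    show "D h1 h2 \<le> d" unfolding d_def by (rule Max_ge) (use that in \<open>auto intro!: image_eqI[of _ _ "(h1, h2)"]\<close>)
  qed
  then show ?thesis by (rule that)
qed

context splitting
begin

definition "nu = (\<lambda>i. complex_of_real ((g *v uzp) $ i))"

text \<open>\<open>g *v uzp\<close> has no negative part, so the indefinite pairing with it is a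
  Euclidean one. This is why \<open>lincol\<close> and \<open>lapN\<close> carry no signs.\<close>

lemma bf_uzp_inner: "bf x uzp = (g *v uzp) \<bullet> (g *v x)"
  using bf_g[of x uzp] uzp_in inner_parts[of "g *v uzp" "g *v x"] bf_inner[of "g *v x" "g *v uzp"]
  by (simp add: perp_z_iff inner_commute)

lemma lapN_nu: "lapN nu = of_real N"
proof -
  have "(\<Sum>i\<in>UNIV. (complex_of_real ((g *v uzp) $ i))\<^sup>2) = of_real ((g *v uzp) \<bullet> (g *v uzp))"
    by (simp add: inner_vec_def power2_eq_square)
  then show ?thesis unfolding lapN_def nu_def N_def bf_uzp_inner .
qed

lemma Wp_Wp: "Wp (Wp x) = Wp x" and Wp_Wn: "Wp (Wn x) = 0" and Wn_Wp: "Wn (Wp x) = 0" and Wn_Wn: "Wn (Wn x) = Wn x"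
proof -
  have i: "px (px x) = px x" "px (nx x) = 0" "nx (px x) = 0" "nx (nx x) = nx x" for x
    by (simp_all add: px_def nx_def linear_0[OF linear_pos_part] linear_0[OF linear_neg_part])
  have "px (Wp x) = Wp x" "px (Wn x) = 0" "nx (Wp x) = 0" "nx (Wn x) = Wn x"
    by (simp_all add: Wp_def Wn_def linear_diff[OF linear_px] linear_add[OF linear_px] linear_cmul[OF linear_px]
        linear_diff[OF linear_nx] linear_add[OF linear_nx] linear_cmul[OF linear_nx] px_uzp i)
  moreover have "bf (Wp x) uzp = 0" "bf (Wn x) uz = 0" using Wp_in[of x] Wn_in[of x] by (auto simp: wp_def w_def perpV_def)
  moreover have "bf (Wp x) uz = 0" "bf (Wn x) uzp = 0"
    using Wp_in[of x] Wn_in[of x] z_perp[OF uz_in, of "Wp x"] z_perp[of "Wn x", OF _ uzp_in] by (auto simp: wp_def w_def)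
  ultimately show "Wp (Wp x) = Wp x" "Wp (Wn x) = 0" "Wn (Wp x) = 0" "Wn (Wn x) = Wn x"
    by (simp_all add: Wp_def[of "Wp x"] Wp_def[of "Wn x"] Wn_def[of "Wp x"] Wn_def[of "Wn x"])
qed

definition "Pr = matrix (projV ((*v) g ` wp))"

lemma projV_g_wp: "projV ((*v) g ` wp) y = g *v Wp (gi *v y)"
proof (rule projV_eqI)
  show "subspace ((*v) g ` wp)" by (rule linear_subspace_image[OF matrix_vector_mul_linear subspace_wp])
  show "g *v Wp (gi *v y) \<in> (*v) g ` wp" using Wp_in by blast
  fix t assume "t \<in> (*v) g ` wp"
  then obtain s where s: "t = g *v s" "s \<in> wp" by blast
  have p: "s \<in> perpV z" "bf uzp s = 0" using s by (auto simp: wp_def perpV_def bf_sym)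
  have "bf (y - g *v Wp (gi *v y)) t = bf (g *v (gi *v y - Wp (gi *v y))) (g *v s)"
    by (simp add: s matrix_vector_mult_diff_distrib)
  also have "\<dots> = 0" using p bf_px(2)[OF p(1)] by (simp only: bf_g) (simp add: Wp_def bf_simps)
  finally show "bf (y - g *v Wp (gi *v y)) t = 0" .
next
  fix t assume t: "t \<in> (*v) g ` wp" "\<And>t'. t' \<in> (*v) g ` wp \<Longrightarrow> bf t t' = 0"
  then obtain s where s: "t = g *v s" "s \<in> wp" by blast
  have "bf s s = 0" using t(2)[OF t(1)] by (simp add: s bf_g)
  then have "s = 0" using perp_z_definite s by (auto simp: wp_def)
  then show "t = 0" by (simp add: s)
qed

lemma Pr_mult: "Pr *v y = g *v Wp (gi *v y)"
proof -
  have "linear (\<lambda>y. g *v Wp (gi *v y))"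
    using linear_compose[OF linear_compose[OF matrix_vector_mul_linear[of gi] linear_Wp] matrix_vector_mul_linear[of g]]
    by (simp add: o_def)
  then show ?thesis unfolding Pr_def projV_g_wp[abs_def] by (simp add: matrix_works[unfolded scalar_mult_eq_scaleR])
qed

definition "gw = (\<lambda>x. g *v (Wp x + Wn x))"

lemma Pr_gw: "Pr *v (gw x) = g *v Wp x"
  by (simp add: Pr_mult gw_def linear_add[OF linear_Wp] Wp_Wp Wp_Wn)

end

locale splitting_poly = splitting L M u u' g z w wp uz uzp \<mu> \<mu>M
  for L M :: "(real^('p::finite + bool)) set" and u u' g z w wp uz uzp \<mu> \<mu>M +
  fixes P :: "complex^2^('p + bool) \<Rightarrow> complex"
    and Psplit :: "nat \<Rightarrow> nat \<Rightarrow> complex^2^('p + bool) \<Rightarrow> complex"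
    and m :: nat
  assumes P_poly: "poly_mat P"
    and Psplit_poly: "\<And>h1 h2. poly_mat (Psplit h1 h2)"
    and Psplit_ext: "\<And>h1 h2 x. Psplit h1 h2 x = Psplit h1 h2 (capply (matrix (projV ((*v) g ` wp))) x)"
    and Psplit_id: "\<And>v. P (cmat (mapv ((*v) g) v)) =
          (\<Sum>h1\<le>m. \<Sum>h2\<le>m. complex_of_real (bf (v$1) uzp ^ h1 * bf (v$2) uzp ^ h2)
              * Psplit h1 h2 (cmat (mapv (\<lambda>x. g *v (projV wp x + projV w x)) v)))"
begin

lemma Psplit_cong:
  assumes "capply Pr x = capply Pr y"
  shows "Psplit h1 h2 x = Psplit h1 h2 y"
  by (subst Psplit_ext, subst (2) Psplit_ext) (simp only: assms Pr_def[symmetric])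

lemma trans_inv_Psplit: "trans_inv {w. capply Pr w = 0} (Psplit h1 h2)"
  unfolding trans_inv_def by (intro allI ballI Psplit_cong) (simp add: capply_add)

lemma heatop_Psplit_cong:
  assumes "capply Pr x = capply Pr y"
  shows "heatop Yi (Psplit h1 h2) x = heatop Yi (Psplit h1 h2) y"
proof -
  have "capply Pr (x - y) = 0" using assms by (simp add: capply_diff)
  then have "heatop Yi (Psplit h1 h2) (y + (x - y)) = heatop Yi (Psplit h1 h2) y"
    using trans_inv_heatop[OF trans_inv_Psplit, of Yi h1 h2] unfolding trans_inv_def by blast
  then show ?thesis by simp
qed

text \<open>Links the geometry to the heat operator: translations along \<open>g *v uzp\<close>
  vanish under the projection \<open>Pr\<close>, so the split pieces satisfy the invariance that
  \<open>heatop_lmono_mult\<close> needs.\<close>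

lemma normal_translations: "range (\<lambda>(t, l). mscale t (colmat nu l)) \<subseteq> {w. capply Pr w = 0}"
proof -
  have "Pr *v (g *v uzp) = 0" by (simp add: Pr_mult Wp_uzp)
  then have "capply Pr (mscale t (colmat nu l)) = 0" for t l
    unfolding nu_def capply_mscale_colmat by (simp add: mscale_def colmat_def vec_eq_iff)
  then show ?thesis by auto
qed

text \<open>The splitting identity is given at real points only, while \<open>pd\<close>
  differentiates in complex entries; both sides are polynomials, so real points suffice. The
  factorials undo the divided powers in \<open>lmono\<close>.\<close>

lemma P_eq: "P = (\<lambda>x. \<Sum>h\<in>{..m} \<times> {..m}. case h of (h1, h2) \<Rightarrow> fact h1 * fact h2 * (lmono nu h1 h2 x * Psplit h1 h2 x))"
proof -
  obtain dP where dP: "poly_deg dP P" using poly_mat_imp_poly_deg[OF P_poly] by blast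
  obtain d where d: "\<And>h1 h2. h1 \<le> m \<Longrightarrow> h2 \<le> m \<Longrightarrow> poly_deg d (Psplit h1 h2)"
    using poly_deg_prod_common[where f=Psplit and m=m, OF Psplit_poly] by blast
  have "poly_deg (m + m + d) (\<lambda>x. \<Sum>h\<in>{..m} \<times> {..m}. case h of (h1, h2) \<Rightarrow> fact h1 * fact h2 * (lmono nu h1 h2 x * Psplit h1 h2 x))"
  proof (intro poly_deg_sum)
    fix h assume "h \<in> {..m} \<times> {..m}"
    then obtain h1 h2 where h: "h = (h1, h2)" "h1 \<le> m" "h2 \<le> m" by auto
    have "poly_deg (m + m + d) (\<lambda>x. lmono nu h1 h2 x * Psplit h1 h2 x)"
      by (rule poly_deg.mono[OF poly_deg.mult[OF poly_deg_lmono d[OF h(2,3)]]]) (use h in simp)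
    then show "poly_deg (m + m + d) (\<lambda>x. case h of (h1, h2) \<Rightarrow> fact h1 * fact h2 * (lmono nu h1 h2 x * Psplit h1 h2 x))"
      unfolding h prod.case by (rule poly_deg_cmult)
  qed simp
  then show ?thesis
  proof (rule poly_deg_eq_on_reals[OF dP])
    fix r :: "real^2^('p + bool)"
    define v where "v = (\<chi> j. gi *v (\<chi> i. r $ i $ j))"
    have r: "(\<chi> i j. complex_of_real (r $ i $ j)) = cmat (mapv ((*v) g) v)"
      by (simp add: cmat_def mapv_def v_def vec_eq_iff)
    have X: "lincol nu j (cmat (mapv ((*v) g) v)) = of_real (bf (v $ j) uzp)" for j
      unfolding nu_def lincol_cmat by (simp add: mapv_def bf_uzp_inner)
    have ps: "Psplit h1 h2 (cmat (mapv (\<lambda>x. g *v (projV wp x + projV w x)) v)) = Psplit h1 h2 (cmat (mapv ((*v) g) v))" for h1 h2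
    proof (rule Psplit_cong)
      have "Pr *v (g *v (projV wp x + projV w x)) = Pr *v (g *v x)" for x
        using Pr_gw[of x] by (simp add: projV_wp projV_w gw_def) (simp add: Pr_mult)
      then show "capply Pr (cmat (mapv (\<lambda>x. g *v (projV wp x + projV w x)) v)) = capply Pr (cmat (mapv ((*v) g) v))"
        unfolding capply_cmat by (simp add: mapv_def)
    qed
    show "P (\<chi> i j. complex_of_real (r $ i $ j)) = (\<Sum>h\<in>{..m} \<times> {..m}. case h of (h1, h2) \<Rightarrow> fact h1 * fact h2 *
       (lmono nu h1 h2 (\<chi> i j. complex_of_real (r $ i $ j)) * Psplit h1 h2 (\<chi> i j. complex_of_real (r $ i $ j))))"
      unfolding r Psplit_id ps lmono_def X sum.cartesian_product
      by (intro sum.cong refl) (auto simp: field_simps)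
  qed
qed

text \<open>\<open>v\<close> may be any pair with the \<open>Wp\<close>-components of
  \<open>lam\<close>. It is later taken independent of the multiple of \<open>u\<close>, which lets
  the split factor leave the Poisson sum.\<close>

lemma heatop_P:
  fixes Yi :: "real^2^2"
  assumes sym: "Yi $ 1 $ 2 = Yi $ 2 $ 1"
    and cong: "\<And>j. Wp (v $ j) = Wp (lam $ j)"
  shows "heatop Yi P (cmat (mapv ((*v) g) lam)) = (\<Sum>h\<in>{..m} \<times> {..m}. case h of (h1, h2) \<Rightarrow>
      fact h1 * fact h2 * gauss_poly (- complex_of_real (N * Yi$1$1 / (8 * pi))) (- complex_of_real (N * Yi$1$2 / (8 * pi))) (- complex_of_real (N * Yi$2$2 / (8 * pi)))
      h1 h2 (of_real (bf (lam$1) uzp)) (of_real (bf (lam$2) uzp)) * heatop Yi (Psplit h1 h2) (cmat (mapv gw v)))"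
proof -
  obtain d where d: "\<And>h1 h2. h1 \<le> m \<Longrightarrow> h2 \<le> m \<Longrightarrow> poly_deg d (Psplit h1 h2)"
    using poly_deg_prod_common[where f=Psplit and m=m, OF Psplit_poly] by blast
  let ?x = "cmat (mapv ((*v) g) lam)"
  have X: "lincol nu j ?x = of_real (bf (lam $ j) uzp)" for j
    unfolding nu_def lincol_cmat by (simp add: mapv_def bf_uzp_inner)
  have pd: "poly_deg (m + m + d) (\<lambda>x. lmono nu h1 h2 x * Psplit h1 h2 x)" if "h1 \<le> m" "h2 \<le> m" for h1 h2
    by (rule poly_deg.mono[OF poly_deg.mult[OF poly_deg_lmono d[OF that]]]) (use that in simp)
  have "heatop Yi P ?x = (\<Sum>h\<in>{..m} \<times> {..m}. heatop Yi (case h of (h1, h2) \<Rightarrow> \<lambda>x. fact h1 * fact h2 * (lmono nu h1 h2 x * Psplit h1 h2 x)) ?x)"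
  proof -
    have "P = (\<lambda>x. \<Sum>h\<in>{..m} \<times> {..m}. (case h of (h1, h2) \<Rightarrow> \<lambda>x. fact h1 * fact h2 * (lmono nu h1 h2 x * Psplit h1 h2 x)) x)"
      by (subst P_eq) (simp add: case_prod_unfold)
    then show ?thesis
      by (simp only:) (rule heatop_sum[where d="m + m + d"], auto intro!: poly_deg_cmult pd)
  qed
  also have "\<dots> = (\<Sum>h\<in>{..m} \<times> {..m}. case h of (h1, h2) \<Rightarrow>
      fact h1 * fact h2 * gauss_poly (- complex_of_real (N * Yi$1$1 / (8 * pi))) (- complex_of_real (N * Yi$1$2 / (8 * pi))) (- complex_of_real (N * Yi$2$2 / (8 * pi)))
      h1 h2 (of_real (bf (lam$1) uzp)) (of_real (bf (lam$2) uzp)) * heatop Yi (Psplit h1 h2) (cmat (mapv gw v)))"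
  proof (intro sum.cong refl)
    fix h assume "h \<in> {..m} \<times> {..m}"
    then obtain h1 h2 where h: "h = (h1, h2)" "h1 \<le> m" "h2 \<le> m" by auto
    have inv: "trans_inv (range (\<lambda>(t, l). mscale t (colmat nu l))) (Psplit h1 h2)"
      using trans_inv_Psplit[of h1 h2] normal_translations unfolding trans_inv_def by blast
    have "capply Pr ?x = capply Pr (cmat (mapv gw v))"
      unfolding capply_cmat by (simp add: mapv_def Pr_gw cong) (simp add: Pr_mult)
    then have "heatop Yi (Psplit h1 h2) ?x = heatop Yi (Psplit h1 h2) (cmat (mapv gw v))" by (rule heatop_Psplit_cong)
    then show "heatop Yi (case h of (h1, h2) \<Rightarrow> \<lambda>x. fact h1 * fact h2 * (lmono nu h1 h2 x * Psplit h1 h2 x)) ?x = (case h of (h1, h2) \<Rightarrow>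
      fact h1 * fact h2 * gauss_poly (- complex_of_real (N * Yi$1$1 / (8 * pi))) (- complex_of_real (N * Yi$1$2 / (8 * pi))) (- complex_of_real (N * Yi$2$2 / (8 * pi)))
      h1 h2 (of_real (bf (lam$1) uzp)) (of_real (bf (lam$2) uzp)) * heatop Yi (Psplit h1 h2) (cmat (mapv gw v)))"
      unfolding h prod.case heatop_cmult[OF pd[OF h(2,3)]] heatop_lmono_mult[OF d[OF h(2,3)] inv sym] lapN_nu X
      by (simp add: mult.assoc)
  qed
  finally show ?thesis .
qed

end

section \<open>The split theta function\<close>

locale theta_setting = splitting_poly L M u u' g z w wp uz uzp \<mu> \<mu>M P Psplit m
  for L M :: "(real^('p::finite + bool)) set" and u u' g z w wp uz uzp \<mu> \<mu>M P Psplit m +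
  fixes \<tau> :: "complex^2^2" and \<sigma> :: "(real^('p + bool))^2"
  assumes \<tau>_H2: "siegelH2 \<tau>" and \<sigma>_in: "\<forall>j. \<sigma>$j \<in> dualV L"
begin

definition "al = Im (\<tau>$1$1)"
definition "be = Im (\<tau>$1$2)"
definition "ga = Im (\<tau>$2$2)"
definition "D = al * ga - be^2"
definition "\<sigma>M = mapv (projV (span M)) \<sigma>"

lemma \<tau>_sym: "\<tau>$2$1 = \<tau>$1$2"
  using \<tau>_H2 by (simp add: siegelH2_def vec_eq_iff transpose_def)

lemma quad_pos:
  assumes "(x, y) \<noteq> (0, 0)"
  shows "al * x^2 + 2 * be * x * y + ga * y^2 > 0"
proof -
  define v :: "real^2" where "v = (\<chi> j. if j = 1 then x else y)"
  have "v \<noteq> 0" using assms by (auto simp: v_def vec_eq_iff forall_2)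
  then have "v \<bullet> (Imat \<tau> *v v) > 0" using \<tau>_H2 by (simp add: siegelH2_def)
  also have "v \<bullet> (Imat \<tau> *v v) = al * x^2 + 2 * be * x * y + ga * y^2"
    by (simp add: inner_vec_def matrix_vector_mult_def sum_2 v_def Imat_def al_def be_def ga_def \<tau>_sym power2_eq_square algebra_simps)
  finally show ?thesis .
qed

lemma ga_pos: "ga > 0"
  using quad_pos[of 0 1] by simp

lemma al_pos: "al > 0"
  using quad_pos[of 1 0] by simp

lemma D_pos: "D > 0"
proof -
  have "al * ga^2 + 2 * be * ga * (- be) + ga * (- be)^2 > 0" by (rule quad_pos) (use ga_pos in simp)
  also have "al * ga^2 + 2 * be * ga * (- be) + ga * (- be)^2 = ga * D" by (simp add: D_def power2_eq_square algebra_simps)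
  finally show ?thesis using ga_pos by (simp add: zero_less_mult_iff)
qed

lemma det_Imat: "det (Imat \<tau>) = D"
  by (simp add: det_2 Imat_def D_def al_def be_def ga_def \<tau>_sym power2_eq_square)

definition "yi = matrix_inv (Imat \<tau>)"

lemma yi_entries: "yi$1$1 = ga / D" "yi$1$2 = - be / D" "yi$2$1 = - be / D" "yi$2$2 = al / D"
proof -
  define B :: "real^2^2" where "B = (\<chi> i j. if i = 1 then (if j = 1 then ga / D else - be / D) else (if j = 1 then - be / D else al / D))"
  have ag: "al * ga = D + be * be" "ga * al = D + be * be" by (simp_all add: D_def power2_eq_square mult.commute)
  have "Imat \<tau> ** B = mat 1"
    using D_pos by (simp add: vec_eq_iff forall_2 matrix_matrix_mult_def sum_2 mat_def B_def Imat_def \<tau>_sym flip: al_def be_def ga_def)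
      (simp add: field_simps ag)
  moreover have "invertible (Imat \<tau>)" using D_pos det_Imat by (simp add: invertible_det_nz)
  ultimately have "yi = B"
    unfolding yi_def by (metis matrix_inv_right_left(2) matrix_mul_assoc matrix_mul_lid matrix_mul_rid)
  then show "yi$1$1 = ga / D" "yi$1$2 = - be / D" "yi$2$1 = - be / D" "yi$2$2 = al / D"
    by (simp_all add: B_def)
qed

lemma \<sigma>_bf: "bf (\<sigma>$j) u \<in> \<int>" "bf (\<sigma>$j) u' \<in> \<int>"
  using \<sigma>_in u_in u'_in by (auto simp: dualV_def)

lemma \<sigma>M_eq: "\<sigma>M$j = \<sigma>$j - bf (\<sigma>$j) u' *\<^sub>R u - bf (\<sigma>$j) u *\<^sub>R u'"
  by (simp add: \<sigma>M_def mapv_def projV_span_M)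

section \<open>Coordinates on the coset and the exponent in them\<close>

definition pick :: "int \<times> int \<Rightarrow> 2 \<Rightarrow> real" where
  "pick a j = (if j = 1 then of_int (fst a) else of_int (snd a))"

definition lamb :: "((real^('p + bool))^2) \<times> (int^2) \<times> (int \<times> int) \<Rightarrow> (real^('p + bool))^2" where
  "lamb = (\<lambda>(k, c, a). \<chi> j. k$j + pick a j *\<^sub>R u + of_int (c$j) *\<^sub>R u')"

lemma coset_span_M: "k \<in> coset2 \<sigma>M M \<Longrightarrow> k$j \<in> span M"
proof -
  assume "k \<in> coset2 \<sigma>M M"
  then have "k$j - \<sigma>M$j \<in> span M" by (simp add: coset2_def span_base)
  moreover have "\<sigma>M$j \<in> span M"
    unfolding span_M perpV_def using uu uu' u'u' by (simp add: \<sigma>M_eq bf_simps bf_sym[of u' u])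
  ultimately have "(k$j - \<sigma>M$j) + \<sigma>M$j \<in> span M" by (rule span_add)
  then show ?thesis by simp
qed

lemma coset_bf: "k \<in> coset2 \<sigma>M M \<Longrightarrow> bf (k$j) u = 0 \<and> bf (k$j) u' = 0"
  using coset_span_M[of k j] by (simp add: span_M perpV_def)

lemma L_add: "x \<in> L \<Longrightarrow> y \<in> L \<Longrightarrow> x + y \<in> L"
proof -
  assume x: "x \<in> L" and y: "y \<in> L"
  obtain B :: "real^('p + bool)^('p + bool)" where B: "L = range (\<lambda>k::int^('p + bool). B *v (\<chi> i. of_int (k$i)))"
    using L unfolding is_lattice_def by blast
  obtain k l where k: "x = B *v (\<chi> i. of_int ((k :: int^('p + bool))$i))" and l: "y = B *v (\<chi> i. of_int ((l :: int^('p + bool))$i))"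
    using x y unfolding B by blast
  have "(\<chi> i. real_of_int (k$i)) + (\<chi> i. of_int (l$i)) = (\<chi> i. real_of_int ((k + l)$i))" by (simp add: vec_eq_iff)
  then have "x + y = B *v (\<chi> i. of_int ((k + l)$i))" unfolding k l by (simp add: matrix_vector_right_distrib[symmetric])
  then show ?thesis unfolding B by blast
qed

lemma L_scale: "x \<in> L \<Longrightarrow> of_int n *\<^sub>R x \<in> L"
proof -
  assume x: "x \<in> L"
  obtain B :: "real^('p + bool)^('p + bool)" where B: "L = range (\<lambda>k::int^('p + bool). B *v (\<chi> i. of_int (k$i)))"
    using L unfolding is_lattice_def by blast
  obtain k where k: "x = B *v (\<chi> i. of_int ((k :: int^('p + bool))$i))" using x unfolding B by blast
  have "of_int n *\<^sub>R (\<chi> i. of_int (k$i)) = (\<chi> i. real_of_int ((\<chi> i. n * k$i) $ i))" by (simp add: vec_eq_iff)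
  then have "of_int n *\<^sub>R x = B *v (\<chi> i. of_int ((\<chi> i. n * k$i) $ i))" unfolding k by (simp add: matrix_vector_mult_scaleR[symmetric])
  then show ?thesis unfolding B by blast
qed

lemma Ints_scale_L: "r \<in> \<int> \<Longrightarrow> x \<in> L \<Longrightarrow> r *\<^sub>R x \<in> L"
  by (auto elim!: Ints_cases intro: L_scale)

text \<open>For \<sigma> in the dual lattice the pairings with \<open>u\<close> and
  \<open>u'\<close> are integers; they read off c and a, so every floor in the inverse map is
  exact.\<close>

lemma lamb_bij: "bij_betw lamb (coset2 \<sigma>M M \<times> UNIV \<times> UNIV) (coset2 \<sigma> L)"
proof (rule bij_betw_byWitness[of _ "\<lambda>v. (mapv (projV (span M)) v, \<chi> j. \<lfloor>bf (v$j) u\<rfloor>, (\<lfloor>bf (v$1) u'\<rfloor>, \<lfloor>bf (v$2) u'\<rfloor>))"])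
  have bl: "bf (lamb (k, c, a) $ j) u = of_int (c$j)" "bf (lamb (k, c, a) $ j) u' = pick a j" if "k \<in> coset2 \<sigma>M M" for k c a j
    using coset_bf[OF that, of j] uu uu' u'u' by (simp_all add: lamb_def bf_simps bf_sym[of u' u])
  show "\<forall>x\<in>coset2 \<sigma>M M \<times> UNIV \<times> UNIV. (mapv (projV (span M)) (lamb x), \<chi> j. \<lfloor>bf (lamb x$j) u\<rfloor>, (\<lfloor>bf (lamb x$1) u'\<rfloor>, \<lfloor>bf (lamb x$2) u'\<rfloor>)) = x"
    using bl by (auto simp: mapv_def projV_span_M vec_eq_iff) (auto simp: lamb_def pick_def)
  have dv: "v$j = (v$j - \<sigma>$j) + \<sigma>$j" for v :: "(real^('p + bool))^2" and j by simp
  have vint: "bf (v$j) u \<in> \<int>" "bf (v$j) u' \<in> \<int>" if v: "v \<in> coset2 \<sigma> L" for v j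
  proof -
    have "v$j - \<sigma>$j \<in> L" using v by (simp add: coset2_def)
    then obtain k a b where k: "k \<in> M" "v$j - \<sigma>$j = k + of_int a *\<^sub>R u + of_int b *\<^sub>R u'" unfolding L_split by blast
    have kp: "bf k u = 0" "bf k u' = 0" using k(1) M_perp by (auto simp: perpV_def)
    have "bf (v$j - \<sigma>$j) u \<in> \<int>" "bf (v$j - \<sigma>$j) u' \<in> \<int>"
      unfolding k(2) using kp uu uu' u'u' by (simp_all add: bf_simps bf_sym[of u' u])
    then have "bf (v$j - \<sigma>$j) u + bf (\<sigma>$j) u \<in> \<int>" "bf (v$j - \<sigma>$j) u' + bf (\<sigma>$j) u' \<in> \<int>" using \<sigma>_bf by (auto intro: Ints_add)
    then show "bf (v$j) u \<in> \<int>" "bf (v$j) u' \<in> \<int>" by (simp_all add: bf_simps)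
  qed
  have fl: "of_int \<lfloor>r\<rfloor> = r" if "r \<in> \<int>" for r :: real using that by (auto elim: Ints_cases)
  show "\<forall>v\<in>coset2 \<sigma> L. lamb (mapv (projV (span M)) v, \<chi> j. \<lfloor>bf (v$j) u\<rfloor>, (\<lfloor>bf (v$1) u'\<rfloor>, \<lfloor>bf (v$2) u'\<rfloor>)) = v"
  proof
    fix v assume v: "v \<in> coset2 \<sigma> L"
    show "lamb (mapv (projV (span M)) v, \<chi> j. \<lfloor>bf (v$j) u\<rfloor>, (\<lfloor>bf (v$1) u'\<rfloor>, \<lfloor>bf (v$2) u'\<rfloor>)) = v"
      by (simp add: vec_eq_iff[of "lamb _"] forall_2) (simp add: lamb_def pick_def mapv_def projV_span_M fl[OF vint(1)[OF v]] fl[OF vint(2)[OF v]])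
  qed
  show "lamb ` (coset2 \<sigma>M M \<times> UNIV \<times> UNIV) \<subseteq> coset2 \<sigma> L"
  proof clarify
    fix k c a1 a2 assume k: "k \<in> coset2 \<sigma>M M"
    show "lamb (k, c, (a1, a2)) \<in> coset2 \<sigma> L" unfolding coset2_def
    proof (intro CollectI allI)
      fix j
      have kL: "k$j - \<sigma>M$j \<in> L" using k M_iff by (simp add: coset2_def)
      have e: "lamb (k, c, (a1, a2))$j - \<sigma>$j = (k$j - \<sigma>M$j) + (pick (a1, a2) j - bf (\<sigma>$j) u') *\<^sub>R u + (of_int (c$j) - bf (\<sigma>$j) u) *\<^sub>R u'"
        by (simp add: lamb_def \<sigma>M_eq algebra_simps)
      show "lamb (k, c, (a1, a2))$j - \<sigma>$j \<in> L"
        unfolding e using \<sigma>_bf[of j] by (intro L_add kL Ints_scale_L u_in u'_in Ints_diff) (auto simp: pick_def)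
    qed
  qed
  show "(\<lambda>v. (mapv (projV (span M)) v, \<chi> j. \<lfloor>bf (v$j) u\<rfloor>, (\<lfloor>bf (v$1) u'\<rfloor>, \<lfloor>bf (v$2) u'\<rfloor>))) ` coset2 \<sigma> L \<subseteq> coset2 \<sigma>M M \<times> UNIV \<times> UNIV"
  proof (rule image_subsetI)
    fix v assume v: "v \<in> coset2 \<sigma> L"
    have "mapv (projV (span M)) v \<in> coset2 \<sigma>M M" unfolding coset2_def
    proof (intro CollectI allI)
      fix j
      have e: "mapv (projV (span M)) v $ j - \<sigma>M$j = (v$j - \<sigma>$j) + (bf (\<sigma>$j) u' - bf (v$j) u') *\<^sub>R u + (bf (\<sigma>$j) u - bf (v$j) u) *\<^sub>R u'"
        by (simp add: mapv_def projV_span_M \<sigma>M_eq algebra_simps)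
      have "mapv (projV (span M)) v $ j - \<sigma>M$j \<in> L" unfolding e
        using v vint[OF v, of j] \<sigma>_bf[of j] by (intro L_add Ints_scale_L u_in u'_in Ints_diff) (auto simp: coset2_def)
      moreover have "mapv (projV (span M)) v $ j - \<sigma>M$j \<in> span M"
        unfolding mapv_def vec_lambda_beta projV_span_M \<sigma>M_eq unfolding span_M perpV_def
        using uu uu' u'u' by (simp add: bf_simps bf_sym[of u' u])
      then have "bf (mapv (projV (span M)) v $ j - \<sigma>M$j) u = 0" "bf (mapv (projV (span M)) v $ j - \<sigma>M$j) u' = 0"
        by (subst (asm) (2) span_M, simp add: perpV_def)+
      ultimately show "mapv (projV (span M)) v $ j - \<sigma>M$j \<in> M" by (simp only: M_iff simp_thms)
    qed
    then show "(mapv (projV (span M)) v, \<chi> j. \<lfloor>bf (v$j) u\<rfloor>, (\<lfloor>bf (v$1) u'\<rfloor>, \<lfloor>bf (v$2) u'\<rfloor>)) \<in> coset2 \<sigma>M M \<times> UNIV \<times> UNIV"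
      by simp
  qed
qed

text \<open>The point of the shifted coset of \<open>M\<close> that replaces the lattice vector; it
  agrees with \<open>k\<close> plus c times \<open>u'\<close> in all
  \<open>w\<close>-components.\<close>

definition vv :: "(real^('p + bool))^2 \<Rightarrow> int^2 \<Rightarrow> (real^('p + bool))^2" where
  "vv k c = k + (\<chi> j. - (of_int (c$j) *\<^sub>R \<mu>M))"

lemma Wp_lamb: "Wp (lamb (k, c, a) $ j) = Wp (vv k c $ j)" and Wn_lamb: "Wn (lamb (k, c, a) $ j) = Wn (vv k c $ j)"
  by (simp_all add: lamb_def vv_def linear_add[OF linear_Wp] linear_cmul[OF linear_Wp] linear_neg[OF linear_Wp] Wp_u Wp_\<mu>M
      linear_add[OF linear_Wn] linear_cmul[OF linear_Wn] linear_neg[OF linear_Wn] Wn_u Wn_\<mu>M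
      linear_diff[OF linear_Wp] linear_diff[OF linear_Wn])

definition pc :: "(real^('p + bool))^2 \<Rightarrow> int^2 \<Rightarrow> 2 \<Rightarrow> real" where
  "pc k c j = bf (k$j) uzp + of_int (c$j) * bf u' uzp"

lemma bf_u_uzp: "bf u uzp = N"
  using z_perp[OF uz_in uzp_in] by (simp add: u_eq bf_simps N_def)

lemma bf_lamb_uzp: "bf (lamb (k, c, a) $ j) uzp = pc k c j + pick a j * N"
  by (simp add: lamb_def pc_def bf_simps bf_u_uzp)

text \<open>(\<lambda>, u) = c, and \<open>u\<close> is the sum of its two components, so the
  pairing with \<open>uz\<close> is c - X.\<close>

lemma bf_lamb_uz: "k \<in> coset2 \<sigma>M M \<Longrightarrow> bf (lamb (k, c, a) $ j) uz = of_int (c$j) - (pc k c j + pick a j * N)"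
  using coset_bf[of k j] uu uu' u'u' unfolding bf_uz_uzp bf_lamb_uzp by (simp add: lamb_def bf_simps bf_sym[of u' u])

definition bc :: "int^2 \<Rightarrow> 2 \<Rightarrow> complex" where
  "bc c j = (\<Sum>k\<in>UNIV. of_int (c$k) * cnj (\<tau>$k$j))"

definition Ecc :: "int^2 \<Rightarrow> complex" where
  "Ecc c = exp (- (pi * \<i> / N) * (of_int (c$1) * bc c 1 + of_int (c$2) * bc c 2))"

definition Ew :: "(real^('p + bool))^2 \<Rightarrow> complex" where
  "Ew v = trq (mapv Wp v) \<tau> + trq (mapv Wn v) (cnjmat \<tau>)"

definition Eexp :: "(real^('p + bool))^2 \<Rightarrow> int^2 \<Rightarrow> int \<times> int \<Rightarrow> complex" where
  "Eexp k c a = (let X = (\<lambda>j. complex_of_real (pc k c j + pick a j * N)) in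
     exp (- of_real (2 * pi / N) * (of_real al * X 1^2 + 2 * of_real be * X 1 * X 2 + of_real ga * X 2^2)
           + 2 * pi * \<i> / N * (X 1 * bc c 1 + X 2 * bc c 2)))"

text \<open>The terms X^2 \<tau> and - (c - X)^2 times the conjugate of \<tau> combine: the
  difference of \<tau> and its conjugate is 2 i y, giving a real form in X, a linear term with
  characteristic \<open>bc\<close> and the constant \<open>Ecc\<close>.\<close>

lemma exponent_lamb:
  assumes "k \<in> coset2 \<sigma>M M"
  shows "ee (trq (mapv px (lamb (k, c, a))) \<tau> + trq (mapv nx (lamb (k, c, a))) (cnjmat \<tau>)) = ee (Ew (vv k c)) * Ecc c * Eexp k c a"
proof -
  define l where "l = lamb (k, c, a)"
  define X where "X = (\<lambda>j. complex_of_real (pc k c j + pick a j * N))"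
  define C where "C = (\<lambda>j. complex_of_int (c$j))"
  define n where "n = complex_of_real N"
  have n0: "n \<noteq> 0" using N_pos by (simp add: n_def)
  define k11 k12 k22 where "k11 = cnj (\<tau>$1$1)" and "k12 = cnj (\<tau>$1$2)" and "k22 = cnj (\<tau>$2$2)"
  have t: "\<tau>$1$1 = k11 + 2 * \<i> * of_real al" "\<tau>$1$2 = k12 + 2 * \<i> * of_real be" "\<tau>$2$2 = k22 + 2 * \<i> * of_real ga"
    by (simp_all add: k11_def k12_def k22_def al_def be_def ga_def complex_eq_iff)
  have bfpx: "complex_of_real (bf (px (l$i)) (px (l$j)) / 2) = of_real (bf (Wp (vv k c $ i)) (Wp (vv k c $ j)) / 2) + X i * X j / (2 * n)" for i j
    unfolding bf_proj_perp_z l_def Wp_lamb bf_lamb_uzp X_def n_def by (simp add: add_divide_distrib of_real_add[of "bf (Wp (vv k c $ i)) (Wp (vv k c $ j)) / 2"] del: of_real_add)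
  have bfnx: "complex_of_real (bf (nx (l$i)) (nx (l$j)) / 2) = of_real (bf (Wn (vv k c $ i)) (Wn (vv k c $ j)) / 2) - (C i - X i) * (C j - X j) / (2 * n)" for i j
    unfolding bf_proj_z l_def Wn_lamb bf_lamb_uz[OF assms] X_def C_def n_def by (simp add: diff_divide_distrib del: of_real_add)
  have "trq (mapv px l) \<tau> + trq (mapv nx l) (cnjmat \<tau>) = Ew (vv k c) +
     ((X 1 * X 1 * \<tau>$1$1 + X 1 * X 2 * \<tau>$1$2 + X 2 * X 1 * \<tau>$1$2 + X 2 * X 2 * \<tau>$2$2)
      - ((C 1 - X 1) * (C 1 - X 1) * k11 + (C 1 - X 1) * (C 2 - X 2) * k12 + (C 2 - X 2) * (C 1 - X 1) * k12 + (C 2 - X 2) * (C 2 - X 2) * k22)) / (2 * n)"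
    unfolding Ew_def trq_def mapv_def vec_lambda_beta bfpx bfnx
    by (simp add: sum_2 cnjmat_def \<tau>_sym k11_def k12_def k22_def algebra_simps add_divide_distrib diff_divide_distrib)
  also have "\<dots> = Ew (vv k c) + (2 * \<i> * (of_real al * X 1^2 + 2 * of_real be * X 1 * X 2 + of_real ga * X 2^2)
      + 2 * (X 1 * bc c 1 + X 2 * bc c 2) - (C 1 * bc c 1 + C 2 * bc c 2)) / (2 * n)"
    unfolding t by (simp add: bc_def sum_2 \<tau>_sym k11_def[symmetric] k12_def[symmetric] k22_def[symmetric] C_def power2_eq_square algebra_simps)
  finally have e: "trq (mapv px l) \<tau> + trq (mapv nx l) (cnjmat \<tau>) = \<dots>" .
  show ?thesis
    unfolding l_def[symmetric] e ee_def Ecc_def Eexp_def Let_def X_def[symmetric] exp_add[symmetric]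
    by (rule arg_cong[where f=exp]) (use n0 in \<open>simp add: n_def[symmetric] C_def field_simps\<close>)
qed

definition HP :: "nat \<times> nat \<Rightarrow> (real^('p + bool))^2 \<Rightarrow> complex" where
  "HP h v = heatop yi (Psplit (fst h) (snd h)) (cmat (mapv gw v))"

definition TL :: "((real^('p + bool))^2) \<times> (int^2) \<times> (int \<times> int) \<Rightarrow> complex" where
  "TL x = heatop yi P (cmat (mapv ((*v) g) (lamb x))) * ee (trq (mapv px (lamb x)) \<tau> + trq (mapv nx (lamb x)) (cnjmat \<tau>))"

definition gp :: "nat \<times> nat \<Rightarrow> (real^('p + bool))^2 \<Rightarrow> int^2 \<Rightarrow> int \<times> int \<Rightarrow> complex" where
  "gp h k c a = gauss_poly (- of_real (N * ga / (8 * pi * D))) (of_real (N * be / (8 * pi * D))) (- of_real (N * al / (8 * pi * D)))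
     (fst h) (snd h) (of_real (pc k c 1 + of_int (fst a) * N)) (of_real (pc k c 2 + of_int (snd a) * N))"

lemma TL_eq:
  assumes "k \<in> coset2 \<sigma>M M"
  shows "TL (k, c, a) = (\<Sum>h\<in>{..m} \<times> {..m}. (fact (fst h) * fact (snd h) * HP h (vv k c) * ee (Ew (vv k c)) * Ecc c) * (gp h k c a * Eexp k c a))"
proof -
  \<comment> \<open>The inverse of y has negative mixed entries, which explains the single positive
    sign among the three arguments.\<close>
  have y: "- complex_of_real (N * yi$1$1 / (8 * pi)) = - of_real (N * ga / (8 * pi * D))"
     "- complex_of_real (N * yi$1$2 / (8 * pi)) = of_real (N * be / (8 * pi * D))"
     "- complex_of_real (N * yi$2$2 / (8 * pi)) = - of_real (N * al / (8 * pi * D))"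
    using D_pos by (simp_all add: yi_entries field_simps)
  have "yi$1$2 = yi$2$1" by (simp add: yi_entries)
  note hp = heatop_P[OF this Wp_lamb[symmetric], of k c a]
  show ?thesis
    unfolding TL_def exponent_lamb[OF assms] hp sum_distrib_right y HP_def gp_def bf_lamb_uzp
    by (intro sum.cong refl) (simp add: case_prod_unfold pick_def mult_ac)
qed

definition A1 :: "int^2 \<Rightarrow> int \<times> int \<Rightarrow> complex" where
  "A1 c d = (of_real ga * (bc c 1 + of_int (fst d)) - of_real be * (bc c 2 + of_int (snd d))) / of_real D"

definition A2 :: "int^2 \<Rightarrow> int \<times> int \<Rightarrow> complex" where
  "A2 c d = (- of_real be * (bc c 1 + of_int (fst d)) + of_real al * (bc c 2 + of_int (snd d))) / of_real D"

definition Fexp :: "(real^('p + bool))^2 \<Rightarrow> int^2 \<Rightarrow> int \<times> int \<Rightarrow> complex" where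
  "Fexp k c d = exp (- of_real (pi / (2 * N)) * ((of_real ga * (bc c 1 + of_int (fst d))^2 - 2 * of_real be * (bc c 1 + of_int (fst d)) * (bc c 2 + of_int (snd d)) + of_real al * (bc c 2 + of_int (snd d))^2) / of_real D)
           - 2 * pi * \<i> / N * (of_int (fst d) * of_real (pc k c 1) + of_int (snd d) * of_real (pc k c 2)))"

lemma poisson_kc:
  "(\<Sum>\<^sub>\<infinity>a. gp h k c a * Eexp k c a) = of_real (1 / (2 * N * sqrt D)) *
     (\<Sum>\<^sub>\<infinity>d. (\<i> / 2 * A1 c d) ^ fst h / fact (fst h) * ((\<i> / 2 * A2 c d) ^ snd h / fact (snd h)) * Fexp k c d)"
  "(\<lambda>a. gp h k c a * Eexp k c a) summable_on UNIV"
proof -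
  note th = gauss_poly_theta_inversion[OF ga_pos D_pos[unfolded D_def] N_pos, of "fst h" "snd h" "pc k c 1" "pc k c 2" "bc c 1" "bc c 2", folded D_def]
  show "(\<Sum>\<^sub>\<infinity>a. gp h k c a * Eexp k c a) = of_real (1 / (2 * N * sqrt D)) *
     (\<Sum>\<^sub>\<infinity>d. (\<i> / 2 * A1 c d) ^ fst h / fact (fst h) * ((\<i> / 2 * A2 c d) ^ snd h / fact (snd h)) * Fexp k c d)"
    using th(1) unfolding gp_def Eexp_def A1_def A2_def Fexp_def by (simp add: case_prod_unfold pick_def Let_def)
  show "(\<lambda>a. gp h k c a * Eexp k c a) summable_on UNIV"
    using th(2) unfolding gp_def Eexp_def by (simp add: case_prod_unfold pick_def Let_def)
qed

end

section \<open>Matching the dual sum with the stated terms\<close>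

context theta_setting
begin

definition \<alpha>d :: "int^2 \<Rightarrow> (real^('p + bool))^2" where
  "\<alpha>d d = (\<chi> j. of_int (d$j) *\<^sub>R \<mu>M)"

definition \<beta>c :: "int^2 \<Rightarrow> (real^('p + bool))^2" where
  "\<beta>c c = (\<chi> j. - (of_int (c$j) *\<^sub>R \<mu>M))"

lemma vv_eq: "vv k c = k + \<beta>c c"
  by (simp add: vv_def \<beta>c_def)

definition ctd :: "int^2 \<Rightarrow> int^2 \<Rightarrow> 2 \<Rightarrow> complex" where
  "ctd c d j = (\<Sum>k\<in>UNIV. of_int (c$k) * \<tau>$k$j) + of_int (d$j)"

definition ctbd :: "int^2 \<Rightarrow> int^2 \<Rightarrow> 2 \<Rightarrow> complex" where
  "ctbd c d j = (\<Sum>k\<in>UNIV. of_int (c$k) * cnj (\<tau>$k$j)) + of_int (d$j)"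

definition Acd :: "int^2 \<Rightarrow> int^2 \<Rightarrow> 2 \<Rightarrow> complex" where
  "Acd c d l = (\<Sum>k\<in>UNIV. ctbd c d k * complex_of_real (yi$k$l))"

definition Gcd :: "int^2 \<Rightarrow> int^2 \<Rightarrow> complex" where
  "Gcd c d = exp (- complex_of_real (pi / (2 * N)) * (\<Sum>j\<in>UNIV. \<Sum>k\<in>UNIV. ctd c d j * ctbd c d k * complex_of_real (yi$k$j)))"

definition tM :: "nat \<times> nat \<Rightarrow> int^2 \<Rightarrow> int^2 \<Rightarrow> (real^('p + bool))^2 \<Rightarrow> complex" where
  "tM h c d k = HP h (k + \<beta>c c) * ee (Ew (k + \<beta>c c) - complex_of_real (trv (k + (1/2) *\<^sub>R \<beta>c c) (\<alpha>d d)))"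

definition coef :: "nat \<times> nat \<Rightarrow> int^2 \<Rightarrow> int^2 \<Rightarrow> complex" where
  "coef h c d = Gcd c d * (Acd c d 1 ^ fst h * Acd c d 2 ^ snd h) / (- 2 * \<i>) ^ (fst h + snd h)"

lemma Acd_eq: "Acd c d 1 = A1 c (d$1, d$2)" "Acd c d 2 = A2 c (d$1, d$2)"
  by (simp_all add: Acd_def A1_def A2_def ctbd_def bc_def sum_2 yi_entries diff_divide_distrib add_divide_distrib algebra_simps)

text \<open>Since c \<tau> + d is its conjugate counterpart plus 2 i c y, the factor y cancels its
  inverse in the mixed product and leaves a term linear in c.\<close>

lemma ctd_sum: "(\<Sum>j\<in>UNIV. \<Sum>k\<in>UNIV. ctd c d j * ctbd c d k * complex_of_real (yi$k$j)) =
  (of_real ga * (ctbd c d 1)^2 - 2 * of_real be * ctbd c d 1 * ctbd c d 2 + of_real al * (ctbd c d 2)^2) / of_real D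
    + 2 * \<i> * (of_int (c$1) * ctbd c d 1 + of_int (c$2) * ctbd c d 2)"
proof -
  define a b e n where "a = complex_of_real al" and "b = complex_of_real be" and "e = complex_of_real ga" and "n = complex_of_real D"
  have n0: "n \<noteq> 0" using D_pos by (simp add: n_def)
  have n: "n = a * e - b^2" by (simp add: n_def a_def b_def e_def D_def)
  have t: "\<tau>$1$1 = cnj (\<tau>$1$1) + 2 * \<i> * a" "\<tau>$1$2 = cnj (\<tau>$1$2) + 2 * \<i> * b" "\<tau>$2$2 = cnj (\<tau>$2$2) + 2 * \<i> * e"
    by (simp_all add: al_def be_def ga_def a_def b_def e_def complex_eq_iff)
  define C1 C2 where "C1 = complex_of_int (c$1)" and "C2 = complex_of_int (c$2)"
  define K1 K2 where "K1 = ctbd c d 1" and "K2 = ctbd c d 2"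
  have c1: "ctd c d 1 = K1 + 2 * \<i> * (C1 * a + C2 * b)"
    unfolding ctd_def K1_def ctbd_def sum_2 \<tau>_sym C1_def C2_def by (subst t(1), subst t(2)) (simp add: algebra_simps)
  have c2: "ctd c d 2 = K2 + 2 * \<i> * (C1 * b + C2 * e)"
    unfolding ctd_def K2_def ctbd_def sum_2 \<tau>_sym C1_def C2_def by (subst t(2), subst t(3)) (simp add: algebra_simps)
  have y: "complex_of_real (yi$1$1) = e / n" "complex_of_real (yi$1$2) = - b / n" "complex_of_real (yi$2$1) = - b / n" "complex_of_real (yi$2$2) = a / n"
    by (simp_all add: yi_entries a_def b_def e_def n_def)
  have "(K1 + 2 * \<i> * (C1 * a + C2 * b)) * K1 * e + (K1 + 2 * \<i> * (C1 * a + C2 * b)) * K2 * (- b)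
     + ((K2 + 2 * \<i> * (C1 * b + C2 * e)) * K1 * (- b) + (K2 + 2 * \<i> * (C1 * b + C2 * e)) * K2 * a)
     = (e * K1^2 - 2 * b * K1 * K2 + a * K2^2) + 2 * \<i> * (C1 * K1 + C2 * K2) * n"
    unfolding n by (simp add: power2_eq_square algebra_simps)
  then have "((K1 + 2 * \<i> * (C1 * a + C2 * b)) * K1 * e + (K1 + 2 * \<i> * (C1 * a + C2 * b)) * K2 * (- b)
     + ((K2 + 2 * \<i> * (C1 * b + C2 * e)) * K1 * (- b) + (K2 + 2 * \<i> * (C1 * b + C2 * e)) * K2 * a)) / n
     = (e * K1^2 - 2 * b * K1 * K2 + a * K2^2) / n + 2 * \<i> * (C1 * K1 + C2 * K2)"
    using n0 by (simp add: add_divide_distrib)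
  then show ?thesis
    unfolding sum_2 c1 c2 K1_def[symmetric] K2_def[symmetric] y C1_def[symmetric] C2_def[symmetric] a_def[symmetric] b_def[symmetric] e_def[symmetric] n_def[symmetric]
    by (simp add: add_divide_distrib diff_divide_distrib)
qed

text \<open>The half shift of \<open>k\<close> by \<open>\<beta>c\<close> turns each pairing into
  (\<open>pc\<close> - c/2) / N. The c d terms left by it are exactly those obtained from
  \<open>Ecc\<close> when \<open>bc\<close> is rewritten as \<open>ctbd\<close> minus d.\<close>

lemma phase:
  assumes k: "k \<in> coset2 \<sigma>M M"
  shows "ee (Ew (vv k c)) * Ecc c * Fexp k c (d$1, d$2) = Gcd c d * ee (Ew (vv k c) - complex_of_real (trv (k + (1/2) *\<^sub>R \<beta>c c) (\<alpha>d d)))"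
proof -
  have tr: "trv (k + (1/2) *\<^sub>R \<beta>c c) (\<alpha>d d) = (\<Sum>j\<in>UNIV. of_int (d$j) * (pc k c j - of_int (c$j) / 2)) / N"
  proof -
    have "bf (k$j + (1/2) *\<^sub>R (- (of_int (c$j) *\<^sub>R \<mu>M))) (of_int (d$j) *\<^sub>R \<mu>M) = of_int (d$j) * (pc k c j - of_int (c$j) / 2) / N" for j
      unfolding bf_simps bf_\<mu>M[OF coset_span_M[OF k]] bf_\<mu>M_\<mu>M pc_def using N_pos by (simp add: field_simps)
    then show ?thesis by (simp add: trv_def \<beta>c_def \<alpha>d_def sum_divide_distrib)
  qed
  define E where "E = Ew (vv k c)"
  define n where "n = complex_of_real N"
  have n0: "n \<noteq> 0" using N_pos by (simp add: n_def)
  define Q where "Q = (of_real ga * (ctbd c d 1)^2 - 2 * of_real be * ctbd c d 1 * ctbd c d 2 + of_real al * (ctbd c d 2)^2) / of_real D"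
  have bcd: "bc c j = ctbd c d j - of_int (d$j)" "bc c j + of_int (d$j) = ctbd c d j" for j by (simp_all add: bc_def ctbd_def)
  define p where "p = complex_of_real pi"
  have "2 * p * \<i> * E + - (p * \<i> / n) * (of_int (c$1) * (ctbd c d 1 - of_int (d$1)) + of_int (c$2) * (ctbd c d 2 - of_int (d$2)))
     + (- (p / (2 * n)) * Q - 2 * p * \<i> / n * (of_int (d$1) * of_real (pc k c 1) + of_int (d$2) * of_real (pc k c 2)))
    = - (p / (2 * n)) * (Q + 2 * \<i> * (of_int (c$1) * ctbd c d 1 + of_int (c$2) * ctbd c d 2))
     + 2 * p * \<i> * (E - (of_int (d$1) * (of_real (pc k c 1) - of_int (c$1) / 2) + of_int (d$2) * (of_real (pc k c 2) - of_int (c$2) / 2)) / n)"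
    using n0 by (simp add: field_simps)
  then have "2 * pi * \<i> * E + - (pi * \<i> / N) * (of_int (c$1) * (ctbd c d 1 - of_int (d$1)) + of_int (c$2) * (ctbd c d 2 - of_int (d$2)))
     + (- of_real (pi / (2 * N)) * Q - 2 * pi * \<i> / N * (of_int (d$1) * of_real (pc k c 1) + of_int (d$2) * of_real (pc k c 2)))
    = - of_real (pi / (2 * N)) * (Q + 2 * \<i> * (of_int (c$1) * ctbd c d 1 + of_int (c$2) * ctbd c d 2))
     + 2 * pi * \<i> * (E - of_real ((of_int (d$1) * (pc k c 1 - of_int (c$1) / 2) + of_int (d$2) * (pc k c 2 - of_int (c$2) / 2)) / N))"
    by (simp add: n_def p_def)
  then show ?thesis
    unfolding Gcd_def ctd_sum
    unfolding Q_def[symmetric] tr ee_def Ecc_def Fexp_def fst_conv snd_conv exp_add[symmetric] E_def[symmetric] bcd(2) sum_2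
    unfolding bcd(1) Q_def[symmetric]
    by (rule arg_cong[where f=exp])
qed

lemma poisson_term:
  assumes k: "k \<in> coset2 \<sigma>M M"
  shows "(fact (fst h) * fact (snd h) * HP h (vv k c) * ee (Ew (vv k c)) * Ecc c) *
     ((\<i> / 2 * A1 c (d$1, d$2)) ^ fst h / fact (fst h) * ((\<i> / 2 * A2 c (d$1, d$2)) ^ snd h / fact (snd h)) * Fexp k c (d$1, d$2))
    = coef h c d * tM h c d k"
proof -
  \<comment> \<open>Turns the i/2 of the inversion formula into the inverse powers of - 2 i of the
    statement.\<close>
  have i: "\<i> / 2 * x = x / (- 2 * \<i>)" for x by (simp add: field_simps)
  have "(fact (fst h) * fact (snd h) * HP h (vv k c) * ee (Ew (vv k c)) * Ecc c) *
     ((\<i> / 2 * A1 c (d$1, d$2)) ^ fst h / fact (fst h) * ((\<i> / 2 * A2 c (d$1, d$2)) ^ snd h / fact (snd h)) * Fexp k c (d$1, d$2))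
    = HP h (vv k c) * ((A1 c (d$1, d$2)) ^ fst h * (A2 c (d$1, d$2)) ^ snd h / (- 2 * \<i>) ^ (fst h + snd h)) * (ee (Ew (vv k c)) * Ecc c * Fexp k c (d$1, d$2))"
    unfolding i power_divide power_add by simp
  also have "\<dots> = coef h c d * tM h c d k"
    unfolding phase[OF k] unfolding coef_def tM_def Acd_eq vv_eq by simp
  finally show ?thesis .
qed

lemma infsum_finite_sum:
  fixes f :: "'a \<Rightarrow> 'b \<Rightarrow> complex"
  assumes "finite A" "\<And>h. h \<in> A \<Longrightarrow> f h summable_on S"
  shows "(\<Sum>\<^sub>\<infinity>x\<in>S. \<Sum>h\<in>A. f h x) = (\<Sum>h\<in>A. \<Sum>\<^sub>\<infinity>x\<in>S. f h x)"
    and "(\<lambda>x. \<Sum>h\<in>A. f h x) summable_on S"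
proof -
  have "(\<lambda>x. \<Sum>h\<in>A. f h x) summable_on S \<and> (\<Sum>\<^sub>\<infinity>x\<in>S. \<Sum>h\<in>A. f h x) = (\<Sum>h\<in>A. \<Sum>\<^sub>\<infinity>x\<in>S. f h x)"
    using assms by (induction A rule: finite_induct) (auto simp: infsum_add summable_on_add)
  then show "(\<Sum>\<^sub>\<infinity>x\<in>S. \<Sum>h\<in>A. f h x) = (\<Sum>h\<in>A. \<Sum>\<^sub>\<infinity>x\<in>S. f h x)"
    "(\<lambda>x. \<Sum>h\<in>A. f h x) summable_on S" by auto
qed

lemma infsum_int2: "(\<Sum>\<^sub>\<infinity>d::int \<times> int. f d) = (\<Sum>\<^sub>\<infinity>d::int^2. f (d$1, d$2))"
  by (rule infsum_reindex_bij_witness[of _ "\<lambda>d::int^2. (d$1, d$2)" "\<lambda>(a, b). \<chi> j. if j = 1 then a else b"])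
    (auto simp: vec_eq_iff forall_2)

lemma sum_a_TL:
  assumes k: "k \<in> coset2 \<sigma>M M"
  shows "(\<Sum>\<^sub>\<infinity>a. TL (k, c, a)) = of_real (1 / (2 * N * sqrt D)) * (\<Sum>h\<in>{..m} \<times> {..m}. \<Sum>\<^sub>\<infinity>d. coef h c d * tM h c d k)"
proof -
  define K where "K = (\<lambda>h. fact (fst h) * fact (snd h) * HP h (vv k c) * ee (Ew (vv k c)) * Ecc c)"
  have "(\<Sum>\<^sub>\<infinity>a. TL (k, c, a)) = (\<Sum>\<^sub>\<infinity>a. \<Sum>h\<in>{..m} \<times> {..m}. K h * (gp h k c a * Eexp k c a))"
    by (simp add: TL_eq[OF k] K_def)
  also have "\<dots> = (\<Sum>h\<in>{..m} \<times> {..m}. \<Sum>\<^sub>\<infinity>a. K h * (gp h k c a * Eexp k c a))"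
    by (rule infsum_finite_sum(1)) (auto intro!: summable_on_cmult_right poisson_kc(2))
  also have "\<dots> = (\<Sum>h\<in>{..m} \<times> {..m}. of_real (1 / (2 * N * sqrt D)) * (\<Sum>\<^sub>\<infinity>d. coef h c d * tM h c d k))"
  proof (rule sum.cong[OF refl])
    fix h
    let ?X = "\<lambda>d. (\<i> / 2 * A1 c d) ^ fst h / fact (fst h) * ((\<i> / 2 * A2 c d) ^ snd h / fact (snd h)) * Fexp k c d"
    have "(\<Sum>\<^sub>\<infinity>a. K h * (gp h k c a * Eexp k c a)) = of_real (1 / (2 * N * sqrt D)) * (\<Sum>\<^sub>\<infinity>d. K h * ?X d)"
      unfolding infsum_cmult_right' poisson_kc(1) by (rule mult.left_commute)
    also have "(\<Sum>\<^sub>\<infinity>d. K h * ?X d) = (\<Sum>\<^sub>\<infinity>d. coef h c d * tM h c d k)"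
      by (subst infsum_int2) (simp only: K_def poisson_term[OF k])
    finally show "(\<Sum>\<^sub>\<infinity>a. K h * (gp h k c a * Eexp k c a)) = of_real (1 / (2 * N * sqrt D)) * (\<Sum>\<^sub>\<infinity>d. coef h c d * tM h c d k)" .
  qed
  finally show ?thesis by (simp add: sum_distrib_left)
qed

section \<open>Absolute convergence\<close>

text \<open>The Euclidean product after \<open>g\<close> is the positive definite majorant of the
  form, which measures the decay of the theta terms.\<close>

lemma inner_g:
  assumes "a \<in> perpV z" "b \<in> z" "a' \<in> perpV z" "b' \<in> z"
  shows "(g *v (a + b)) \<bullet> (g *v (a' + b')) = bf a a' - bf b b'"
  using assms bf_g[of a a'] bf_g[of b b'] inner_parts[of "g *v (a + b)" "g *v (a' + b')"]
  by (simp add: perp_z_iff z_iff bf_inner[of "g *v _"] matrix_vector_right_distrib linear_add[OF linear_pos_part] linear_add[OF linear_neg_part])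

text \<open>Stated for an arbitrary pair \<open>A\<close>, \<open>B\<close> to serve both the
  projections to \<open>z\<close> and its complement and those to \<open>w\<close> and
  \<open>wp\<close>; a real summand changes only the phase.\<close>

lemma norm_ee_trq:
  assumes A: "\<And>x. A x \<in> perpV z" and B: "\<And>x. B x \<in> z"
  defines "\<xi> \<equiv> (\<lambda>x. g *v (A x + B x))"
  shows "norm (ee (trq (mapv A v) \<tau> + trq (mapv B v) (cnjmat \<tau>) - of_real r)) =
    exp (- pi * (al * (\<xi> (v$1) \<bullet> \<xi> (v$1)) + 2 * be * (\<xi> (v$1) \<bullet> \<xi> (v$2)) + ga * (\<xi> (v$2) \<bullet> \<xi> (v$2))))"
proof -
  have i: "\<xi> x \<bullet> \<xi> y = bf (A x) (A y) - bf (B x) (B y)" for x y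
    unfolding \<xi>_def by (rule inner_g[OF A B A B])
  have "Im (trq (mapv A v) \<tau> + trq (mapv B v) (cnjmat \<tau>) - of_real r) =
     (al * (\<xi> (v$1) \<bullet> \<xi> (v$1)) + 2 * be * (\<xi> (v$1) \<bullet> \<xi> (v$2)) + ga * (\<xi> (v$2) \<bullet> \<xi> (v$2))) / 2"
    unfolding i trq_def sum_2 mapv_def vec_lambda_beta cnjmat_def \<tau>_sym
    by (simp add: al_def be_def ga_def bf_sym[of "A (v$2)" "A (v$1)"] bf_sym[of "B (v$2)" "B (v$1)"] field_simps)
  then show ?thesis by (simp add: ee_def norm_exp_eq_Re)
qed

lemma quad_lower:
  obtains e where "e > 0" "\<And>x y :: real^('p + bool). al * (x \<bullet> x) + 2 * be * (x \<bullet> y) + ga * (y \<bullet> y) \<ge> e * (norm x ^ 2 + norm y ^ 2)"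
    "\<And>x y. al * x^2 + 2 * be * x * y + ga * y^2 \<ge> e * (x^2 + y^2)"
proof -
  obtain e where e: "e > 0" "\<And>x y. al * x^2 + 2 * be * x * y + ga * y^2 \<ge> e * (x^2 + y^2)"
    using quadratic_form_lower_bound[OF ga_pos D_pos[unfolded D_def]] by metis
  have "al * (x \<bullet> x) + 2 * be * (x \<bullet> y) + ga * (y \<bullet> y) \<ge> e * (norm x ^ 2 + norm y ^ 2)" for x y :: "real^('p + bool)"
  proof -
    have "e * (norm x ^ 2 + norm y ^ 2) = (\<Sum>i\<in>UNIV. e * ((x$i)^2 + (y$i)^2))"
      unfolding power2_norm_eq_inner by (simp add: inner_vec_def power2_eq_square sum.distrib sum_distrib_left distrib_left)
    also have "\<dots> \<le> (\<Sum>i\<in>UNIV. al * (x$i)^2 + 2 * be * x$i * y$i + ga * (y$i)^2)"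
      by (intro sum_mono e)
    also have "\<dots> = al * (x \<bullet> x) + 2 * be * (x \<bullet> y) + ga * (y \<bullet> y)"
      by (simp add: inner_vec_def power2_eq_square sum.distrib sum_distrib_left mult_ac)
    finally show ?thesis .
  qed
  with e show ?thesis using that by blast
qed

lemma cmat_norm_sum:
  fixes v :: "(real^('p + bool))^2"
  shows "(\<Sum>i\<in>UNIV. \<Sum>j\<in>UNIV. norm (cmat v $ i $ j) ^ 2) = norm (v$1) ^ 2 + norm (v$2) ^ 2"
proof -
  have "norm x ^ 2 = (\<Sum>i\<in>UNIV. (x$i)^2)" for x :: "real^('p + bool)"
    by (simp add: norm_vec_def L2_set_def sum_nonneg)
  then show ?thesis by (simp add: cmat_def sum_2 sum.distrib)
qed

lemma heatop_exp_bound: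
  assumes "poly_mat R" "e > 0"
  obtains C where "C \<ge> 0" "\<And>v :: (real^('p + bool))^2. norm (heatop yi R (cmat v)) \<le> C * exp (e * (norm (v$1) ^ 2 + norm (v$2) ^ 2))"
proof -
  obtain d where "poly_deg d R" using poly_mat_imp_poly_deg[OF assms(1)] by blast
  then have "poly_deg d (heatop yi R)" by (rule poly_deg_heatop)
  from poly_deg_exp_bound[OF this assms(2)] obtain C where C: "C \<ge> 0" "\<And>x. norm (heatop yi R x) \<le> C * exp (e * (\<Sum>i\<in>UNIV. \<Sum>j\<in>UNIV. norm (x $ i $ j) ^ 2))"
    by blast
  show ?thesis by (rule that[OF C(1)]) (use C(2)[of "cmat _"] in \<open>simp only: cmat_norm_sum\<close>)
qed

lemma g_bounded_below:
  obtains c where "c > 0" "\<And>x. c * norm x \<le> norm (g *v x)"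
proof -
  have "inj ((*v) g)" by (rule inj_on_inverseI[of _ "(*v) gi"]) simp
  from linear_inj_bounded_below_pos[OF matrix_vector_mul_linear this] show ?thesis using that by blast
qed

definition Tlam :: "(real^('p + bool))^2 \<Rightarrow> complex" where
  "Tlam l = heatop yi P (cmat (mapv ((*v) g) l)) * ee (trq (mapv px l) \<tau> + trq (mapv nx l) (cnjmat \<tau>))"

text \<open>Half of the Gaussian rate pays for the polynomial; the remainder is compared with the
  Euclidean norm because \<open>g\<close> is bounded below.\<close>

lemma Tlam_summable: "Tlam summable_on coset2 \<sigma> L"
proof -
  obtain e where e: "e > 0" "\<And>x y :: real^('p + bool). al * (x \<bullet> x) + 2 * be * (x \<bullet> y) + ga * (y \<bullet> y) \<ge> e * (norm x ^ 2 + norm y ^ 2)"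
    using quad_lower by metis
  have "pi * e / 2 > 0" using e by simp
  then obtain C where C: "C \<ge> 0" "\<And>v. norm (heatop yi P (cmat v)) \<le> C * exp (pi * e / 2 * (norm (v$1) ^ 2 + norm (v$2) ^ 2))"
    using heatop_exp_bound[OF P_poly] by metis
  obtain c where c: "c > 0" "\<And>x. c * norm x \<le> norm (g *v x)" using g_bounded_below by metis
  have "(\<lambda>l. norm (Tlam l)) summable_on coset2 \<sigma> L"
  proof (rule Infinite_Sum.abs_summable_on_comparison_test')
    show "(\<lambda>l. C * exp (- (pi * e / 2 * c^2) * (norm (l$1) ^ 2 + norm (l$2) ^ 2))) summable_on coset2 \<sigma> L"
      using e c by (intro summable_on_cmult_right coset2_gaussian_summable L) auto
    fix l :: "(real^('p + bool))^2"
    define n where "n = norm (g *v (l$1)) ^ 2 + norm (g *v (l$2)) ^ 2"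
    have ne: "norm (ee (trq (mapv px l) \<tau> + trq (mapv nx l) (cnjmat \<tau>))) \<le> exp (- (pi * e) * n)"
    proof -
      have "norm (ee (trq (mapv px l) \<tau> + trq (mapv nx l) (cnjmat \<tau>) - of_real 0)) =
         exp (- pi * (al * ((g *v (l$1)) \<bullet> (g *v (l$1))) + 2 * be * ((g *v (l$1)) \<bullet> (g *v (l$2))) + ga * ((g *v (l$2)) \<bullet> (g *v (l$2)))))"
        using norm_ee_trq[where v=l and r=0, OF px_in nx_in] by (simp only: px_nx)
      moreover have "pi * (e * n) \<le> pi * (al * ((g *v (l$1)) \<bullet> (g *v (l$1))) + 2 * be * ((g *v (l$1)) \<bullet> (g *v (l$2))) + ga * ((g *v (l$2)) \<bullet> (g *v (l$2))))"
        unfolding n_def by (intro mult_left_mono e) auto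
      ultimately show ?thesis by simp
    qed
    have nc: "c^2 * (norm (l$1) ^ 2 + norm (l$2) ^ 2) \<le> n"
    proof -
      have "(c * norm x)^2 \<le> norm (g *v x) ^ 2" for x using c by (intro power_mono) auto
      from add_mono[OF this this, of "l$1" "l$2"] show ?thesis by (simp add: n_def power_mult_distrib distrib_left)
    qed
    have "norm (Tlam l) \<le> (C * exp (pi * e / 2 * n)) * exp (- (pi * e) * n)"
      unfolding Tlam_def norm_mult using C(2)[of "mapv ((*v) g) l"] C(1) ne
      by (intro mult_mono) (auto simp: n_def mapv_def)
    also have "\<dots> = C * exp (- (pi * e / 2 * n))" by (simp add: mult.assoc exp_add[symmetric])
    also have "\<dots> \<le> C * exp (- (pi * e / 2 * c^2) * (norm (l$1) ^ 2 + norm (l$2) ^ 2))"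
    proof -
      have "pi * e / 2 * (c^2 * (norm (l$1) ^ 2 + norm (l$2) ^ 2)) \<le> pi * e / 2 * n"
        using e by (intro mult_left_mono nc) auto
      then show ?thesis using C(1) by (intro mult_left_mono) (auto simp: mult.assoc)
    qed
    finally show "norm (Tlam l) \<le> C * exp (- (pi * e / 2 * c^2) * (norm (l$1) ^ 2 + norm (l$2) ^ 2))" .
  qed
  then show ?thesis by (rule abs_summable_summable)
qed

lemma TL_summable: "TL summable_on coset2 \<sigma>M M \<times> UNIV \<times> UNIV"
  and TL_infsum: "infsum TL (coset2 \<sigma>M M \<times> UNIV \<times> UNIV) = infsum Tlam (coset2 \<sigma> L)"
proof -
  have "TL = (\<lambda>x. Tlam (lamb x))" by (simp add: fun_eq_iff TL_def Tlam_def)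
  then show "TL summable_on coset2 \<sigma>M M \<times> UNIV \<times> UNIV" "infsum TL (coset2 \<sigma>M M \<times> UNIV \<times> UNIV) = infsum Tlam (coset2 \<sigma> L)"
    using summable_on_reindex_bij_betw[OF lamb_bij, of Tlam] infsum_reindex_bij_betw[OF lamb_bij, of Tlam] Tlam_summable by simp_all
qed

lemma vv_span_M: "k \<in> coset2 \<sigma>M M \<Longrightarrow> vv k c $ j \<in> span M"
proof -
  assume k: "k \<in> coset2 \<sigma>M M"
  have "\<mu>M \<in> span M" unfolding \<mu>M_def projV_span_M unfolding span_M perpV_def
    using uu uu' u'u' by (simp add: bf_simps bf_sym[of u' u])
  then show ?thesis using coset_span_M[OF k, of j] by (simp add: vv_def span_diff span_scale)
qed

text \<open>For x orthogonal to \<open>u\<close> the components along \<open>uzp\<close> and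
  \<open>uz\<close> removed by \<open>gw\<close> form a single multiple of \<open>u\<close>; its
  size is recovered from (x, u') = 0. Hence decay in \<open>gw x\<close> is decay in x on
  \<open>span M\<close>.\<close>

lemma span_M_recover:
  assumes "x \<in> span M"
  shows "x = gi *v gw x - bf (gi *v gw x) u' *\<^sub>R u"
proof -
  define y where "y = Wp x + Wn x"
  have x: "bf x u = 0" "bf x u' = 0" using assms by (auto simp: span_M perpV_def)
  have "bf x uz = - bf x uzp" using bf_uz_uzp[of x] x by simp
  moreover have "px x + nx x = y + (bf x uzp / N) *\<^sub>R uzp - (bf x uz / N) *\<^sub>R uz" by (simp add: y_def Wp_def Wn_def)
  ultimately have xy: "x = y + (bf x uzp / N) *\<^sub>R u" by (simp add: px_nx u_eq scaleR_add_right add.assoc)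
  have "bf y u' + bf x uzp / N = 0" using x(2) uu' by (subst (asm) xy) (simp add: bf_simps)
  then have "bf x uzp / N = - bf y u'" by simp
  then have "x = y - bf y u' *\<^sub>R u" using xy by simp
  then show ?thesis by (simp add: gw_def y_def)
qed


lemma heatop_HP_bound:
  assumes "e > 0"
  obtains C where "C \<ge> 0" "\<And>v. norm (HP h v) \<le> C * exp (e * (norm (gw (v$1)) ^ 2 + norm (gw (v$2)) ^ 2))"
proof -
  obtain C where C: "C \<ge> 0" "\<And>v :: (real^('p + bool))^2. norm (heatop yi (Psplit (fst h) (snd h)) (cmat v)) \<le> C * exp (e * (norm (v$1) ^ 2 + norm (v$2) ^ 2))"
    by (rule heatop_exp_bound[OF Psplit_poly assms, of "fst h" "snd h"]) blast
  show ?thesis by (rule that[OF C(1)]) (use C(2)[of "mapv gw _"] in \<open>simp only: HP_def mapv_def vec_lambda_beta\<close>)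
qed

definition rcd :: "int^2 \<Rightarrow> int^2 \<Rightarrow> 2 \<Rightarrow> real" where
  "rcd c d j = (\<Sum>k\<in>UNIV. of_int (c$k) * Re (\<tau>$k$j)) + of_int (d$j)"

definition nc :: "int^2 \<Rightarrow> real" where
  "nc c = of_int (c$1)^2 + of_int (c$2)^2"

definition nr :: "int^2 \<Rightarrow> int^2 \<Rightarrow> real" where
  "nr c d = rcd c d 1 ^ 2 + rcd c d 2 ^ 2"

lemma Re_ctbd: "Re (ctbd c d j) = rcd c d j"
  by (simp add: ctbd_def rcd_def)

lemma Im_ctbd: "Im (ctbd c d 1) = - (of_int (c$1) * al + of_int (c$2) * be)" "Im (ctbd c d 2) = - (of_int (c$1) * be + of_int (c$2) * ga)"
  by (simp_all add: ctbd_def sum_2 \<tau>_sym al_def be_def ga_def)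

lemma ctd_cnj: "ctd c d j = cnj (ctbd c d j)"
  by (simp add: ctd_def ctbd_def)

text \<open>With \<tau> = x + i y, the exponent is the inverse form at c x + d plus the form y at c,
  so it decays in both rows.\<close>

lemma norm_Gcd:
  "norm (Gcd c d) = exp (- (pi / (2 * N)) * ((ga * rcd c d 1^2 - 2 * be * rcd c d 1 * rcd c d 2 + al * rcd c d 2^2) / D
     + (al * of_int (c$1)^2 + 2 * be * of_int (c$1) * of_int (c$2) + ga * of_int (c$2)^2)))"
proof -
  define r1 r2 s1 s2 where "r1 = rcd c d 1" and "r2 = rcd c d 2" and "s1 = of_int (c$1) * al + of_int (c$2) * be" and "s2 = of_int (c$1) * be + of_int (c$2) * ga"
  have "Re (\<Sum>j\<in>UNIV. \<Sum>k\<in>UNIV. ctd c d j * ctbd c d k * complex_of_real (yi$k$j))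
     = ((ga * r1^2 - 2 * be * r1 * r2 + al * r2^2) + (ga * s1^2 - 2 * be * s1 * s2 + al * s2^2)) / D"
    unfolding ctd_cnj sum_2 yi_entries
    by (simp add: Re_ctbd Im_ctbd r1_def[symmetric] r2_def[symmetric] s1_def[symmetric] s2_def[symmetric])
      (simp add: power2_eq_square add_divide_distrib diff_divide_distrib algebra_simps)
  also have "ga * s1^2 - 2 * be * s1 * s2 + al * s2^2 = D * (al * of_int (c$1)^2 + 2 * be * of_int (c$1) * of_int (c$2) + ga * of_int (c$2)^2)"
    using adjugate_quadratic_form[of ga al "of_int (c$1)" be "of_int (c$2)"] unfolding s1_def s2_def D_def by (simp add: mult.commute)
  finally have e: "Re (\<Sum>j\<in>UNIV. \<Sum>k\<in>UNIV. ctd c d j * ctbd c d k * complex_of_real (yi$k$j))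
     = (ga * r1^2 - 2 * be * r1 * r2 + al * r2^2) / D + (al * of_int (c$1)^2 + 2 * be * of_int (c$1) * of_int (c$2) + ga * of_int (c$2)^2)"
    using D_pos by (simp add: add_divide_distrib)
  have re: "Re (- complex_of_real (pi / (2 * N)) * x) = - (pi / (2 * N)) * Re x" for x by simp
  show ?thesis unfolding Gcd_def norm_exp_eq_Re re e r1_def r2_def ..
qed

lemma Acd_bound:
  obtains K where "K \<ge> 0" "\<And>c d l. norm (Acd c d l) \<le> K * (\<bar>rcd c d 1\<bar> + \<bar>rcd c d 2\<bar> + \<bar>of_int (c$1)\<bar> + \<bar>of_int (c$2)\<bar>)"
proof -
  define Y where "Y = (\<Sum>k\<in>UNIV. \<Sum>l\<in>UNIV. \<bar>yi$k$l\<bar>)"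
  define K0 where "K0 = 1 + \<bar>al\<bar> + \<bar>be\<bar> + \<bar>ga\<bar>"
  have Y: "Y \<ge> 0" unfolding Y_def by (intro sum_nonneg) auto
  have K0: "K0 \<ge> 1" by (simp add: K0_def)
  have "norm (Acd c d l) \<le> (Y * K0) * (\<bar>rcd c d 1\<bar> + \<bar>rcd c d 2\<bar> + \<bar>of_int (c$1)\<bar> + \<bar>of_int (c$2)\<bar>)" for c d l
  proof -
    define S where "S = \<bar>rcd c d 1\<bar> + \<bar>rcd c d 2\<bar> + \<bar>real_of_int (c$1)\<bar> + \<bar>of_int (c$2)\<bar>"
    have im: "\<bar>of_int (c$1) * p + of_int (c$2) * q\<bar> \<le> (\<bar>p\<bar> + \<bar>q\<bar>) * (\<bar>of_int (c$1)\<bar> + \<bar>of_int (c$2)\<bar>)" for p q :: real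
    proof -
      have "\<bar>of_int (c$1) * p + of_int (c$2) * q\<bar> \<le> \<bar>of_int (c$1)\<bar> * \<bar>p\<bar> + \<bar>of_int (c$2)\<bar> * \<bar>q\<bar>"
        by (metis abs_mult abs_triangle_ineq)
      also have "\<dots> \<le> (\<bar>p\<bar> + \<bar>q\<bar>) * (\<bar>of_int (c$1)\<bar> + \<bar>of_int (c$2)\<bar>)"
        by (simp add: algebra_simps)
      finally show ?thesis .
    qed
    have n: "norm (ctbd c d k) \<le> K0 * S" for k
    proof -
      have "norm (ctbd c d k) \<le> \<bar>rcd c d k\<bar> + \<bar>Im (ctbd c d k)\<bar>" using cmod_le[of "ctbd c d k"] by (simp add: Re_ctbd)
      also have "\<bar>Im (ctbd c d k)\<bar> \<le> (\<bar>al\<bar> + \<bar>be\<bar> + \<bar>ga\<bar>) * (\<bar>of_int (c$1)\<bar> + \<bar>of_int (c$2)\<bar>)"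
      proof -
        consider "k = 1" | "k = 2" using exhaust_2 by blast
        then show ?thesis
        proof cases
          case 1
          have "\<bar>Im (ctbd c d k)\<bar> \<le> (\<bar>al\<bar> + \<bar>be\<bar>) * (\<bar>of_int (c$1)\<bar> + \<bar>of_int (c$2)\<bar>)" using im[of al be] by (simp only: 1 Im_ctbd abs_minus_cancel)
          also have "\<dots> \<le> (\<bar>al\<bar> + \<bar>be\<bar> + \<bar>ga\<bar>) * (\<bar>of_int (c$1)\<bar> + \<bar>of_int (c$2)\<bar>)" by (intro mult_right_mono) auto
          finally show ?thesis .
        next
          case 2
          have "\<bar>Im (ctbd c d k)\<bar> \<le> (\<bar>be\<bar> + \<bar>ga\<bar>) * (\<bar>of_int (c$1)\<bar> + \<bar>of_int (c$2)\<bar>)" using im[of be ga] by (simp only: 2 Im_ctbd abs_minus_cancel)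
          also have "\<dots> \<le> (\<bar>al\<bar> + \<bar>be\<bar> + \<bar>ga\<bar>) * (\<bar>of_int (c$1)\<bar> + \<bar>of_int (c$2)\<bar>)" by (intro mult_right_mono) auto
          finally show ?thesis .
        qed
      qed
      also have "\<bar>rcd c d k\<bar> + (\<bar>al\<bar> + \<bar>be\<bar> + \<bar>ga\<bar>) * (\<bar>of_int (c$1)\<bar> + \<bar>of_int (c$2)\<bar>) \<le> S + (\<bar>al\<bar> + \<bar>be\<bar> + \<bar>ga\<bar>) * S"
      proof (intro add_mono mult_left_mono)
        show "\<bar>rcd c d k\<bar> \<le> S" using exhaust_2[of k] by (auto simp: S_def)
      qed (auto simp: S_def)
      also have "\<dots> = K0 * S" by (simp add: K0_def algebra_simps)
      finally show ?thesis by simp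
    qed
    have "norm (Acd c d l) \<le> (\<Sum>k\<in>UNIV. norm (ctbd c d k) * \<bar>yi$k$l\<bar>)"
      unfolding Acd_def by (rule order_trans[OF norm_sum]) (simp add: norm_mult)
    also have "\<dots> \<le> (\<Sum>k\<in>UNIV. (K0 * S) * \<bar>yi$k$l\<bar>)" by (intro sum_mono mult_right_mono n) auto
    also have "\<dots> = (K0 * S) * (\<Sum>k\<in>UNIV. \<bar>yi$k$l\<bar>)" by (simp add: sum_distrib_left)
    also have "\<dots> \<le> (K0 * S) * Y"
    proof (rule mult_left_mono)
      show "(\<Sum>k\<in>UNIV. \<bar>yi$k$l\<bar>) \<le> Y" unfolding Y_def by (intro sum_mono member_le_sum) auto
      show "0 \<le> K0 * S" using K0 by (simp add: S_def)
    qed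
    finally show ?thesis by (simp add: S_def mult_ac)
  qed
  moreover have "Y * K0 \<ge> 0" using Y K0 by simp
  ultimately show ?thesis using that by blast
qed

lemma Acd_power_bound:
  assumes "e > 0"
  obtains C where "C \<ge> 0" "\<And>c d l. norm (Acd c d l) ^ n \<le> C * exp (e * (nr c d + nc c))"
proof -
  obtain K where K: "K \<ge> 0" "\<And>c d l. norm (Acd c d l) \<le> K * (\<bar>rcd c d 1\<bar> + \<bar>rcd c d 2\<bar> + \<bar>of_int (c$1)\<bar> + \<bar>of_int (c$2)\<bar>)"
    using Acd_bound by blast
  have "e / 4 > 0" using assms by simp
  then obtain C where C: "C \<ge> 0" "\<And>x. x \<ge> 0 \<Longrightarrow> x ^ n \<le> C * exp (e / 4 * x^2)" using power_exp_square_bound[of "e/4" n] by blast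
  have "norm (Acd c d l) ^ n \<le> (K ^ n * C) * exp (e * (nr c d + nc c))" for c d l
  proof -
    define S where "S = \<bar>rcd c d 1\<bar> + \<bar>rcd c d 2\<bar> + \<bar>real_of_int (c$1)\<bar> + \<bar>of_int (c$2)\<bar>"
    have S0: "S \<ge> 0" by (simp add: S_def)
    have sq: "(p + q + r + s)^2 \<le> 4 * (p^2 + q^2 + r^2 + s^2)" for p q r s :: real
      using zero_le_power2[of "p - q"] zero_le_power2[of "p - r"] zero_le_power2[of "p - s"] zero_le_power2[of "q - r"] zero_le_power2[of "q - s"] zero_le_power2[of "r - s"]
      by (simp add: power2_eq_square algebra_simps)
    have S2: "S^2 \<le> 4 * (nr c d + nc c)" using sq[of "\<bar>rcd c d 1\<bar>" "\<bar>rcd c d 2\<bar>" "\<bar>real_of_int (c$1)\<bar>" "\<bar>of_int (c$2)\<bar>"]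
      by (simp add: S_def nr_def nc_def)
    have "norm (Acd c d l) ^ n \<le> (K * S) ^ n" using K(2)[of c d l] by (intro power_mono) (auto simp: S_def)
    also have "\<dots> = K ^ n * S ^ n" by (rule power_mult_distrib)
    also have "\<dots> \<le> K ^ n * (C * exp (e / 4 * S^2))" using K C(2)[OF S0] by (intro mult_left_mono) auto
    also have "\<dots> \<le> K ^ n * (C * exp (e * (nr c d + nc c)))"
    proof -
      have "e / 4 * S^2 \<le> e / 4 * (4 * (nr c d + nc c))" using assms S2 by (intro mult_left_mono) auto
      then have "e / 4 * S^2 \<le> e * (nr c d + nc c)" by (simp add: algebra_simps)
      then show ?thesis using K(1) C(1) by (intro mult_left_mono) auto
    qed
    finally show ?thesis by simp
  qed
  moreover have "K ^ n * C \<ge> 0" using K C by simp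
  ultimately show ?thesis using that by blast
qed

text \<open>The change from (k, c, d) to the quantities in which decay is known is triangular: c is
  kept, d differs from \<open>rcd\<close> by a linear function of c, and k differs from
  \<open>vv\<close> by c times \<open>\<mu>M\<close>.\<close>

lemma recover_bound:
  obtains K where "K > 0" "\<And>k c d. k \<in> coset2 \<sigma>M M \<Longrightarrow>
    norm (k$1)^2 + norm (k$2)^2 + nc c + nc d \<le> K * (norm (gw (vv k c $ 1))^2 + norm (gw (vv k c $ 2))^2 + nr c d + nc c)"
proof -
  have lin: "linear (\<lambda>x. gi *v x - bf (gi *v x) u' *\<^sub>R u)"
    by (rule linearI) (simp_all add: matrix_vector_right_distrib matrix_vector_mult_scaleR bf_simps algebra_simps)
  obtain B where B: "B > 0" "\<And>x. norm (gi *v x - bf (gi *v x) u' *\<^sub>R u) \<le> B * norm x"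
    using linear_bounded_pos[OF lin] by blast
  have two: "(a + b)^2 \<le> 2 * a^2 + 2 * b^2" for a b :: real
    using zero_le_power2[of "a - b"] by (simp add: power2_eq_square algebra_simps)
  define m0 where "m0 = norm \<mu>M"
  define t0 where "t0 = \<bar>Re (\<tau>$1$1)\<bar> + \<bar>Re (\<tau>$1$2)\<bar> + \<bar>Re (\<tau>$2$2)\<bar>"
  have kb: "norm (k$j)^2 \<le> 2 * B^2 * norm (gw (vv k c $ j))^2 + 2 * m0^2 * of_int (c$j)^2" if "k \<in> coset2 \<sigma>M M" for k c j
  proof -
    have "norm (vv k c $ j) \<le> B * norm (gw (vv k c $ j))"
      using span_M_recover[OF vv_span_M[OF that, of c j]] B(2)[of "gw (vv k c $ j)"] by simp
    moreover have "norm (k$j) \<le> norm (vv k c $ j) + m0 * \<bar>of_int (c$j)\<bar>"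
    proof -
      have "k$j = vv k c $ j + of_int (c$j) *\<^sub>R \<mu>M" by (simp add: vv_def)
      then show ?thesis using norm_triangle_ineq[of "vv k c $ j" "of_int (c$j) *\<^sub>R \<mu>M"] by (simp add: m0_def mult.commute)
    qed
    ultimately have "norm (k$j) \<le> B * norm (gw (vv k c $ j)) + m0 * \<bar>of_int (c$j)\<bar>" by linarith
    then have "norm (k$j)^2 \<le> (B * norm (gw (vv k c $ j)) + m0 * \<bar>of_int (c$j)\<bar>)^2" by (intro power_mono) auto
    also have "\<dots> \<le> 2 * (B * norm (gw (vv k c $ j)))^2 + 2 * (m0 * \<bar>of_int (c$j)\<bar>)^2" by (rule two)
    finally show ?thesis by (simp add: power_mult_distrib)
  qed
  have db: "of_int (d$j)^2 \<le> 2 * rcd c d j ^ 2 + 4 * t0^2 * nc c" for c d and j :: 2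
  proof -
    define q where "q = (\<Sum>k\<in>UNIV. of_int (c$k) * Re (\<tau>$k$j))"
    have t: "\<bar>Re (\<tau>$k$j)\<bar> \<le> t0" for k using exhaust_2[of k] exhaust_2[of j] by (auto simp: t0_def \<tau>_sym)
    have "\<bar>q\<bar> \<le> (\<Sum>k\<in>UNIV. \<bar>of_int (c$k)\<bar> * \<bar>Re (\<tau>$k$j)\<bar>)" unfolding q_def by (rule order_trans[OF sum_abs]) (simp add: abs_mult)
    also have "\<dots> \<le> (\<Sum>k\<in>UNIV. \<bar>of_int (c$k)\<bar> * t0)" by (intro sum_mono mult_left_mono t) auto
    finally have "\<bar>q\<bar> \<le> (\<bar>of_int (c$1)\<bar> + \<bar>of_int (c$2)\<bar>) * t0" by (simp add: sum_2 distrib_right)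
    then have "\<bar>q\<bar>^2 \<le> ((\<bar>of_int (c$1)\<bar> + \<bar>of_int (c$2)\<bar>) * t0)^2" by (intro power_mono) auto
    also have "\<dots> \<le> (2 * nc c) * t0^2"
      unfolding power_mult_distrib using two[of "\<bar>real_of_int (c$1)\<bar>" "\<bar>of_int (c$2)\<bar>"] by (intro mult_right_mono) (auto simp: nc_def)
    finally have q: "q^2 \<le> 2 * nc c * t0^2" by simp
    have "of_int (d$j) = rcd c d j + (- q)" by (simp add: rcd_def q_def)
    then have "of_int (d$j)^2 \<le> 2 * rcd c d j ^ 2 + 2 * (- q)^2" using two[of "rcd c d j" "- q"] by simp
    then show ?thesis using q by (simp add: mult_ac)
  qed
  \<comment> \<open>Simply the sum of all coefficients from \<open>kb\<close> and \<open>db\<close>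
    with some room, so that the difference of the two sides is visibly nonnegative.\<close>
  define K where "K = 2 * B^2 + 2 * m0^2 + 8 * t0^2 + 3"
  show ?thesis
  proof (rule that)
    show "K > 0" unfolding K_def by (intro add_nonneg_pos add_nonneg_nonneg) auto
    fix k c d assume k: "k \<in> coset2 \<sigma>M M"
    define x where "x = norm (gw (vv k c $ 1))^2 + norm (gw (vv k c $ 2))^2"
    have nn: "x \<ge> 0" "nr c d \<ge> 0" "nc c \<ge> 0" by (simp_all add: x_def nr_def nc_def)
    have 1: "norm (k$1)^2 + norm (k$2)^2 \<le> 2 * B^2 * x + 2 * m0^2 * nc c"
      using kb[OF k, of 1 c] kb[OF k, of 2 c] by (simp add: x_def nc_def distrib_left)
    have 2: "nc d \<le> 2 * nr c d + 8 * t0^2 * nc c"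
      using add_mono[OF db[of d 1 c] db[of d 2 c]] unfolding nc_def[of d] nr_def by (simp add: algebra_simps)
    have nB: "B^2 \<ge> 0" "m0^2 \<ge> 0" "t0^2 \<ge> 0" by auto
    have "K * (x + nr c d + nc c) = (2 * B^2 * x + 2 * m0^2 * nc c) + (2 * nr c d + 8 * t0^2 * nc c) + nc c
      + (B^2 * (2 * nr c d + 2 * nc c) + m0^2 * (2 * x + 2 * nr c d) + t0^2 * (8 * x + 8 * nr c d) + 3 * x + nr c d + 2 * nc c)"
      by (simp add: K_def algebra_simps)
    moreover have "0 \<le> B^2 * (2 * nr c d + 2 * nc c) + m0^2 * (2 * x + 2 * nr c d) + t0^2 * (8 * x + 8 * nr c d) + 3 * x + nr c d + 2 * nc c"
      using nn nB by (intro add_nonneg_nonneg mult_nonneg_nonneg) auto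
    ultimately show "norm (k$1)^2 + norm (k$2)^2 + nc c + nc d \<le> K * (norm (gw (vv k c $ 1))^2 + norm (gw (vv k c $ 2))^2 + nr c d + nc c)"
      unfolding x_def[symmetric] using 1 2 by linarith
  qed
qed

end

context theta_setting
begin

lemma term_bound:
  obtains C e where "C \<ge> 0" "e > 0" "\<And>k c d. k \<in> coset2 \<sigma>M M \<Longrightarrow>
    norm (coef h c d * tM h c d k) \<le> C * exp (- e * (norm (k$1)^2 + norm (k$2)^2 + nc c + nc d))"
proof -
  obtain e1 where e1: "e1 > 0" "\<And>x y :: real^('p + bool). al * (x \<bullet> x) + 2 * be * (x \<bullet> y) + ga * (y \<bullet> y) \<ge> e1 * (norm x ^ 2 + norm y ^ 2)"
    "\<And>x y. al * x^2 + 2 * be * x * y + ga * y^2 \<ge> e1 * (x^2 + y^2)"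
    by (rule quad_lower) blast
  obtain e2 where e2: "e2 > 0" "\<And>x y. ga * x^2 + 2 * (- be) * x * y + al * y^2 \<ge> e2 * (x^2 + y^2)"
    using quadratic_form_lower_bound[of al ga "- be"] al_pos D_pos by (auto simp: D_def mult.commute)
  define f where "f = pi / (2 * N)"
  have f: "f > 0" using N_pos by (simp add: f_def)
  \<comment> \<open>A common decay rate. One quarter of it is spent on each power of
    \<open>Acd\<close> and one half on the heat polynomial, so half survives in both groups of
    variables.\<close>
  define \<delta> where "\<delta> = Min {pi * e1, f * e1, f * (e2 / D)}"
  have \<delta>: "\<delta> > 0" "\<delta> \<le> pi * e1" "\<delta> \<le> f * e1" "\<delta> \<le> f * (e2 / D)" using e1 e2 f D_pos by (auto simp: \<delta>_def)
  have d4: "\<delta> / 4 > 0" "\<delta> / 2 > 0" using \<delta> by auto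
  obtain C1 where C1: "C1 \<ge> 0" "\<And>c d l. norm (Acd c d l) ^ fst h \<le> C1 * exp (\<delta> / 4 * (nr c d + nc c))"
    by (rule Acd_power_bound[OF d4(1), of "fst h"]) blast
  obtain C2 where C2: "C2 \<ge> 0" "\<And>c d l. norm (Acd c d l) ^ snd h \<le> C2 * exp (\<delta> / 4 * (nr c d + nc c))"
    by (rule Acd_power_bound[OF d4(1), of "snd h"]) blast
  obtain C3 where C3: "C3 \<ge> 0" "\<And>v. norm (HP h v) \<le> C3 * exp (\<delta> / 2 * (norm (gw (v$1)) ^ 2 + norm (gw (v$2)) ^ 2))"
    by (rule heatop_HP_bound[OF d4(2), of h]) blast
  obtain K where K: "K > 0" "\<And>k c d. k \<in> coset2 \<sigma>M M \<Longrightarrow>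
    norm (k$1)^2 + norm (k$2)^2 + nc c + nc d \<le> K * (norm (gw (vv k c $ 1))^2 + norm (gw (vv k c $ 2))^2 + nr c d + nc c)"
    by (rule recover_bound) blast
  have bound: "norm (coef h c d * tM h c d k) \<le> (C1 * C2 * C3) * exp (- (\<delta> / 2 / K) * (norm (k$1)^2 + norm (k$2)^2 + nc c + nc d))"
    if k: "k \<in> coset2 \<sigma>M M" for k c d
  proof -
    define x where "x = norm (gw (vv k c $ 1))^2 + norm (gw (vv k c $ 2))^2"
    define y where "y = nr c d + nc c"
    have nn: "nr c d \<ge> 0" "nc c \<ge> 0" "x \<ge> 0" by (simp_all add: nr_def nc_def x_def)
    have G: "norm (Gcd c d) \<le> exp (- \<delta> * y)"
    proof -
      have "e2 / D * nr c d \<le> (ga * rcd c d 1^2 - 2 * be * rcd c d 1 * rcd c d 2 + al * rcd c d 2^2) / D"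
        using divide_right_mono[OF e2(2)[of "rcd c d 1" "rcd c d 2"], of D] D_pos by (simp add: nr_def)
      moreover have "e1 * nc c \<le> al * of_int (c$1)^2 + 2 * be * of_int (c$1) * of_int (c$2) + ga * of_int (c$2)^2"
        unfolding nc_def by (rule e1(3))
      ultimately have "f * (e2 / D * nr c d + e1 * nc c) \<le> f * ((ga * rcd c d 1^2 - 2 * be * rcd c d 1 * rcd c d 2 + al * rcd c d 2^2) / D
         + (al * of_int (c$1)^2 + 2 * be * of_int (c$1) * of_int (c$2) + ga * of_int (c$2)^2))"
        using f by (intro mult_left_mono add_mono) auto
      moreover have "\<delta> * nr c d + \<delta> * nc c \<le> (f * (e2 / D)) * nr c d + (f * e1) * nc c"
        using \<delta> nn by (intro add_mono mult_right_mono) auto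
      moreover have "(f * (e2 / D)) * nr c d + (f * e1) * nc c = f * (e2 / D * nr c d + e1 * nc c)"
        by (simp only: distrib_left mult.assoc)
      ultimately have "\<delta> * y \<le> f * ((ga * rcd c d 1^2 - 2 * be * rcd c d 1 * rcd c d 2 + al * rcd c d 2^2) / D
         + (al * of_int (c$1)^2 + 2 * be * of_int (c$1) * of_int (c$2) + ga * of_int (c$2)^2))"
        unfolding y_def distrib_left[of \<delta>] by linarith
      then show ?thesis unfolding norm_Gcd f_def[symmetric] exp_le_cancel_iff by simp
    qed
    have E: "norm (ee (Ew (vv k c) - complex_of_real r)) \<le> exp (- \<delta> * x)" for r
    proof -
      have W: "Wp x \<in> perpV z" "Wn x \<in> z" for x using Wp_in[of x] Wn_in[of x] by (auto simp: wp_def w_def)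
      have eq: "norm (ee (Ew (vv k c) - complex_of_real r)) = exp (- pi * (al * (gw (vv k c $ 1) \<bullet> gw (vv k c $ 1)) + 2 * be * (gw (vv k c $ 1) \<bullet> gw (vv k c $ 2)) + ga * (gw (vv k c $ 2) \<bullet> gw (vv k c $ 2))))"
        unfolding Ew_def gw_def by (rule norm_ee_trq[OF W])
      have "pi * (e1 * x) \<le> pi * (al * (gw (vv k c $ 1) \<bullet> gw (vv k c $ 1)) + 2 * be * (gw (vv k c $ 1) \<bullet> gw (vv k c $ 2)) + ga * (gw (vv k c $ 2) \<bullet> gw (vv k c $ 2)))"
        unfolding x_def by (intro mult_left_mono e1) auto
      moreover have "\<delta> * x \<le> pi * (e1 * x)" unfolding mult.assoc[symmetric] using \<delta> nn by (intro mult_right_mono) auto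
      ultimately show ?thesis unfolding eq exp_le_cancel_iff mult_minus_left neg_le_iff_le by (rule order_trans[rotated])
    qed
    have "norm (coef h c d) = norm (Gcd c d) * (norm (Acd c d 1) ^ fst h * norm (Acd c d 2) ^ snd h) / 2 ^ (fst h + snd h)"
      by (simp add: coef_def norm_mult norm_divide norm_power)
    also have "\<dots> \<le> norm (Gcd c d) * (norm (Acd c d 1) ^ fst h * norm (Acd c d 2) ^ snd h) / 1"
      by (intro divide_left_mono) auto
    also have "\<dots> \<le> exp (- \<delta> * y) * ((C1 * exp (\<delta> / 4 * y)) * (C2 * exp (\<delta> / 4 * y)))"
      using G C1(2)[of c d 1] C2(2)[of c d 2] C1(1) C2(1) by (auto simp: y_def[symmetric] intro!: mult_mono)
    also have "\<dots> = (C1 * C2) * exp (- \<delta> * y + \<delta> / 4 * y + \<delta> / 4 * y)" by (simp only: exp_add) (simp only: mult_ac)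
    also have "- \<delta> * y + \<delta> / 4 * y + \<delta> / 4 * y = - (\<delta> / 2) * y" by simp
    finally have c: "norm (coef h c d) \<le> (C1 * C2) * exp (- (\<delta> / 2) * y)" .
    have "norm (tM h c d k) \<le> (C3 * exp (\<delta> / 2 * x)) * exp (- \<delta> * x)"
      unfolding tM_def norm_mult vv_eq[symmetric] using C3(2)[of "vv k c"] C3(1) E by (intro mult_mono) (auto simp: x_def)
    also have "\<dots> = C3 * exp (\<delta> / 2 * x + - \<delta> * x)" by (simp only: exp_add mult.assoc)
    also have "\<delta> / 2 * x + - \<delta> * x = - (\<delta> / 2) * x" by simp
    finally have t: "norm (tM h c d k) \<le> C3 * exp (- (\<delta> / 2) * x)" .
    have "norm (coef h c d * tM h c d k) \<le> ((C1 * C2) * exp (- (\<delta> / 2) * y)) * (C3 * exp (- (\<delta> / 2) * x))"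
      unfolding norm_mult using c t C1(1) C2(1) by (intro mult_mono) auto
    also have "\<dots> = (C1 * C2 * C3) * exp (- (\<delta> / 2) * y + - (\<delta> / 2) * x)" by (simp only: exp_add) (simp only: mult_ac)
    also have "\<dots> \<le> (C1 * C2 * C3) * exp (- (\<delta> / 2 / K) * (norm (k$1)^2 + norm (k$2)^2 + nc c + nc d))"
    proof (intro mult_left_mono)
      have "(\<delta> / 2 / K) * (norm (k$1)^2 + norm (k$2)^2 + nc c + nc d) \<le> (\<delta> / 2 / K) * (K * (x + nr c d + nc c))"
        unfolding x_def using K(2)[OF k] \<delta> K(1) by (intro mult_left_mono) auto
      also have "\<dots> = (\<delta> / 2) * (x + y)" using K(1) by (simp add: y_def add.assoc)
      finally show "exp (- (\<delta> / 2) * y + - (\<delta> / 2) * x) \<le> exp (- (\<delta> / 2 / K) * (norm (k$1)^2 + norm (k$2)^2 + nc c + nc d))"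
        unfolding exp_le_cancel_iff by (simp add: distrib_left)
      show "0 \<le> C1 * C2 * C3" using C1(1) C2(1) C3(1) by simp
    qed
    finally show ?thesis .
  qed
  show ?thesis by (rule that[OF _ _ bound]) (use C1(1) C2(1) C3(1) \<delta> K(1) in auto)
qed

lemma M_subset_L: "M \<subseteq> L"
  using M_iff by blast

text \<open>Joint summability in (k, c, d) is what permits summing over k first, after the Poisson
  step has been carried out with k fixed.\<close>

lemma term_summable: "(\<lambda>(k, c, d). coef h c d * tM h c d k) summable_on coset2 \<sigma>M M \<times> UNIV \<times> UNIV"
proof -
  obtain C e where Ce: "C \<ge> 0" "e > 0" "\<And>k c d. k \<in> coset2 \<sigma>M M \<Longrightarrow>
    norm (coef h c d * tM h c d k) \<le> C * exp (- e * (norm (k$1)^2 + norm (k$2)^2 + nc c + nc d))"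
    by (rule term_bound) blast
  have nc: "(\<lambda>c. exp (- e * nc c)) summable_on UNIV"
    using int_vec_gaussian_summable[OF Ce(2), where 'n=2] by (simp add: nc_def sum_2)
  have "coset2 \<sigma>M M \<subseteq> coset2 \<sigma>M L" using M_subset_L by (auto simp: coset2_def)
  then have k: "(\<lambda>k. exp (- e * (norm (k$1)^2 + norm (k$2)^2))) summable_on coset2 \<sigma>M M"
    by (rule summable_on_subset_banach[OF coset2_gaussian_summable[OF L Ce(2)]])
  have "(\<lambda>(c, d). exp (- e * nc c) * exp (- e * nc d)) summable_on UNIV \<times> UNIV"
    by (rule summable_on_Times_mult[OF nc nc]) auto
  then have "(\<lambda>(k, cd). exp (- e * (norm (k$1)^2 + norm (k$2)^2)) * (case cd of (c, d) \<Rightarrow> exp (- e * nc c) * exp (- e * nc d))) summable_on coset2 \<sigma>M M \<times> (UNIV \<times> UNIV)"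
    by (rule summable_on_Times_mult[OF k]) auto
  then have s: "(\<lambda>x. C * (case x of (k, cd) \<Rightarrow> exp (- e * (norm (k$1)^2 + norm (k$2)^2)) * (case cd of (c, d) \<Rightarrow> exp (- e * nc c) * exp (- e * nc d)))) summable_on coset2 \<sigma>M M \<times> UNIV \<times> UNIV"
    by (rule summable_on_cmult_right)
  have "(\<lambda>x. norm (case x of (k, c, d) \<Rightarrow> coef h c d * tM h c d k)) summable_on coset2 \<sigma>M M \<times> UNIV \<times> UNIV"
  proof (rule Infinite_Sum.abs_summable_on_comparison_test'[OF s])
    fix x :: "((real^('p + bool))^2) \<times> (int^2) \<times> (int^2)"
    assume "x \<in> coset2 \<sigma>M M \<times> UNIV \<times> UNIV"
    then obtain k c d where x: "x = (k, c, d)" "k \<in> coset2 \<sigma>M M" by auto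
    have "exp (- e * (norm (k$1)^2 + norm (k$2)^2)) * (exp (- e * nc c) * exp (- e * nc d)) = exp (- e * (norm (k$1)^2 + norm (k$2)^2 + nc c + nc d))"
      unfolding exp_add[symmetric] by (simp add: algebra_simps)
    then show "norm (case x of (k, c, d) \<Rightarrow> coef h c d * tM h c d k) \<le> C * (case x of (k, cd) \<Rightarrow> exp (- e * (norm (k$1)^2 + norm (k$2)^2)) * (case cd of (c, d) \<Rightarrow> exp (- e * nc c) * exp (- e * nc d)))"
      using Ce(3)[OF x(2), of c d] unfolding x(1) prod.case by simp
  qed
  then show ?thesis by (rule abs_summable_summable)
qed

section \<open>Assembly\<close>

lemma theta_splitting:
  "of_real D * infsum Tlam (coset2 \<sigma> L) = of_real (1 / (2 * N)) *
     (\<Sum>\<^sub>\<infinity>(c, d). \<Sum>h1\<le>m. \<Sum>h2\<le>m. coef (h1, h2) c d * (of_real (sqrt D) * (\<Sum>\<^sub>\<infinity>k\<in>coset2 \<sigma>M M. tM (h1, h2) c d k)))"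
proof -
  let ?I = "coset2 \<sigma>M M" and ?H = "{..m} \<times> {..m}"
  define \<kappa> where "\<kappa> = complex_of_real (1 / (2 * N * sqrt D))"
  define V where "V = (\<lambda>k (c, d). \<Sum>h\<in>?H. coef h c d * tM h c d k)"
  have Vsum: "(\<lambda>(k, cd). V k cd) summable_on ?I \<times> (UNIV \<times> UNIV)"
  proof -
    have "(\<lambda>x. \<Sum>h\<in>?H. (case x of (k, c, d) \<Rightarrow> coef h c d * tM h c d k)) summable_on ?I \<times> UNIV \<times> UNIV"
      by (rule infsum_finite_sum(2), simp, rule term_summable)
    then show ?thesis by (simp add: V_def case_prod_unfold)
  qed
  have dsum: "(\<lambda>d. coef h c d * tM h c d k) summable_on UNIV" if "k \<in> ?I" for h k c
  proof -
    have "(\<lambda>(c, d). coef h c d * tM h c d k) summable_on UNIV \<times> UNIV"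
      using summable_on_SigmaD1[of "\<lambda>k (c, d). coef h c d * tM h c d k" ?I "\<lambda>_. UNIV \<times> UNIV" k] term_summable[of h] that
      by (simp add: case_prod_unfold)
    from summable_on_SigmaD1[OF this, of c] show ?thesis by simp
  qed
  have ksum: "(\<lambda>k. coef h c d * tM h c d k) summable_on ?I" for h c d
  proof -
    have "(\<lambda>(cd, k). case cd of (c, d) \<Rightarrow> coef h c d * tM h c d k) summable_on (UNIV \<times> UNIV) \<times> ?I"
      using term_summable[of h] by (subst (asm) summable_on_swap) (simp add: case_prod_unfold)
    from summable_on_SigmaD1[OF this, of "(c, d)"] show ?thesis by simp
  qed
  have "infsum Tlam (coset2 \<sigma> L) = infsum TL (?I \<times> (UNIV \<times> UNIV))" using TL_infsum by simp
  also have "\<dots> = (\<Sum>\<^sub>\<infinity>k\<in>?I. \<Sum>\<^sub>\<infinity>ca\<in>UNIV \<times> UNIV. TL (k, ca))"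
    using infsum_Sigma_banach[of TL ?I "\<lambda>_. UNIV \<times> UNIV"] TL_summable by simp
  also have "\<dots> = (\<Sum>\<^sub>\<infinity>k\<in>?I. \<kappa> * (\<Sum>\<^sub>\<infinity>cd\<in>UNIV \<times> UNIV. V k cd))"
  proof (rule infsum_cong)
    fix k assume k: "k \<in> ?I"
    have s: "(\<lambda>ca. TL (k, ca)) summable_on UNIV \<times> UNIV"
      using summable_on_SigmaD1[of "\<lambda>k ca. TL (k, ca)" ?I "\<lambda>_. UNIV \<times> UNIV" k] TL_summable k by simp
    have sV: "V k summable_on UNIV \<times> UNIV"
      using summable_on_SigmaD1[of V ?I "\<lambda>_. UNIV \<times> UNIV" k] Vsum k by simp
    have "(\<Sum>\<^sub>\<infinity>ca\<in>UNIV \<times> UNIV. TL (k, ca)) = (\<Sum>\<^sub>\<infinity>c. \<Sum>\<^sub>\<infinity>a. TL (k, c, a))"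
      using infsum_Sigma_banach[OF s] by simp
    also have "\<dots> = (\<Sum>\<^sub>\<infinity>c. \<kappa> * (\<Sum>\<^sub>\<infinity>d. V k (c, d)))"
      unfolding sum_a_TL[OF k] V_def prod.case \<kappa>_def using dsum[OF k]
      by (subst infsum_finite_sum(1)) auto
    also have "\<dots> = \<kappa> * (\<Sum>\<^sub>\<infinity>cd\<in>UNIV \<times> UNIV. V k cd)"
      unfolding infsum_cmult_right' using infsum_Sigma_banach[OF sV] by simp
    finally show "(\<Sum>\<^sub>\<infinity>ca\<in>UNIV \<times> UNIV. TL (k, ca)) = \<kappa> * (\<Sum>\<^sub>\<infinity>cd\<in>UNIV \<times> UNIV. V k cd)" .
  qed
  also have "\<dots> = \<kappa> * (\<Sum>\<^sub>\<infinity>cd\<in>UNIV \<times> UNIV. \<Sum>\<^sub>\<infinity>k\<in>?I. V k cd)"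
    unfolding infsum_cmult_right' using infsum_swap_banach[OF Vsum] by simp
  also have "(\<Sum>\<^sub>\<infinity>cd\<in>UNIV \<times> UNIV. \<Sum>\<^sub>\<infinity>k\<in>?I. V k cd) = (\<Sum>\<^sub>\<infinity>(c, d). \<Sum>h\<in>?H. coef h c d * (\<Sum>\<^sub>\<infinity>k\<in>?I. tM h c d k))"
  proof (simp only: UNIV_Times_UNIV, rule infsum_cong)
    fix cd :: "(int^2) \<times> (int^2)"
    obtain c d where cd: "cd = (c, d)" by (cases cd)
    show "(\<Sum>\<^sub>\<infinity>k\<in>?I. V k cd) = (case cd of (c, d) \<Rightarrow> \<Sum>h\<in>?H. coef h c d * (\<Sum>\<^sub>\<infinity>k\<in>?I. tM h c d k))"
      unfolding cd V_def prod.case infsum_cmult_right'[symmetric] by (rule infsum_finite_sum(1)) (auto intro: ksum)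
  qed
  finally have main: "infsum Tlam (coset2 \<sigma> L) = \<kappa> * (\<Sum>\<^sub>\<infinity>(c, d). \<Sum>h\<in>?H. coef h c d * (\<Sum>\<^sub>\<infinity>k\<in>?I. tM h c d k))" .
  have rhs: "(\<lambda>(c, d). \<Sum>h1\<le>m. \<Sum>h2\<le>m. coef (h1, h2) c d * (of_real (sqrt D) * (\<Sum>\<^sub>\<infinity>k\<in>?I. tM (h1, h2) c d k)))
    = (\<lambda>cd. of_real (sqrt D) * (case cd of (c, d) \<Rightarrow> \<Sum>h\<in>?H. coef h c d * (\<Sum>\<^sub>\<infinity>k\<in>?I. tM h c d k)))"
    by (simp add: fun_eq_iff sum.cartesian_product sum_distrib_left case_prod_unfold mult_ac)
  \<comment> \<open>The factor det y of the larger theta function meets 1 / sqrt(det y) from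
    inversion; what remains is the normalisation of the smaller theta function.\<close>
  have "complex_of_real D * \<kappa> = of_real (1 / (2 * N)) * of_real (sqrt D)"
  proof -
    have "D * (1 / (2 * N * sqrt D)) = 1 / (2 * N) * sqrt D"
      using D_pos N_pos by (simp add: field_simps)
    then show ?thesis unfolding \<kappa>_def of_real_mult[symmetric] by simp
  qed
  then show ?thesis unfolding main rhs infsum_cmult_right' by (simp only: mult.assoc[symmetric])
qed

end

text \<open>The vector valued identity is read one component at a time: \<sigma> is a pair of
  representatives in the dual lattice, and its projection to \<open>span M\<close> represents the
  corresponding component on the other side.\<close>

theorem mainTheorem13:
  fixes L M :: "(real^('p::finite + bool)) set"
    and u u' :: "real^('p + bool)"
    and g :: "real^('p + bool)^('p + bool)"
    and \<tau> :: "complex^2^2"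
    and m :: nat
    and P :: "complex^2^('p + bool) \<Rightarrow> complex"
    and Psplit :: "nat \<Rightarrow> nat \<Rightarrow> complex^2^('p + bool) \<Rightarrow> complex"
    and z w wp :: "(real^('p + bool)) set"
    and uz uzp \<mu> \<mu>M :: "real^('p + bool)"
  assumes L_even: "even_lattice L"
    and u_in: "u \<in> L" and u'_in: "u' \<in> L"
    and u_iso: "qf u = 0" and u'_iso: "qf u' = 0" and uu': "bf u u' = 1"
    and M_perp: "M \<subseteq> perpV {u, u'}"
    and L_split: "L = {x + of_int a *\<^sub>R u + of_int b *\<^sub>R u' | x a b. x \<in> M}"
    and P_vh: "very_homog m P"
    and g_SO: "SO_V g"
    and \<tau>_H2: "siegelH2 \<tau>"
    and z_def: "z \<equiv> {x. g *v x \<in> z0}"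
    and uz_def: "uz \<equiv> projV z u"
    and uzp_def: "uzp \<equiv> projV (perpV z) u"
    and w_def: "w \<equiv> z \<inter> perpV {uz}"
    and wp_def: "wp \<equiv> perpV z \<inter> perpV {uzp}"
    and \<mu>_def: "\<mu> \<equiv> - u' + (1 / (2 * bf uzp uzp)) *\<^sub>R uzp + (1 / (2 * bf uz uz)) *\<^sub>R uz"
    and \<mu>M_def: "\<mu>M \<equiv> projV (span M) \<mu>"
    and Psplit_poly: "\<And>h1 h2. poly_mat (Psplit h1 h2)"
    and Psplit_ext: "\<And>h1 h2 x. Psplit h1 h2 x
                        = Psplit h1 h2 (capply (matrix (projV ((*v) g ` wp))) x)"
    and Psplit_id: "\<And>v. P (cmat (mapv ((*v) g) v)) =
          (\<Sum>h1\<le>m. \<Sum>h2\<le>m. complex_of_real (bf (v$1) uzp ^ h1 * bf (v$2) uzp ^ h2)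
              * Psplit h1 h2 (cmat (mapv (\<lambda>x. g *v (projV wp x + projV w x)) v)))"
    and \<sigma>_in: "\<forall>j. \<sigma>$j \<in> dualV L"
  shows "ThetaL L \<tau> g P \<sigma> =
    complex_of_real (1 / (2 * bf uzp uzp)) *
    infsum (\<lambda>(c::int^2, d::int^2).
      (let y = Imat \<tau>; yi = matrix_inv y;
           ctd = (\<lambda>j. (\<Sum>k\<in>UNIV. of_int (c$k) * \<tau>$k$j) + of_int (d$j));
           ctbd = (\<lambda>j. (\<Sum>k\<in>UNIV. of_int (c$k) * cnj (\<tau>$k$j)) + of_int (d$j));
           A = (\<lambda>l. \<Sum>k\<in>UNIV. ctbd k * complex_of_real (yi$k$l))
       in \<Sum>h1\<le>m. \<Sum>h2\<le>m.
            exp (- complex_of_real (pi / (2 * bf uzp uzp))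
                   * (\<Sum>j\<in>UNIV. \<Sum>k\<in>UNIV. ctd j * ctbd k * complex_of_real (yi$k$j)))
            * (A 1 ^ h1 * A 2 ^ h2) / (- 2 * \<i>) ^ (h1 + h2)
            * ThetaM M \<tau> (\<chi> j. of_int (d$j) *\<^sub>R \<mu>M) (\<chi> j. - (of_int (c$j) *\<^sub>R \<mu>M))
                     g w wp (Psplit h1 h2) (mapv (projV (span M)) \<sigma>)))
      UNIV"
proof -
  interpret theta_setting L M u u' g z w wp uz uzp \<mu> \<mu>M P Psplit m \<tau> \<sigma>
  proof unfold_locales
    show "is_lattice L" using L_even by (simp add: even_lattice_def)
    show "bf u u = 0" "bf u' u' = 0" using u_iso u'_iso by (simp_all add: qf_def)
    show "poly_mat P" using P_vh by (simp add: very_homog_def)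
    show "z = {x. g *v x \<in> z0}" "uz = projV z u" "uzp = projV (perpV z) u" "w = z \<inter> perpV {uz}" "wp = perpV z \<inter> perpV {uzp}"
      "\<mu> = - u' + (1 / (2 * bf uzp uzp)) *\<^sub>R uzp + (1 / (2 * bf uz uz)) *\<^sub>R uz" "\<mu>M = projV (span M) \<mu>"
      by (simp_all only: z_def uz_def uzp_def w_def wp_def \<mu>_def \<mu>M_def)
    show "Psplit h1 h2 x = Psplit h1 h2 (capply (matrix (projV ((*v) g ` wp))) x)" for h1 h2 x by (rule Psplit_ext)
  qed (fact u_in u'_in uu' M_perp L_split g_SO Psplit_poly Psplit_id \<tau>_H2 \<sigma>_in)+
  have lhs: "ThetaL L \<tau> g P \<sigma> = of_real D * infsum Tlam (coset2 \<sigma> L)"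
  proof -
    have zz: "{x. g *v x \<in> z0} = z" by (simp only: z_def)
    have "mapv (projV (perpV z)) l = mapv px l" "mapv (projV z) l = mapv nx l" for l
      by (simp_all add: mapv_def projV_perp_z projV_z)
    then show ?thesis
      unfolding ThetaL_def Let_def zz det_Imat Tlam_def[abs_def] yi_def by simp
  qed
  have theta: "ThetaM M \<tau> (\<chi> j. of_int (d$j) *\<^sub>R \<mu>M) (\<chi> j. - (of_int (c$j) *\<^sub>R \<mu>M)) g w wp (Psplit h1 h2) (mapv (projV (span M)) \<sigma>)
     = of_real (sqrt D) * (\<Sum>\<^sub>\<infinity>k\<in>coset2 \<sigma>M M. tM (h1, h2) c d k)" for c d :: "int^2" and h1 h2
  proof -
    have "mapv (projV wp) v = mapv Wp v" "mapv (projV w) v = mapv Wn v" for v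
      by (simp_all add: mapv_def projV_wp projV_w)
    moreover have "(\<lambda>v. g *v (projV wp v + projV w v)) = gw"
      by (simp add: gw_def projV_wp projV_w)
    ultimately show ?thesis
      unfolding ThetaM_def Let_def det_Imat tM_def HP_def Ew_def yi_def[symmetric] \<alpha>d_def \<beta>c_def \<sigma>M_def by simp
  qed
  show ?thesis
    unfolding lhs theta_splitting theta Let_def N_def[symmetric] yi_def[symmetric]
    by (simp only: coef_def Gcd_def Acd_def ctd_def ctbd_def fst_conv snd_conv)
qed

end
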